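(* Let $(X,x_0)$ be a pointed diffeological space. Then there exists a surjective group homomorphism $$\theta_1: G(X,x_0)\to \pi_1^D(X_1,x_0)$$ such that $\theta_1\circ q=q_1$, where $q:\Omega_{\mathrm{st}}(X,x_0)\to G(X,x_0)$ sends a loop to its class in the geometric loop group and $q_1:\Omega_{\mathrm{st}}(X,x_0)\to\pi_1^D(X_1,x_0)$ sends a loop to its class in the smooth fundamental group of the $1$-skeletal diffeological space $X_1$.
   Context: $I=[0,1]$ carries the subset diffeology of $\mathbb{R}$; $D(\cdot,\cdot)$ is the diffeological space of smooth maps. $P(X,x_0)$ is the diffeological space of smooth paths $\gamma:I\to X$ with $\gamma(0)=x_0$. Concatenation is written $*$, with $\gamma$ traversed first in $\gamma*\gamma'$; $\gamma^{-1}(t)=\gamma(1-t)$. A path has sitting instants (is stationary) if it is constant on $[0,\varepsilon)$ and on $(1-\varepsilon,1]$ for some $0<\varepsilon<1/2$; $\Omega_{\mathrm{st}}(X,x_0)$ is the space of smooth loops at $x_0$ with sitting instants. Let $\sim$ be the equivalence relation on $P(X,x_0)$ generated by: ($\sim_1$) $\gamma\sim_1\gamma\circ\varphi$ for every orientation preserving diffeomorphism $\varphi$ of $I$; ($\sim_2$) $\gamma\sim_2\gamma\circ\psi$ for every smooth $\psi:I\to I$ for which there is a proper subinterval $I_0\subset I$ with $\psi(I_0)=\{t_0\}$ constant and $\psi|_{I-I_0}$ an orientation preserving diffeomorphism onto $I-\{t_0\}$; ($\sim_3$) $\alpha*\beta*\beta^{-1}*\eta\sim_3\alpha*\eta$ for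 paths of this form in $P(X,x_0)$ ($\alpha,\beta$ allowed to be empty). The geometric path space is $E(X,x_0)=P(X,x_0)/\!\sim$ with the quotient diffeology, and the geometric loop group $G(X,x_0)$ is the fiber over $x_0$ of the map $E(X,x_0)\to X$, $[\gamma]\mapsto\gamma(1)$, with group structure given by concatenation of loops with sitting instants (every class has such a representative), unit the class of the constant loop and inverses given by reversed loops. $X_1$ is the set $X$ with the $1$-skeletal diffeology: $p:U\to X_1$ is a plot iff locally it is constant or factors through a plot of $X$ with domain of dimension $\le 1$. For a pointed diffeological space $(Y,y_0)$, $\pi_1^D(Y,y_0)$ is the group of smooth path components of the diffeological loop space $D((\mathbb{R},\{0,1\}),(Y,y_0))$ (two points are in the same component if joined by a smooth path $\mathbb{R}\to D((\mathbb{R},\{0,1\}),(Y,y_0))$ from parameter $0$ to parameter $1$), with multiplication by concatenation of representatives with sitting instants. A stationary loop $I\to X$ is extended constantly to $\mathbb{R}$ and is then smooth into $X_1$. *)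

theory Defs
  imports "HOL-Analysis.Analysis" "HOL-Algebra.Group"
begin

section \<open>Smooth maps between open subsets of Euclidean spaces\<close>

text \<open>Since the dimension of the domain of a plot varies, \<open>\<real>\<^sup>n\<close> is the library's
  \<^const>\<open>Euclidean_space\<close> \<open>n\<close>: the functions \<^typ>\<open>nat \<Rightarrow> real\<close> vanishing at all indices \<open>\<ge> n\<close>.\<close>

type_synonym vec = "nat \<Rightarrow> real"

definition partial_deriv :: "nat \<Rightarrow> (vec \<Rightarrow> real) \<Rightarrow> vec \<Rightarrow> real" where
  "partial_deriv i f x = deriv (\<lambda>t. f (x(i := t))) (x i)"

text \<open>For \<open>U\<close> open in \<open>\<real>\<^sup>n\<close>: all iterated partial derivatives of \<open>f\<close> exist and are continuous
  on \<open>U\<close>. The values of \<open>f\<close> outside \<open>U\<close> are irrelevant, as \<open>U\<close> is open.\<close>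

definition smooth_fun :: "nat \<Rightarrow> vec set \<Rightarrow> (vec \<Rightarrow> real) \<Rightarrow> bool" where
  "smooth_fun n U f \<longleftrightarrow> (\<forall>is \<in> lists {..<n}. let g = fold partial_deriv is f in
     continuous_map (subtopology (Euclidean_space n) U) euclideanreal g \<and>
     (\<forall>x\<in>U. \<forall>i<n. (\<lambda>t. g (x(i := t))) field_differentiable (at (x i))))"

definition smooth_vec :: "nat \<Rightarrow> vec set \<Rightarrow> nat \<Rightarrow> vec set \<Rightarrow> (vec \<Rightarrow> vec) \<Rightarrow> bool" where
  "smooth_vec m V n U F \<longleftrightarrow> F \<in> V \<rightarrow> U \<and> (\<forall>i<n. smooth_fun m V (\<lambda>x. F x i))"


section \<open>Diffeological spaces\<close>

text \<open>\<open>plots X n U\<close> is the set of plots of \<open>X\<close> with domain \<open>U \<subseteq> \<real>\<^sup>n\<close>. A plot is a map on \<open>U\<close>;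
  its values outside \<open>U\<close> are arbitrary (axiom \<open>plot_cong\<close>).\<close>

record 'a diffeology = "'a partial_object" +
  plots :: "nat \<Rightarrow> vec set \<Rightarrow> (vec \<Rightarrow> 'a) set"

locale diffeological_space =
  fixes X :: "'a diffeology"
  assumes plot_open: "p \<in> plots X n U \<Longrightarrow> openin (Euclidean_space n) U"
    and plot_carrier: "p \<in> plots X n U \<Longrightarrow> p \<in> U \<rightarrow> carrier X"
    and plot_cong: "p \<in> plots X n U \<Longrightarrow> (\<And>u. u \<in> U \<Longrightarrow> p' u = p u) \<Longrightarrow> p' \<in> plots X n U"
    and plot_const: "openin (Euclidean_space n) U \<Longrightarrow> x \<in> carrier X \<Longrightarrow> (\<lambda>u. x) \<in> plots X n U"
    and plot_local: "openin (Euclidean_space n) U \<Longrightarrow>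
      (\<And>u. u \<in> U \<Longrightarrow> \<exists>V. openin (Euclidean_space n) V \<and> u \<in> V \<and> V \<subseteq> U \<and> p \<in> plots X n V) \<Longrightarrow>
      p \<in> plots X n U"
    and plot_compose: "p \<in> plots X n U \<Longrightarrow> openin (Euclidean_space m) V \<Longrightarrow>
      smooth_vec m V n U F \<Longrightarrow> p \<circ> F \<in> plots X m V"

definition smooth_map :: "'a diffeology \<Rightarrow> 'b diffeology \<Rightarrow> ('a \<Rightarrow> 'b) \<Rightarrow> bool" where
  "smooth_map X Y f \<longleftrightarrow> f \<in> carrier X \<rightarrow> carrier Y \<and>
     (\<forall>n U. \<forall>p \<in> plots X n U. f \<circ> p \<in> plots Y n U)"

definition real_line :: "real diffeology" where
  "real_line = \<lparr>carrier = UNIV,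
     plots = \<lambda>n U. {f. openin (Euclidean_space n) U \<and> smooth_fun n U f}\<rparr>"

definition subset_diff :: "'a diffeology \<Rightarrow> 'a set \<Rightarrow> 'a diffeology" where
  "subset_diff X A = \<lparr>carrier = carrier X \<inter> A, plots = \<lambda>n U. {p \<in> plots X n U. p \<in> U \<rightarrow> A}\<rparr>"

definition quotient_diff :: "'a diffeology \<Rightarrow> ('a \<times> 'a) set \<Rightarrow> 'a set diffeology" where
  "quotient_diff X r = \<lparr>carrier = carrier X // r,
     plots = \<lambda>n U. {p. openin (Euclidean_space n) U \<and>
       (\<forall>u\<in>U. \<exists>V. openin (Euclidean_space n) V \<and> u \<in> V \<and> V \<subseteq> U \<and>
          (\<exists>P \<in> plots X n V. \<forall>v\<in>V. p v = r `` {P v}))}\<rparr>"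

text \<open>\<open>\<real>\<^sup>n\<^sup>+\<^sup>m\<close> is identified with \<open>\<real>\<^sup>n \<times> \<real>\<^sup>m\<close> via \<open>z \<mapsto> (vec_take n z, vec_drop n z)\<close>.\<close>

definition vec_take :: "nat \<Rightarrow> vec \<Rightarrow> vec" where
  "vec_take n z = (\<lambda>i. if i < n then z i else 0)"

definition vec_drop :: "nat \<Rightarrow> vec \<Rightarrow> vec" where
  "vec_drop n z = (\<lambda>i. z (n + i))"

definition vec_times :: "nat \<Rightarrow> vec set \<Rightarrow> nat \<Rightarrow> vec set \<Rightarrow> vec set" where
  "vec_times n U m V =
     {z \<in> topspace (Euclidean_space (n + m)). vec_take n z \<in> U \<and> vec_drop n z \<in> V}"

text \<open>The functional diffeology on \<open>D(X, Y)\<close>. Its points are extensional functions, so that equality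
  of points is equality on \<open>carrier X\<close>.\<close>

definition fun_diff :: "'a diffeology \<Rightarrow> 'b diffeology \<Rightarrow> ('a \<Rightarrow> 'b) diffeology" where
  "fun_diff X Y = \<lparr>carrier = {f \<in> extensional (carrier X). smooth_map X Y f},
     plots = \<lambda>n U. {p. openin (Euclidean_space n) U \<and>
       p \<in> U \<rightarrow> {f \<in> extensional (carrier X). smooth_map X Y f} \<and>
       (\<forall>m V. \<forall>q \<in> plots X m V.
          (\<lambda>z. p (vec_take n z) (q (vec_drop n z))) \<in> plots Y (n + m) (vec_times n U m V))}\<rparr>"

definition one_skeletal :: "'a diffeology \<Rightarrow> 'a diffeology" where
  "one_skeletal X = \<lparr>carrier = carrier X,
     plots = \<lambda>n U. {p. openin (Euclidean_space n) U \<and>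
       (\<forall>u\<in>U. \<exists>V. openin (Euclidean_space n) V \<and> u \<in> V \<and> V \<subseteq> U \<and>
          ((\<exists>x \<in> carrier X. \<forall>v\<in>V. p v = x) \<or>
           (\<exists>m\<le>1. \<exists>W P F. P \<in> plots X m W \<and> smooth_vec n V m W F \<and> (\<forall>v\<in>V. p v = P (F v)))))}\<rparr>"


section \<open>Paths\<close>

abbreviation I01 :: "real diffeology" where
  "I01 \<equiv> subset_diff real_line {0..1}"

abbreviation smooth_paths :: "'a diffeology \<Rightarrow> (real \<Rightarrow> 'a) set" where
  "smooth_paths X \<equiv> carrier (fun_diff I01 X)"

definition path_space :: "'a diffeology \<Rightarrow> 'a \<Rightarrow> (real \<Rightarrow> 'a) diffeology" where
  "path_space X x0 = subset_diff (fun_diff I01 X) {\<gamma>. \<gamma> 0 = x0}"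

definition join :: "(real \<Rightarrow> 'a) \<Rightarrow> (real \<Rightarrow> 'a) \<Rightarrow> real \<Rightarrow> 'a" where
  "join f g = (\<lambda>t. if t \<le> 1/2 then f (2 * t) else g (2 * t - 1))"

definition path_concat :: "(real \<Rightarrow> 'a) \<Rightarrow> (real \<Rightarrow> 'a) \<Rightarrow> real \<Rightarrow> 'a" (infixl \<open>\<star>\<close> 75) where
  "\<gamma> \<star> \<gamma>' = restrict (join \<gamma> \<gamma>') {0..1}"

definition path_rev :: "(real \<Rightarrow> 'a) \<Rightarrow> real \<Rightarrow> 'a" where
  "path_rev \<gamma> = (\<lambda>t\<in>{0..1}. \<gamma> (1 - t))"

definition sitting :: "(real \<Rightarrow> 'a) \<Rightarrow> bool" where
  "sitting \<gamma> \<longleftrightarrow> (\<exists>\<epsilon>. 0 < \<epsilon> \<and> \<epsilon> < 1/2 \<and>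
     (\<forall>t\<in>{0..<\<epsilon>}. \<gamma> t = \<gamma> 0) \<and> (\<forall>t\<in>{1-\<epsilon><..1}. \<gamma> t = \<gamma> 1))"

definition stationary_loops :: "'a diffeology \<Rightarrow> 'a \<Rightarrow> (real \<Rightarrow> 'a) set" where
  "stationary_loops X x0 = {\<gamma> \<in> smooth_paths X. \<gamma> 0 = x0 \<and> \<gamma> 1 = x0 \<and> sitting \<gamma>}"


section \<open>The geometric loop group\<close>

definition op_diffeo :: "real set \<Rightarrow> real set \<Rightarrow> (real \<Rightarrow> real) \<Rightarrow> bool" where
  "op_diffeo S T \<phi> \<longleftrightarrow> bij_betw \<phi> S T \<and>
     smooth_map (subset_diff real_line S) (subset_diff real_line T) \<phi> \<and>
     smooth_map (subset_diff real_line T) (subset_diff real_line S) (inv_into S \<phi>) \<and>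
     (\<forall>t\<in>S. \<exists>d>0. (\<phi> has_real_derivative d) (at t within S))"

text \<open>In \<open>backtrack\<close> and \<open>backtrack_empty\<close> the unbracketed product associates to the left;
  \<open>backtrack_empty\<close> is the case of empty \<open>\<alpha>\<close>. For empty \<open>\<beta>\<close> the relation is the identity.\<close>

inductive geo_step :: "'a diffeology \<Rightarrow> 'a \<Rightarrow> (real \<Rightarrow> 'a) \<Rightarrow> (real \<Rightarrow> 'a) \<Rightarrow> bool"
  for X x0 where
  reparam: "\<gamma> \<in> carrier (path_space X x0) \<Longrightarrow> op_diffeo {0..1} {0..1} \<phi> \<Longrightarrow>
    geo_step X x0 \<gamma> (restrict (\<gamma> \<circ> \<phi>) {0..1})"
| stop: "\<gamma> \<in> carrier (path_space X x0) \<Longrightarrow> smooth_map I01 I01 \<psi> \<Longrightarrow>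
    a < b \<Longrightarrow> {a..b} \<subset> {0..1} \<Longrightarrow> \<psi> ` {a..b} = {t0} \<Longrightarrow>
    op_diffeo ({0..1} - {a..b}) ({0..1} - {t0}) \<psi> \<Longrightarrow>
    geo_step X x0 \<gamma> (restrict (\<gamma> \<circ> \<psi>) {0..1})"
| backtrack: "\<alpha> \<in> smooth_paths X \<Longrightarrow> \<beta> \<in> smooth_paths X \<Longrightarrow> \<eta> \<in> smooth_paths X \<Longrightarrow>
    \<alpha> 1 = \<beta> 0 \<Longrightarrow> \<beta> 0 = \<eta> 0 \<Longrightarrow>
    \<alpha> \<star> \<beta> \<star> path_rev \<beta> \<star> \<eta> \<in> carrier (path_space X x0) \<Longrightarrow>
    \<alpha> \<star> \<eta> \<in> carrier (path_space X x0) \<Longrightarrow>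
    geo_step X x0 (\<alpha> \<star> \<beta> \<star> path_rev \<beta> \<star> \<eta>) (\<alpha> \<star> \<eta>)"
| backtrack_empty: "\<beta> \<in> smooth_paths X \<Longrightarrow> \<beta> 0 = \<eta> 0 \<Longrightarrow>
    \<beta> \<star> path_rev \<beta> \<star> \<eta> \<in> carrier (path_space X x0) \<Longrightarrow>
    \<eta> \<in> carrier (path_space X x0) \<Longrightarrow>
    geo_step X x0 (\<beta> \<star> path_rev \<beta> \<star> \<eta>) \<eta>"

definition geo_rel :: "'a diffeology \<Rightarrow> 'a \<Rightarrow> ((real \<Rightarrow> 'a) \<times> (real \<Rightarrow> 'a)) set" where
  "geo_rel X x0 = {(\<gamma>, \<gamma>'). \<gamma> \<in> carrier (path_space X x0) \<and> \<gamma>' \<in> carrier (path_space X x0) \<and>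
     equivclp (geo_step X x0) \<gamma> \<gamma>'}"

definition geo_path_space :: "'a diffeology \<Rightarrow> 'a \<Rightarrow> (real \<Rightarrow> 'a) set diffeology" where
  "geo_path_space X x0 = quotient_diff (path_space X x0) (geo_rel X x0)"

definition geo_class :: "'a diffeology \<Rightarrow> 'a \<Rightarrow> (real \<Rightarrow> 'a) \<Rightarrow> (real \<Rightarrow> 'a) set" where
  "geo_class X x0 \<gamma> = geo_rel X x0 `` {\<gamma>}"

text \<open>All members of a class have the same endpoint, and the class of \<open>\<gamma> \<star> \<delta>\<close> does not
  depend on the stationary representatives \<open>\<gamma>\<close>, \<open>\<delta>\<close>, so the union below is a single class.\<close>

definition geo_loop_group :: "'a diffeology \<Rightarrow> 'a \<Rightarrow> (real \<Rightarrow> 'a) set monoid" where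
  "geo_loop_group X x0 = \<lparr>
     carrier = {A \<in> carrier (geo_path_space X x0). (\<lambda>\<gamma>. \<gamma> 1) ` A = {x0}},
     mult = \<lambda>A B. \<Union>\<gamma> \<in> A \<inter> stationary_loops X x0. \<Union>\<delta> \<in> B \<inter> stationary_loops X x0.
       geo_class X x0 (\<gamma> \<star> \<delta>),
     one = geo_class X x0 (\<lambda>t\<in>{0..1}. x0)\<rparr>"


section \<open>The smooth fundamental group\<close>

definition loop_space :: "'a diffeology \<Rightarrow> 'a \<Rightarrow> (real \<Rightarrow> 'a) diffeology" where
  "loop_space Y y0 = subset_diff (fun_diff real_line Y) {f. f 0 = y0 \<and> f 1 = y0}"

definition smooth_component_rel :: "'a diffeology \<Rightarrow> ('a \<times> 'a) set" where
  "smooth_component_rel Z = {(a, b). a \<in> carrier Z \<and> b \<in> carrier Z \<and>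
     (\<exists>c. smooth_map real_line Z c \<and> c 0 = a \<and> c 1 = b)}"

definition pi1_class :: "'a diffeology \<Rightarrow> 'a \<Rightarrow> (real \<Rightarrow> 'a) \<Rightarrow> (real \<Rightarrow> 'a) set" where
  "pi1_class Y y0 f = smooth_component_rel (loop_space Y y0) `` {f}"

text \<open>A loop parametrized by \<open>\<real>\<close> is stationary if it is constant near \<open>(-\<infinity>, 0]\<close> and
  near \<open>[1, \<infinity>)\<close>; these are the constant extensions of loops on \<open>[0,1]\<close> with sitting instants.\<close>

definition stationary_real_loops :: "'a diffeology \<Rightarrow> 'a \<Rightarrow> (real \<Rightarrow> 'a) set" where
  "stationary_real_loops Y y0 = {f \<in> carrier (loop_space Y y0).
     \<exists>\<epsilon>. 0 < \<epsilon> \<and> \<epsilon> < 1/2 \<and> (\<forall>t<\<epsilon>. f t = y0) \<and> (\<forall>t>1-\<epsilon>. f t = y0)}"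

text \<open>As for \<^const>\<open>geo_loop_group\<close>, the union is a single class.\<close>

definition smooth_pi1 :: "'a diffeology \<Rightarrow> 'a \<Rightarrow> (real \<Rightarrow> 'a) set monoid" where
  "smooth_pi1 Y y0 = \<lparr>
     carrier = carrier (loop_space Y y0) // smooth_component_rel (loop_space Y y0),
     mult = \<lambda>A B. \<Union>f \<in> A \<inter> stationary_real_loops Y y0. \<Union>g \<in> B \<inter> stationary_real_loops Y y0.
       pi1_class Y y0 (join f g),
     one = pi1_class Y y0 (\<lambda>t. y0)\<rparr>"


section \<open>The two projections from the stationary loops\<close>

definition q_geo :: "'a diffeology \<Rightarrow> 'a \<Rightarrow> (real \<Rightarrow> 'a) \<Rightarrow> (real \<Rightarrow> 'a) set" where
  "q_geo X x0 \<gamma> = geo_class X x0 \<gamma>"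

definition q_one :: "'a diffeology \<Rightarrow> 'a \<Rightarrow> (real \<Rightarrow> 'a) \<Rightarrow> (real \<Rightarrow> 'a) set" where
  "q_one X x0 \<gamma> = pi1_class (one_skeletal X) x0 (\<lambda>t. if t \<in> {0..1} then \<gamma> t else x0)"

end

theory Submission imports Defs begin

text \<open>
  The homomorphism sends the class of a path \<open>\<gamma>\<close> to the class of \<open>\<gamma> \<circ> b\<close>, where \<open>b\<close> is a fixed smooth step
  function with sitting instants (\<open>smoothed\<close>, \<open>base_step\<close>). Every element of either group is the class of a flat
  loop, that is, a loop on \<open>\<real>\<close> that is constant on \<open>(-\<infinity>, e]\<close> and on \<open>[1 - e, \<infinity>)\<close> for some \<open>e > 0\<close>, and on flat loops both
  multiplications are concatenation. Moreover \<open>X\<close> and \<open>X\<^sub>1\<close> have the same curves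
  (\<open>one_skeletal_curve_iff\<close>). So the assignment is a surjective homomorphism compatible with the two projections as soon
  as the generators of the equivalence of paths become homotopies in \<open>X\<^sub>1\<close> and concatenation is
  well defined on both sides.

  A plot of \<open>X\<^sub>1\<close> locally factors through dimension one, so few homotopies exist in \<open>X\<^sub>1\<close>. But a homotopy
  \<open>k (\<phi>(s, t))\<close> obtained from a curve \<open>k\<close> is one of them (\<open>path_homotopic_reparam\<close>). Reparametrizations, stops and
  the cancellation of a backtrack only move points along one path and therefore are
  of this kind (\<open>geo_step_path_homotopic\<close>).

  Three difficulties account for the length of the proof.

  First, a path is smooth on \<open>[0, 1]\<close> in the subset diffeology and need not extend to a curve on \<open>\<real>\<close>. The curve
  \<open>\<gamma> \<circ> sin_fold\<close> with \<open>sin_fold x = sin\<^sup>2 (\<pi> x / 2)\<close> replaces the missing extension. For a step \<open>c\<close> one has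
  \<open>\<gamma> \<circ> c = (\<gamma> \<circ> sin_fold) \<circ> \<rho>\<close> with \<open>\<rho> = 2 / \<pi> * arcsin (sqrt c)\<close>, and the lift \<open>\<rho>\<close> is smooth
  (\<open>smooth_fold_lift\<close>). This rests on the smoothness of the square root of a monotone function that may be flat at
  its zeros (\<open>smooth_sqrt\<close>), which is a consequence of Landau's interpolation inequality for derivatives.

  Second, the generators of the equivalence of paths insert one stop at a time. Composition with a smooth nondecreasing map that
  stands still at finitely many values stays in the class, because such a map is a composition of
  single stops and a diffeomorphism (\<open>proper_rest_map_split\<close>, \<open>geo_rest\<close>). Associativity and the unit
  laws are instances (\<open>invariant_assoc\<close>).

  Third, equivalent paths must have equivalent concatenations with a given path. A stop at the end of \<open>\<gamma>\<close>
  cannot be removed from a concatenation with \<open>d\<close>, as \<open>\<gamma>\<close> and \<open>d\<close> need not fit together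
  smoothly. Inserting a backtrack that continues \<open>\<gamma>\<close> through the folding map makes room for the
  reparametrization (\<open>fold_right\<close>). The statement for the other factor follows by reversing paths
  (\<open>geo_rev\<close>, \<open>geo_join_left\<close>).
\<close>

section \<open>Iterated partial derivatives and the chain rule\<close>

abbreviation Rn :: "nat \<Rightarrow> vec set" where
  "Rn n \<equiv> topspace (Euclidean_space n)"

abbreviation open_Rn :: "nat \<Rightarrow> vec set \<Rightarrow> bool" where
  "open_Rn n \<equiv> openin (Euclidean_space n)"

lemma Rn_iff: "x \<in> Rn n \<longleftrightarrow> (\<forall>i\<ge>n. x i = 0)"
  by (simp add: topspace_Euclidean_space)

lemma Euclidean_space_eq: "Euclidean_space n = top_of_set {x. \<forall>i\<ge>n. x i = 0}"
  by (simp add: Euclidean_space_def euclidean_product_topology)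

lemma openin_Rn_subset: "open_Rn n U \<Longrightarrow> U \<subseteq> Rn n"
  by (rule openin_subset)

lemma openin_Rn_iff: "open_Rn n U \<longleftrightarrow> (\<exists>T. open T \<and> U = Rn n \<inter> T)"
  unfolding Euclidean_space_eq by (auto simp: openin_open)

lemma openin_Rn_trans: "openin (top_of_set U) W \<Longrightarrow> open_Rn n U \<Longrightarrow> open_Rn n W"
  unfolding Euclidean_space_eq by (rule openin_trans)

lemma continuous_map_Rn_iff:
  "open_Rn n U \<Longrightarrow>
   continuous_map (subtopology (Euclidean_space n) U) euclideanreal g \<longleftrightarrow> continuous_on U g"
  using openin_Rn_subset[of n U]
  unfolding Euclidean_space_eq by (simp add: subtopology_subtopology Int_absorb1)

lemma open_vec_contains_box:
  fixes T :: "vec set"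
  assumes "open T" "x \<in> T"
  obtains e where "e > 0" "\<And>y. y \<in> Rn n \<Longrightarrow> x \<in> Rn n \<Longrightarrow> (\<And>i. i < n \<Longrightarrow> \<bar>y i - x i\<bar> < e) \<Longrightarrow> y \<in> T"
proof -
  have "openin (product_topology (\<lambda>i. euclidean) UNIV) T"
    using assms by (simp add: open_fun_def)
  then obtain X where X: "x \<in> (\<Pi>\<^sub>E i\<in>UNIV. X i)" "\<And>i. open (X i)" "(\<Pi>\<^sub>E i\<in>UNIV. X i) \<subseteq> T"
    using product_topology_open_contains_basis[of "\<lambda>i. euclidean" UNIV T x] assms(2) by auto
  have "\<exists>e>0. \<forall>z. \<bar>z - x i\<bar> < e \<longrightarrow> z \<in> X i" for i
    using X(1,2) by (metis PiE_mem UNIV_I open_real)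
  then obtain e where e: "\<And>i. e i > 0" "\<And>i z. \<bar>z - x i\<bar> < e i \<Longrightarrow> z \<in> X i" by metis
  define d where "d = Min (insert 1 (e ` {..<n}))"
  have "d > 0" using e(1) by (auto simp: d_def)
  moreover have "y \<in> T" if "y \<in> Rn n" "x \<in> Rn n" "\<And>i. i < n \<Longrightarrow> \<bar>y i - x i\<bar> < d" for y
  proof -
    have "y i \<in> X i" for i
    proof (cases "i < n")
      case True
      have "d \<le> e i" using True by (auto simp: d_def intro!: Min_le)
      then show ?thesis using that(3)[OF True] e(2)[of "y i" i] by linarith
    next
      case False
      then have "y i = x i" using that by (auto simp: Rn_iff)
      then show ?thesis using X(1) by auto
    qed
    then show ?thesis using X(3) by auto
  qed
  ultimately show ?thesis using that by blast
qed

lemma openin_Rn_contains_box: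
  assumes "open_Rn n U" "x \<in> U"
  obtains e where "e > 0" "\<And>y. y \<in> Rn n \<Longrightarrow> (\<And>i. i < n \<Longrightarrow> \<bar>y i - x i\<bar> < e) \<Longrightarrow> y \<in> U"
proof -
  obtain T where T: "open T" "U = Rn n \<inter> T"
    using assms(1) by (auto simp: openin_Rn_iff)
  then have "x \<in> T" "x \<in> Rn n" using assms(2) by auto
  then obtain e where e: "e > 0" "\<And>y. y \<in> Rn n \<Longrightarrow> x \<in> Rn n \<Longrightarrow> (\<And>i. i < n \<Longrightarrow> \<bar>y i - x i\<bar> < e) \<Longrightarrow> y \<in> T"
    using open_vec_contains_box[OF T(1), of x n] by blast
  show ?thesis
  proof (rule that[OF e(1)])
    fix y assume "y \<in> Rn n" "\<And>i. i < n \<Longrightarrow> \<bar>y i - x i\<bar> < e"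
    then show "y \<in> U" using e(2)[of y] \<open>x \<in> Rn n\<close> T(2) by auto
  qed
qed

lemma openin_Rn_preimage:
  assumes "open_Rn n U" "continuous_on U f" "open T"
  shows "open_Rn n {x \<in> U. f x \<in> T}"
proof -
  have "openin (top_of_set U) (U \<inter> f -` T)"
    using assms(2,3) by (rule continuous_openin_preimage_gen)
  moreover have "U \<inter> f -` T = {x \<in> U. f x \<in> T}" by auto
  ultimately show ?thesis
    using assms(1) by (metis openin_Rn_trans)
qed

lemma upd_in_Rn: "x \<in> Rn n \<Longrightarrow> i < n \<Longrightarrow> x(i := t) \<in> Rn n"
  by (auto simp: Rn_iff)

lemma eventually_upd_in:
  assumes "open_Rn n U" "x \<in> U" "i < n"
  shows "\<forall>\<^sub>F t in nhds (x i). x(i := t) \<in> U"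
proof -
  obtain e where e: "e > 0" "\<And>y. y \<in> Rn n \<Longrightarrow> (\<And>i. i < n \<Longrightarrow> \<bar>y i - x i\<bar> < e) \<Longrightarrow> y \<in> U"
    using openin_Rn_contains_box[OF assms(1,2)] by metis
  have "x \<in> Rn n" using assms openin_Rn_subset by blast
  have "\<forall>\<^sub>F t in nhds (x i). dist t (x i) < e"
    using e(1) by (metis eventually_nhds_metric)
  then show ?thesis
    by eventually_elim (use e upd_in_Rn[OF \<open>x \<in> Rn n\<close> assms(3)] in \<open>auto simp: dist_real_def\<close>)
qed

definition has_partial :: "(vec \<Rightarrow> real) \<Rightarrow> nat \<Rightarrow> vec \<Rightarrow> real \<Rightarrow> bool" where
  "has_partial f i x d \<longleftrightarrow> ((\<lambda>t. f (x(i := t))) has_real_derivative d) (at (x i))"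

text \<open>This notion allows induction on the order of differentiability. It asks for some functions that are
the partial derivatives, rather than for the value of the derivative operator, so that it
transfers along equality on the open set \<open>U\<close>.\<close>

primrec Cdiff :: "nat \<Rightarrow> nat \<Rightarrow> vec set \<Rightarrow> (vec \<Rightarrow> real) \<Rightarrow> bool" where
  "Cdiff 0 n U f \<longleftrightarrow> continuous_on U f"
| "Cdiff (Suc k) n U f \<longleftrightarrow> continuous_on U f \<and>
     (\<exists>g. \<forall>i<n. (\<forall>x\<in>U. has_partial f i x (g i x)) \<and> Cdiff k n U (g i))"

declare Cdiff.simps(2) [simp del]

lemma Cdiff_SucI:
  assumes "continuous_on U f" "\<And>i x. i < n \<Longrightarrow> x \<in> U \<Longrightarrow> has_partial f i x (g i x)"
    "\<And>i. i < n \<Longrightarrow> Cdiff k n U (g i)"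
  shows "Cdiff (Suc k) n U f"
  using assms by (auto simp: Cdiff.simps(2))

lemma Cdiff_SucE:
  assumes "Cdiff (Suc k) n U f"
  obtains g where "continuous_on U f" "\<And>i x. i < n \<Longrightarrow> x \<in> U \<Longrightarrow> has_partial f i x (g i x)"
    "\<And>i. i < n \<Longrightarrow> Cdiff k n U (g i)"
  using assms by (auto simp: Cdiff.simps(2))

lemma Cdiff_continuous: "Cdiff k n U f \<Longrightarrow> continuous_on U f"
  by (cases k) (auto elim: Cdiff_SucE)

lemma has_partial_cong:
  assumes "open_Rn n U" "x \<in> U" "i < n" "\<And>x. x \<in> U \<Longrightarrow> f x = f' x"
    "has_partial f i x d"
  shows "has_partial f' i x d"
proof -
  have ev: "\<forall>\<^sub>F t in nhds (x i). f (x(i := t)) = f' (x(i := t))"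
    using eventually_upd_in[OF assms(1-3)] by eventually_elim (use assms(4) in auto)
  show ?thesis using assms(5) unfolding has_partial_def DERIV_cong_ev[OF refl ev refl] .
qed

lemma Cdiff_cong:
  assumes U: "open_Rn n U" "\<And>x. x \<in> U \<Longrightarrow> f x = f' x" and f: "Cdiff k n U f"
  shows "Cdiff k n U f'"
proof (cases k)
  case 0 then show ?thesis using assms continuous_on_cong by fastforce
next
  case (Suc k')
  obtain g where g: "continuous_on U f" "\<And>i x. i<n \<Longrightarrow> x \<in> U \<Longrightarrow> has_partial f i x (g i x)"
     "\<And>i. i < n \<Longrightarrow> Cdiff k' n U (g i)"
    using f[unfolded Suc] by (rule Cdiff_SucE) (rule that)
  have "continuous_on U f'" using g(1) assms(2) continuous_on_cong by fastforce
  then show ?thesis unfolding Suc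
    using g by (intro Cdiff_SucI[of _ _ _ g]) (auto intro: has_partial_cong[OF U(1) _ _ U(2)])
qed

lemma Cdiff_Suc_imp: "Cdiff (Suc k) n U f \<Longrightarrow> Cdiff k n U f"
proof (induction k arbitrary: f)
  case 0 then show ?case by (auto elim: Cdiff_SucE)
next
  case (Suc k)
  show ?case using Suc.prems
  proof (rule Cdiff_SucE)
    fix g assume "continuous_on U f" "\<And>i x. i < n \<Longrightarrow> x \<in> U \<Longrightarrow> has_partial f i x (g i x)"
      "\<And>i. i < n \<Longrightarrow> Cdiff (Suc k) n U (g i)"
    then show ?thesis using Suc.IH by (intro Cdiff_SucI[of _ _ _ g]) auto
  qed
qed

lemma Cdiff_const [simp]: "Cdiff k n U (\<lambda>x. c)"
proof (induction k arbitrary: c)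
  case (Suc k)
  then show ?case by (intro Cdiff_SucI[of _ _ _ "\<lambda>i x. 0"]) (auto simp: has_partial_def)
qed auto

lemma continuous_on_proj: "continuous_on U (\<lambda>x::vec. x j)"
  by (rule continuous_on_product_then_coordinatewise) (rule continuous_on_id)

lemma Cdiff_proj: "Cdiff k n U (\<lambda>x. x j)"
proof (cases k)
  case 0 then show ?thesis by (simp add: continuous_on_proj)
next
  case (Suc k')
  have "has_partial (\<lambda>x. x j) i x (if i = j then 1 else 0)" for x :: vec and i
    by (cases "i = j") (auto simp: has_partial_def)
  then show ?thesis unfolding Suc
    by (intro Cdiff_SucI[of _ _ _ "\<lambda>i x. if i = j then 1 else 0"]) (auto simp: continuous_on_proj)
qed

lemma has_partial_add: "has_partial f i x d \<Longrightarrow> has_partial g i x e \<Longrightarrow> has_partial (\<lambda>x. f x + g x) i x (d + e)"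
  unfolding has_partial_def by (rule DERIV_add)

lemma has_partial_mult:
  "has_partial f i x d \<Longrightarrow> has_partial g i x e \<Longrightarrow> has_partial (\<lambda>x. f x * g x) i x (d * g x + e * f x)"
  unfolding has_partial_def by (drule (1) DERIV_mult) simp

lemma Cdiff_add: "Cdiff k n U f \<Longrightarrow> Cdiff k n U g \<Longrightarrow> Cdiff k n U (\<lambda>x. f x + g x)"
proof (induction k arbitrary: f g)
  case 0 then show ?case by (auto intro: continuous_intros)
next
  case (Suc k)
  obtain f' where f': "continuous_on U f" "\<And>i x. i<n \<Longrightarrow> x \<in> U \<Longrightarrow> has_partial f i x (f' i x)"
     "\<And>i. i < n \<Longrightarrow> Cdiff k n U (f' i)"
    using Suc.prems(1) by (rule Cdiff_SucE) (rule that)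
  obtain g' where g': "continuous_on U g" "\<And>i x. i<n \<Longrightarrow> x \<in> U \<Longrightarrow> has_partial g i x (g' i x)"
     "\<And>i. i < n \<Longrightarrow> Cdiff k n U (g' i)"
    using Suc.prems(2) by (rule Cdiff_SucE) (rule that)
  show ?case
  proof (rule Cdiff_SucI)
    show "continuous_on U (\<lambda>x. f x + g x)" using f'(1) g'(1) by (rule continuous_on_add)
    show "has_partial (\<lambda>x. f x + g x) i x (f' i x + g' i x)" if "i < n" "x \<in> U" for i x
      using f'(2)[OF that] g'(2)[OF that] by (rule has_partial_add)
    show "Cdiff k n U (\<lambda>x. f' i x + g' i x)" if "i < n" for i
      using f'(3)[OF that] g'(3)[OF that] by (rule Suc.IH)
  qed
qed

lemma Cdiff_mult: "Cdiff k n U f \<Longrightarrow> Cdiff k n U g \<Longrightarrow> Cdiff k n U (\<lambda>x. f x * g x)"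
proof (induction k arbitrary: f g)
  case 0 then show ?case by (auto intro: continuous_intros)
next
  case (Suc k)
  obtain f' where f': "continuous_on U f" "\<And>i x. i<n \<Longrightarrow> x \<in> U \<Longrightarrow> has_partial f i x (f' i x)"
     "\<And>i. i < n \<Longrightarrow> Cdiff k n U (f' i)"
    using Suc.prems(1) by (rule Cdiff_SucE) (rule that)
  obtain g' where g': "continuous_on U g" "\<And>i x. i<n \<Longrightarrow> x \<in> U \<Longrightarrow> has_partial g i x (g' i x)"
     "\<And>i. i < n \<Longrightarrow> Cdiff k n U (g' i)"
    using Suc.prems(2) by (rule Cdiff_SucE) (rule that)
  note fk = Cdiff_Suc_imp[OF Suc.prems(1)] and gk = Cdiff_Suc_imp[OF Suc.prems(2)]
  show ?case
  proof (rule Cdiff_SucI)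
    show "continuous_on U (\<lambda>x. f x * g x)" using f'(1) g'(1) by (rule continuous_on_mult)
    show "has_partial (\<lambda>x. f x * g x) i x (f' i x * g x + g' i x * f x)" if "i < n" "x \<in> U" for i x
      using f'(2)[OF that] g'(2)[OF that] by (rule has_partial_mult)
    show "Cdiff k n U (\<lambda>x. f' i x * g x + g' i x * f x)" if "i < n" for i
      by (rule Cdiff_add[OF Suc.IH[OF f'(3)[OF that] gk] Suc.IH[OF g'(3)[OF that] fk]])
  qed
qed

lemma Cdiff_sum: "finite A \<Longrightarrow> (\<And>a. a \<in> A \<Longrightarrow> Cdiff k n U (f a)) \<Longrightarrow> Cdiff k n U (\<lambda>x. \<Sum>a\<in>A. f a x)"
  by (induction A rule: finite_induct) (auto intro: Cdiff_add)

lemma continuous_on_box: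
  assumes "open_Rn n U" "x \<in> U" "continuous_on U g" "\<epsilon> > 0"
  obtains e where "e > 0"
    "\<And>y. y \<in> Rn n \<Longrightarrow> (\<And>i. i < n \<Longrightarrow> \<bar>y i - x i\<bar> < e) \<Longrightarrow> y \<in> U \<and> \<bar>g y - g x\<bar> < (\<epsilon>::real)"
proof -
  have "open_Rn n {y \<in> U. g y \<in> ball (g x) \<epsilon>}"
    using assms by (intro openin_Rn_preimage) auto
  from openin_Rn_contains_box[OF this, of x] obtain e where "e > 0"
    "\<And>y. y \<in> Rn n \<Longrightarrow> (\<And>i. i < n \<Longrightarrow> \<bar>y i - x i\<bar> < e) \<Longrightarrow> y \<in> {y \<in> U. g y \<in> ball (g x) \<epsilon>}"
    using assms by auto
  then show ?thesis using that by (auto simp: dist_real_def abs_minus_commute)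
qed

text \<open>Only continuity of the partial derivatives is available, so the increment of \<open>f\<close> along the curve is
taken coordinate by coordinate: \<open>mix k t\<close> has the first \<open>k\<close> coordinates of \<open>c t\<close> and the others of
\<open>c t0\<close>, and the mean value theorem applies to each step from \<open>mix k t\<close> to \<open>mix (Suc k) t\<close>.\<close>

lemma chain_rule_curve:
  assumes U: "open_Rn n U"
    and f': "\<And>i x. i < n \<Longrightarrow> x \<in> U \<Longrightarrow> has_partial f i x (f' i x)"
    and f'c: "\<And>i. i < n \<Longrightarrow> continuous_on U (f' i)"
    and c: "\<And>t. c t \<in> Rn n" "c t0 \<in> U"
    and c': "\<And>i. i < n \<Longrightarrow> ((\<lambda>t. c t i) has_real_derivative c' i) (at t0)"
  shows "((\<lambda>t. f (c t)) has_real_derivative (\<Sum>i<n. f' i (c t0) * c' i)) (at t0)"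
proof -
  define mix where "mix k t = (\<lambda>i. if i < k then c t i else c t0 i)" for k :: nat and t
  have mixR: "mix k t \<in> Rn n" for k t using c(1) by (auto simp: mix_def Rn_iff)
  have close: "\<forall>\<^sub>F t in at t0. \<forall>i<n. \<bar>c t i - c t0 i\<bar> < e" if "e > 0" for e
  proof -
    have "\<forall>\<^sub>F t in at t0. \<bar>c t i - c t0 i\<bar> < e" if "i < n" for i
    proof -
      have "isCont (\<lambda>t. c t i) t0" using c'[OF that] DERIV_isCont by blast
      then have "((\<lambda>t. c t i) \<longlongrightarrow> c t0 i) (at t0)" by (simp add: isCont_def)
      from tendstoD[OF this \<open>e > 0\<close>] show ?thesis by (simp add: dist_real_def)
    qed
    then have "\<forall>\<^sub>F t in at t0. \<forall>i\<in>{..<n}. \<bar>c t i - c t0 i\<bar> < e"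
      by (intro eventually_ball_finite) auto
    then show ?thesis by (simp add: Ball_def)
  qed
  have step: "((\<lambda>t. f (mix (Suc k) t) - f (mix k t)) has_real_derivative f' k (c t0) * c' k) (at t0)"
    if k: "k < n" for k
  proof -
    obtain r where r: "r > 0"
      "\<And>y. y \<in> Rn n \<Longrightarrow> (\<And>i. i < n \<Longrightarrow> \<bar>y i - c t0 i\<bar> < r) \<Longrightarrow> y \<in> U"
      using openin_Rn_contains_box[OF U c(2)] by metis
    define good where "good t \<longleftrightarrow> (\<forall>i<n. \<bar>c t i - c t0 i\<bar> < r)" for t
    have "\<exists>\<xi>. good t \<longrightarrow> \<bar>\<xi> - c t0 k\<bar> \<le> \<bar>c t k - c t0 k\<bar> \<and>
       f (mix (Suc k) t) - f (mix k t) = (c t k - c t0 k) * f' k ((mix k t)(k := \<xi>))" for t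
    proof (cases "good t")
      case True
      have eqs: "mix (Suc k) t = (mix k t)(k := c t k)" "mix k t = (mix k t)(k := c t0 k)"
        by (auto simp: mix_def fun_eq_iff less_Suc_eq)
      have inU: "(mix k t)(k := \<xi>) \<in> U" if "\<bar>\<xi> - c t0 k\<bar> \<le> \<bar>c t k - c t0 k\<bar>" for \<xi>
      proof (rule r(2))
        show "(mix k t)(k := \<xi>) \<in> Rn n" using mixR k by (rule upd_in_Rn)
        fix i assume "i < n"
        show "\<bar>((mix k t)(k := \<xi>)) i - c t0 i\<bar> < r"
          using True that r(1) \<open>i < n\<close> k by (auto simp: good_def mix_def intro: le_less_trans)
      qed
      have D: "((\<lambda>\<xi>. f ((mix k t)(k := \<xi>))) has_real_derivative f' k ((mix k t)(k := \<xi>))) (at \<xi>)"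
        if "\<bar>\<xi> - c t0 k\<bar> \<le> \<bar>c t k - c t0 k\<bar>" for \<xi>
        using f'[OF k inU[OF that]] by (simp add: has_partial_def)
      consider "c t k = c t0 k" | "c t0 k < c t k" | "c t k < c t0 k" by linarith
      then show ?thesis
      proof cases
        case 1
        then have "mix (Suc k) t = mix k t" using eqs by metis
        then show ?thesis using 1 by auto
      next
        case 2
        obtain z where "z > c t0 k" "z < c t k"
          "f ((mix k t)(k := c t k)) - f ((mix k t)(k := c t0 k)) = (c t k - c t0 k) * f' k ((mix k t)(k := z))"
          using MVT2[OF 2 D] by force
        then show ?thesis using eqs(1) eqs(2)[symmetric] by (intro exI[of _ z]) auto
      next
        case 3
        obtain z where "z > c t k" "z < c t0 k"
          "f ((mix k t)(k := c t0 k)) - f ((mix k t)(k := c t k)) = (c t0 k - c t k) * f' k ((mix k t)(k := z))"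
          using MVT2[OF 3 D] by force
        then show ?thesis using eqs(1) eqs(2)[symmetric] by (intro exI[of _ z]) (auto simp: algebra_simps)
      qed
    qed auto
    then obtain \<xi> where \<xi>: "\<And>t. good t \<Longrightarrow> \<bar>\<xi> t - c t0 k\<bar> \<le> \<bar>c t k - c t0 k\<bar>"
       "\<And>t. good t \<Longrightarrow> f (mix (Suc k) t) - f (mix k t) = (c t k - c t0 k) * f' k ((mix k t)(k := \<xi> t))"
      by metis
    have lim1: "((\<lambda>t. (c t k - c t0 k) / (t - t0)) \<longlongrightarrow> c' k) (at t0)"
      using c'[OF k] by (simp add: has_field_derivative_iff)
    have lim2: "((\<lambda>t. f' k ((mix k t)(k := \<xi> t))) \<longlongrightarrow> f' k (c t0)) (at t0)"
    proof (rule tendstoI)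
      fix \<epsilon> :: real assume "\<epsilon> > 0"
      then obtain e where e: "e > 0" "\<And>y. y \<in> Rn n \<Longrightarrow> (\<And>i. i < n \<Longrightarrow> \<bar>y i - c t0 i\<bar> < e) \<Longrightarrow>
          y \<in> U \<and> \<bar>f' k y - f' k (c t0)\<bar> < \<epsilon>"
        using continuous_on_box[OF U c(2) f'c[OF k]] by metis
      show "\<forall>\<^sub>F t in at t0. dist (f' k ((mix k t)(k := \<xi> t))) (f' k (c t0)) < \<epsilon>"
        using close[OF e(1)] close[OF r(1)]
      proof eventually_elim
        case (elim t)
        then have "good t" by (simp add: good_def)
        have "\<bar>((mix k t)(k := \<xi> t)) i - c t0 i\<bar> < e" if "i < n" for i
          using elim that \<xi>(1)[OF \<open>good t\<close>] k e(1) by (auto simp: mix_def intro: le_less_trans)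
        then show ?case using e(2)[of "(mix k t)(k := \<xi> t)"] upd_in_Rn[OF mixR k] by (auto simp: dist_real_def)
      qed
    qed
    have "((\<lambda>t. (f (mix (Suc k) t) - f (mix k t)) / (t - t0)) \<longlongrightarrow> f' k (c t0) * c' k) (at t0)"
    proof (rule Lim_transform_eventually[OF tendsto_mult[OF lim2 lim1]])
      show "\<forall>\<^sub>F t in at t0. f' k ((mix k t)(k := \<xi> t)) * ((c t k - c t0 k) / (t - t0)) =
         (f (mix (Suc k) t) - f (mix k t)) / (t - t0)"
        using close[OF r(1)] by eventually_elim (use \<xi>(2) in \<open>auto simp: good_def\<close>)
    qed
    moreover have "mix m t0 = c t0" for m by (auto simp: mix_def)
    ultimately show ?thesis by (simp add: has_field_derivative_iff)
  qed
  have "((\<lambda>t. f (mix k t)) has_real_derivative (\<Sum>i<k. f' i (c t0) * c' i)) (at t0)" if "k \<le> n" for k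
    using that
  proof (induction k)
    case 0 then show ?case by (simp add: mix_def)
  next
    case (Suc k)
    then show ?case using DERIV_add[OF Suc.IH step[of k]] by (simp add: algebra_simps)
  qed
  from this[of n] have "((\<lambda>t. f (mix n t)) has_real_derivative (\<Sum>i<n. f' i (c t0) * c' i)) (at t0)" by simp
  moreover have "mix n = c" using c(1) by (fastforce simp: mix_def Rn_iff fun_eq_iff)
  ultimately show ?thesis by simp
qed

lemma Cdiff_compose:
  assumes U: "open_Rn n U" and V: "open_Rn m V"
    and F: "F \<in> V \<rightarrow> U"
  shows "Cdiff k n U f \<Longrightarrow> (\<And>i. i < n \<Longrightarrow> Cdiff k m V (\<lambda>x. F x i)) \<Longrightarrow> Cdiff k m V (\<lambda>x. f (F x))"
proof -
  have FR: "F x \<in> Rn n" if "x \<in> V" for x using F U openin_Rn_subset that by blast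
  have cont: "continuous_on V (\<lambda>x. f (F x))"
    if "continuous_on U f" "\<And>i. i < n \<Longrightarrow> continuous_on V (\<lambda>x. F x i)" for f
  proof -
    have "continuous_on V (\<lambda>x. F x i)" for i
    proof (cases "i < n")
      case False
      then have "F x i = 0" if "x \<in> V" for x using FR[OF that] by (simp add: Rn_iff)
      then have "continuous_on V (\<lambda>x. F x i) \<longleftrightarrow> continuous_on V (\<lambda>x. 0::real)" by (rule continuous_on_cong[OF refl])
      then show ?thesis by simp
    next
      case True then show ?thesis by (rule that(2))
    qed
    then have "continuous_on V F" by (rule continuous_on_coordinatewise_then_product)
    then show ?thesis by (rule continuous_on_compose2[OF that(1)]) (use F in blast)
  qed
  show "Cdiff k m V (\<lambda>x. f (F x))" if "Cdiff k n U f" "\<And>i. i < n \<Longrightarrow> Cdiff k m V (\<lambda>x. F x i)"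
    using that
  proof (induction k arbitrary: f)
    case 0
    have "continuous_on V (\<lambda>x. F x i)" if "i < n" for i using 0(2)[OF that] by (simp only: Cdiff.simps(1))
    then show ?case using cont[of f] 0(1) by (simp only: Cdiff.simps(1))
  next
    case (Suc k)
    obtain f' where f': "continuous_on U f" "\<And>i x. i<n \<Longrightarrow> x \<in> U \<Longrightarrow> has_partial f i x (f' i x)"
       "\<And>i. i < n \<Longrightarrow> Cdiff k n U (f' i)"
      using Suc.prems(1) by (rule Cdiff_SucE) (rule that)
    have "\<exists>G. \<forall>j<m. (\<forall>x\<in>V. has_partial (\<lambda>x. F x i) j x (G j x)) \<and> Cdiff k m V (G j)" if "i < n" for i
      using Suc.prems(2)[OF that] unfolding Cdiff.simps(2) by (rule conjunct2)
    then have "\<exists>F'. \<forall>i. i < n \<longrightarrow> (\<forall>j<m. (\<forall>x\<in>V. has_partial (\<lambda>x. F x i) j x (F' i j x)) \<and> Cdiff k m V (F' i j))"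
      by (intro choice) blast
    then obtain F' where F': "\<And>i j x. i<n \<Longrightarrow> j < m \<Longrightarrow> x \<in> V \<Longrightarrow> has_partial (\<lambda>x. F x i) j x (F' i j x)"
        "\<And>i j. i < n \<Longrightarrow> j < m \<Longrightarrow> Cdiff k m V (F' i j)"
      by blast
    define h where "h j x = (\<Sum>i<n. f' i (F x) * F' i j x)" for j x
    show ?case
    proof (rule Cdiff_SucI)
      show "has_partial (\<lambda>x. f (F x)) j x (h j x)" if j: "j < m" and x: "x \<in> V" for j x
      proof -
        define c where "c t = (if x(j := t) \<in> V then F (x(j := t)) else F x)" for t
        have ev: "\<forall>\<^sub>F t in nhds (x j). c t = F (x(j := t))"
          using eventually_upd_in[OF V x j] by eventually_elim (simp add: c_def)
        have c0: "c (x j) = F x" using x by (simp add: c_def)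
        have "((\<lambda>t. f (c t)) has_real_derivative (\<Sum>i<n. f' i (c (x j)) * F' i j x)) (at (x j))"
        proof (rule chain_rule_curve[OF U f'(2)])
          show "continuous_on U (f' i)" if "i < n" for i using f'(3)[OF that] Cdiff_continuous by blast
          show "c t \<in> Rn n" for t using FR x by (auto simp: c_def)
          show "c (x j) \<in> U" using c0 F x by auto
          show "((\<lambda>t. c t i) has_real_derivative F' i j x) (at (x j))" if "i < n" for i
          proof -
            have "\<forall>\<^sub>F t in nhds (x j). c t i = F (x(j := t)) i" using ev by (auto elim: eventually_mono)
            from DERIV_cong_ev[OF refl this refl] show ?thesis
              using F'(1)[OF that j x] by (simp add: has_partial_def)
          qed
        qed auto
        moreover have "\<forall>\<^sub>F t in nhds (x j). f (c t) = f (F (x(j := t)))" using ev by (auto elim: eventually_mono)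
        note DERIV_cong_ev[OF refl this refl]
        ultimately show ?thesis using c0 by (simp add: h_def has_partial_def)
      qed
      show "Cdiff k m V (h j)" if j: "j < m" for j
        unfolding h_def
      proof (rule Cdiff_sum)
        fix i assume "i \<in> {..<n}"
        then have i: "i < n" by simp
        have "Cdiff k m V (\<lambda>x. F x i)" if "i < n" for i
          using Suc.prems(2)[OF that] by (rule Cdiff_Suc_imp)
        from Suc.IH[OF f'(3)[OF i] this] have "Cdiff k m V (\<lambda>x. f' i (F x))" .
        then show "Cdiff k m V (\<lambda>x. f' i (F x) * F' i j x)" using F'(2)[OF i j] by (rule Cdiff_mult)
      qed simp
      show "continuous_on V (\<lambda>x. f (F x))"
      proof (rule cont[OF f'(1)])
        fix i assume "i < n"
        from Cdiff_continuous[OF Suc.prems(2)[OF this]] show "continuous_on V (\<lambda>x. F x i)" .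
      qed
    qed
  qed
qed

lemma partial_deriv_eq: "has_partial f i x d \<Longrightarrow> partial_deriv i f x = d"
  by (simp add: partial_deriv_def has_partial_def DERIV_imp_deriv)

lemma Cdiff_partial_deriv:
  assumes U: "open_Rn n U" and f: "Cdiff (Suc k) n U f" and i: "i < n"
  shows "Cdiff k n U (partial_deriv i f)"
  using f
proof (rule Cdiff_SucE)
  fix g assume g: "\<And>i x. i < n \<Longrightarrow> x \<in> U \<Longrightarrow> has_partial f i x (g i x)" "\<And>i. i < n \<Longrightarrow> Cdiff k n U (g i)"
  show ?thesis
    by (rule Cdiff_cong[OF U _ g(2)[OF i]]) (simp add: partial_deriv_eq[OF g(1)[OF i]])
qed

lemma field_differentiable_iff_has_partial:
  "(\<lambda>t. f (x(i := t))) field_differentiable (at (x i)) \<longleftrightarrow> has_partial f i x (partial_deriv i f x)"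
  unfolding has_partial_def partial_deriv_def by (rule DERIV_deriv_iff_field_differentiable[symmetric])

lemma smooth_fun_iff_partial:
  assumes U: "open_Rn n U"
  shows "smooth_fun n U f \<longleftrightarrow> (\<forall>is\<in>lists {..<n}. continuous_on U (fold partial_deriv is f) \<and>
    (\<forall>x\<in>U. \<forall>i<n. has_partial (fold partial_deriv is f) i x (partial_deriv i (fold partial_deriv is f) x)))"
  unfolding smooth_fun_def Let_def field_differentiable_iff_has_partial continuous_map_Rn_iff[OF U] ..

lemma smooth_fun_iff_Cdiff:
  assumes U: "open_Rn n U"
  shows "smooth_fun n U f \<longleftrightarrow> (\<forall>k. Cdiff k n U f)"
proof
  assume "\<forall>k. Cdiff k n U f"
  have B: "continuous_on U f \<and> (\<forall>x\<in>U. \<forall>i<n. has_partial f i x (partial_deriv i f x))" if "Cdiff (Suc 0) n U f" for f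
    using that by (rule Cdiff_SucE) (metis partial_deriv_eq)
  have "(\<forall>k. Cdiff k n U f) \<Longrightarrow> is \<in> lists {..<n} \<Longrightarrow> continuous_on U (fold partial_deriv is f) \<and>
    (\<forall>x\<in>U. \<forall>i<n. has_partial (fold partial_deriv is f) i x (partial_deriv i (fold partial_deriv is f) x))" for "is" f
  proof (induction "is" arbitrary: f)
    case Nil
    then show ?case using B by simp
  next
    case (Cons i "is")
    then have "\<forall>k. Cdiff k n U (partial_deriv i f)" using Cdiff_partial_deriv[OF U] by auto
    then show ?case using Cons by simp
  qed
  then show "smooth_fun n U f" using \<open>\<forall>k. _\<close> by (simp add: smooth_fun_iff_partial[OF U])
next
  have D: "smooth_fun n U (partial_deriv i f)" if f: "smooth_fun n U f" and i: "i < n" for f i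
    unfolding smooth_fun_iff_partial[OF U]
  proof
    fix "is" assume "is \<in> lists {..<n}"
    then have "i # is \<in> lists {..<n}" using i by simp
    from f[unfolded smooth_fun_iff_partial[OF U], rule_format, OF this]
    show "continuous_on U (fold partial_deriv is (partial_deriv i f)) \<and>
      (\<forall>x\<in>U. \<forall>j<n. has_partial (fold partial_deriv is (partial_deriv i f)) j x
        (partial_deriv j (fold partial_deriv is (partial_deriv i f)) x))" by simp
  qed
  have B: "continuous_on U f" "\<And>i x. i < n \<Longrightarrow> x \<in> U \<Longrightarrow> has_partial f i x (partial_deriv i f x)"
    if "smooth_fun n U f" for f
    using that[unfolded smooth_fun_iff_partial[OF U], rule_format, of "[]"] by auto
  have "smooth_fun n U f \<Longrightarrow> Cdiff k n U f" for k
  proof (induction k arbitrary: f)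
    case 0 then show ?case using B by auto
  next
    case (Suc k)
    show ?case by (rule Cdiff_SucI[of _ _ _ "\<lambda>i. partial_deriv i f"]) (use B[OF Suc.prems] Suc.IH[OF D[OF Suc.prems]] in auto)
  qed
  then show "smooth_fun n U f \<Longrightarrow> \<forall>k. Cdiff k n U f" by blast
qed

lemma smooth_fun_compose:
  assumes U: "open_Rn n U" and V: "open_Rn m V"
    and f: "smooth_fun n U f" and F: "smooth_vec m V n U F"
  shows "smooth_fun m V (\<lambda>x. f (F x))"
  unfolding smooth_fun_iff_Cdiff[OF V]
proof
  fix k
  show "Cdiff k m V (\<lambda>x. f (F x))"
  proof (rule Cdiff_compose[OF U V, where f = f and F = F])
    show "F \<in> V \<rightarrow> U" using F by (simp add: smooth_vec_def)
    show "Cdiff k n U f" using f by (simp add: smooth_fun_iff_Cdiff[OF U])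
    show "Cdiff k m V (\<lambda>x. F x i)" if "i < n" for i
      using F that by (simp add: smooth_fun_iff_Cdiff[OF V] smooth_vec_def)
  qed
qed

lemma smooth_vec_compose:
  assumes "open_Rn n U" "open_Rn m V"
    "smooth_vec n U p W G" "smooth_vec m V n U F"
  shows "smooth_vec m V p W (\<lambda>x. G (F x))"
  unfolding smooth_vec_def
proof (intro conjI allI impI)
  show "(\<lambda>x. G (F x)) \<in> V \<rightarrow> W" using assms(3,4) by (auto simp: smooth_vec_def)
  fix i assume "i < p"
  then have "smooth_fun n U (\<lambda>x. G x i)" using assms(3) by (simp add: smooth_vec_def)
  from smooth_fun_compose[OF assms(1,2) this assms(4)] show "smooth_fun m V (\<lambda>x. G (F x) i)" .
qed

lemma smooth_fun_cong:
  "open_Rn n U \<Longrightarrow> smooth_fun n U f \<Longrightarrow> (\<And>x. x \<in> U \<Longrightarrow> f x = f' x) \<Longrightarrow> smooth_fun n U f'"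
  using Cdiff_cong[of n U f f'] by (simp only: smooth_fun_iff_Cdiff) blast

lemma smooth_fun_subset:
  "open_Rn n U \<Longrightarrow> open_Rn n V \<Longrightarrow> V \<subseteq> U \<Longrightarrow> smooth_fun n U f \<Longrightarrow> smooth_fun n V f"
  unfolding smooth_fun_iff_partial by (meson continuous_on_subset subsetD)

lemma smooth_fun_local:
  assumes U: "open_Rn n U"
    and loc: "\<And>x. x \<in> U \<Longrightarrow> \<exists>V. open_Rn n V \<and> x \<in> V \<and> V \<subseteq> U \<and> smooth_fun n V f"
  shows "smooth_fun n U f"
  unfolding smooth_fun_iff_partial[OF U]
proof (intro ballI conjI)
  fix "is" assume "is": "is \<in> lists {..<n}"
  let ?g = "fold partial_deriv is f"
  have g: "\<exists>V. open_Rn n V \<and> x \<in> V \<and> V \<subseteq> U \<and> continuous_on V ?g \<and>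
      (\<forall>x\<in>V. \<forall>i<n. has_partial ?g i x (partial_deriv i ?g x))" if "x \<in> U" for x
    using loc[OF that] "is" by (metis smooth_fun_iff_partial)
  then show "\<And>x i. x \<in> U \<Longrightarrow> \<forall>i<n. has_partial ?g i x (partial_deriv i ?g x)" by blast
  have "continuous (at x within U) ?g" if x: "x \<in> U" for x
  proof -
    obtain V where V: "open_Rn n V" "x \<in> V" "V \<subseteq> U" "continuous_on V ?g"
      using g[OF x] by blast
    then obtain T where T: "open T" "V = Rn n \<inter> T" by (auto simp: openin_Rn_iff)
    then have VT: "U \<inter> T = V" using V openin_Rn_subset[OF U] by auto
    have "at x within V = at x within U"
      by (rule at_within_nhd[of _ T]) (use V T VT in auto)
    then show ?thesis using V by (metis continuous_on_eq_continuous_within)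
  qed
  then show "continuous_on U ?g" by (simp add: continuous_on_eq_continuous_within)
qed

lemma smooth_fun_continuous: "open_Rn n U \<Longrightarrow> smooth_fun n U f \<Longrightarrow> continuous_on U f"
  using smooth_fun_iff_Cdiff Cdiff_continuous by blast

lemma smooth_fun_const: "open_Rn n U \<Longrightarrow> smooth_fun n U (\<lambda>x. c)"
  and smooth_fun_proj: "open_Rn n U \<Longrightarrow> smooth_fun n U (\<lambda>x. x j)"
  and smooth_fun_add: "open_Rn n U \<Longrightarrow> smooth_fun n U f \<Longrightarrow> smooth_fun n U g \<Longrightarrow> smooth_fun n U (\<lambda>x. f x + g x)"
  and smooth_fun_mult: "open_Rn n U \<Longrightarrow> smooth_fun n U f \<Longrightarrow> smooth_fun n U g \<Longrightarrow> smooth_fun n U (\<lambda>x. f x * g x)"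
  using Cdiff_const Cdiff_proj Cdiff_add Cdiff_mult by (auto simp only: smooth_fun_iff_Cdiff)

lemma smooth_vec_continuous:
  assumes V: "open_Rn m V" and F: "smooth_vec m V n U F" and U: "U \<subseteq> Rn n"
  shows "continuous_on V F"
proof (rule continuous_on_coordinatewise_then_product)
  fix i
  show "continuous_on V (\<lambda>x. F x i)"
  proof (cases "i < n")
    case False
    have "F x i = 0" if "x \<in> V" for x
    proof -
      have "F x \<in> Rn n" using F U that by (auto simp: smooth_vec_def)
      then show ?thesis using False by (simp add: Rn_iff)
    qed
    then have "continuous_on V (\<lambda>x. F x i) \<longleftrightarrow> continuous_on V (\<lambda>x. 0::real)" by (rule continuous_on_cong[OF refl])
    then show ?thesis by simp
  next
    case True
    then have "smooth_fun m V (\<lambda>x. F x i)" using F by (simp add: smooth_vec_def)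
    then show ?thesis by (rule smooth_fun_continuous[OF V])
  qed
qed

lemma openin_smooth_vec_preimage:
  assumes "open_Rn m V" "open_Rn n U" "open_Rn n W"
    "smooth_vec m V n U F"
  shows "open_Rn m {x \<in> V. F x \<in> W}"
proof -
  obtain T where T: "open T" "W = Rn n \<inter> T"
    using assms(3) by (auto simp: openin_Rn_iff)
  have "F x \<in> Rn n" if "x \<in> V" for x using assms(2,4) openin_Rn_subset that by (force simp: smooth_vec_def)
  then have "{x \<in> V. F x \<in> W} = V \<inter> F -` T" using T by auto
  moreover have "openin (top_of_set V) (V \<inter> F -` T)"
    using smooth_vec_continuous[OF assms(1,4) openin_Rn_subset[OF assms(2)]] T(1) by (rule continuous_openin_preimage_gen)
  ultimately show ?thesis using assms(1) by (metis openin_Rn_trans)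
qed

declare One_nat_def [simp del]

section \<open>Smooth functions of one real variable\<close>

definition vec1 :: "real \<Rightarrow> vec" where
  "vec1 s = (\<lambda>i. if i = 0 then s else 0)"

lemma vec1_0 [simp]: "vec1 s 0 = s" and vec1_Rn: "vec1 s \<in> Rn 1" and Rn1_eq: "x \<in> Rn 1 \<Longrightarrow> vec1 (x 0) = x"
  by (auto simp: vec1_def Rn_iff fun_eq_iff)

lemma openin_Rn_UNIV [simp]: "open_Rn n (Rn n)"
  by (rule openin_topspace)

lemma openin_coord: "open B \<Longrightarrow> open_Rn n {x \<in> Rn n. x i \<in> B}"
  using openin_Rn_preimage[of n "Rn n" "\<lambda>x. x i" B] continuous_on_proj by auto

text \<open>A function of one variable is treated as a function on an open subset of \<open>\<real>\<^sup>1\<close>, so that the closure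
properties come from the several-variable theory.\<close>

definition Ck_on :: "nat \<Rightarrow> real set \<Rightarrow> (real \<Rightarrow> real) \<Rightarrow> bool" where
  "Ck_on k S f \<longleftrightarrow> Cdiff k 1 {x \<in> Rn 1. x 0 \<in> S} (\<lambda>x. f (x 0))"

definition smooth_on :: "real set \<Rightarrow> (real \<Rightarrow> real) \<Rightarrow> bool" where
  "smooth_on S f \<longleftrightarrow> (\<forall>k. Ck_on k S f)"

lemma Ck_on_0: "Ck_on 0 S f \<longleftrightarrow> continuous_on S f"
proof
  assume "Ck_on 0 S f"
  have "continuous_on S vec1"
  proof (rule continuous_on_coordinatewise_then_product)
    show "continuous_on S (\<lambda>x. vec1 x i)" for i by (cases "i = 0") (simp_all add: vec1_def continuous_on_id)
  qed
  then have "continuous_on S (\<lambda>s. f (vec1 s 0))"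
    using \<open>Ck_on 0 S f\<close> unfolding Ck_on_def Cdiff.simps(1)
    by (intro continuous_on_compose2[of "{x \<in> Rn 1. x 0 \<in> S}" "\<lambda>x. f (x 0)" S vec1]) (auto simp: vec1_Rn)
  then show "continuous_on S f" by simp
next
  assume "continuous_on S f"
  then show "Ck_on 0 S f" unfolding Ck_on_def Cdiff.simps(1)
    by (rule continuous_on_compose2[OF _ continuous_on_proj]) auto
qed

lemma has_partial_coord: "has_partial (\<lambda>x. f (x 0)) 0 x d \<longleftrightarrow> (f has_real_derivative d) (at (x 0))"
  by (simp add: has_partial_def)

lemma Ck_on_SucI:
  assumes "open S" and D: "\<And>x. x \<in> S \<Longrightarrow> (f has_real_derivative f' x) (at x)" and "Ck_on k S f'"
  shows "Ck_on (Suc k) S f"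
  unfolding Ck_on_def
proof (rule Cdiff_SucI[where g = "\<lambda>i x. f' (x 0)"])
  have "continuous_on S f" using D DERIV_isCont continuous_at_imp_continuous_on by blast
  then show "continuous_on {x \<in> Rn 1. x 0 \<in> S} (\<lambda>x. f (x 0))"
    by (rule continuous_on_compose2[OF _ continuous_on_proj]) auto
qed (use D assms(3) in \<open>simp_all add: has_partial_coord Ck_on_def\<close>)

lemma Ck_on_SucD:
  assumes "Ck_on (Suc k) S f"
  shows "x \<in> S \<Longrightarrow> (f has_real_derivative deriv f x) (at x)" "open S \<Longrightarrow> Ck_on k S (deriv f)"
proof -
  obtain g where g: "\<And>i x. i < 1 \<Longrightarrow> x \<in> {x \<in> Rn 1. x 0 \<in> S} \<Longrightarrow> has_partial (\<lambda>x. f (x 0)) i x (g i x)"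
    "\<And>i. i < 1 \<Longrightarrow> Cdiff k 1 {x \<in> Rn 1. x 0 \<in> S} (g i)"
    using assms unfolding Ck_on_def by (rule Cdiff_SucE) (rule that)
  have D: "(f has_real_derivative g 0 x) (at (x 0))" if "x \<in> Rn 1" "x 0 \<in> S" for x
    using g(1)[of 0 x] that by (simp add: has_partial_coord)
  show "(f has_real_derivative deriv f x) (at x)" if "x \<in> S"
    using D[of "vec1 x"] that vec1_Rn DERIV_imp_deriv by fastforce
  show "Ck_on k S (deriv f)" if "open S" unfolding Ck_on_def
    by (rule Cdiff_cong[OF openin_coord[OF that] _ g(2)]) (use D DERIV_imp_deriv in force)+
qed

lemma smooth_on_subset: "smooth_on S f \<Longrightarrow> open S \<Longrightarrow> open T \<Longrightarrow> T \<subseteq> S \<Longrightarrow> smooth_on T f"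
  unfolding smooth_on_def Ck_on_def smooth_fun_iff_Cdiff[OF openin_coord, symmetric]
  by (erule smooth_fun_subset[OF openin_coord openin_coord, rotated 3]) auto

lemma smooth_on_iff_smooth_fun:
  "open S \<Longrightarrow> smooth_on S h \<longleftrightarrow> smooth_fun 1 {x \<in> Rn 1. x 0 \<in> S} (\<lambda>x. h (x 0))"
  by (simp add: smooth_on_def Ck_on_def smooth_fun_iff_Cdiff openin_coord)

lemma smooth_on_DERIV: "smooth_on S f \<Longrightarrow> x \<in> S \<Longrightarrow> (f has_real_derivative deriv f x) (at x)"
  unfolding smooth_on_def using Ck_on_SucD(1) by blast

lemma smooth_on_deriv: "open S \<Longrightarrow> smooth_on S f \<Longrightarrow> smooth_on S (deriv f)"
  unfolding smooth_on_def using Ck_on_SucD(2) by blast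

lemma smooth_on_continuous: "smooth_on S f \<Longrightarrow> continuous_on S f"
  unfolding smooth_on_def using Ck_on_0 by blast

lemma smooth_on_isCont: "smooth_on UNIV f \<Longrightarrow> isCont f x"
  using smooth_on_DERIV[of UNIV f x] DERIV_isCont by blast

lemma smooth_on_DERIV_intro:
  assumes "open S" "\<And>x. x \<in> S \<Longrightarrow> (f has_real_derivative f' x) (at x)" "smooth_on S f'"
  shows "smooth_on S f"
  unfolding smooth_on_def
proof
  fix k
  have "Ck_on (Suc k) S f" using assms(3) Ck_on_SucI[OF assms(1,2), where k = k] by (simp only: smooth_on_def)
  then show "Ck_on k S f" unfolding Ck_on_def by (rule Cdiff_Suc_imp)
qed

lemma Ck_on_const: "Ck_on k S (\<lambda>x. c)"
  and Ck_on_id: "Ck_on k S (\<lambda>x. x)"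
  and Ck_on_add: "Ck_on k S f \<Longrightarrow> Ck_on k S g \<Longrightarrow> Ck_on k S (\<lambda>x. f x + g x)"
  and Ck_on_mult: "Ck_on k S f \<Longrightarrow> Ck_on k S g \<Longrightarrow> Ck_on k S (\<lambda>x. f x * g x)"
  by (simp_all add: Ck_on_def Cdiff_const Cdiff_proj Cdiff_add Cdiff_mult)

lemma Ck_on_compose:
  assumes "open S" "open T" "f ` S \<subseteq> T" "Ck_on k T g" "Ck_on k S f"
  shows "Ck_on k S (\<lambda>x. g (f x))"
proof -
  have "Cdiff k 1 {x \<in> Rn 1. x 0 \<in> S} (\<lambda>x. g (vec1 (f (x 0)) 0))"
    by (rule Cdiff_compose[OF openin_coord[OF assms(2)] openin_coord[OF assms(1)], where f = "\<lambda>x. g (x 0)" and F = "\<lambda>x. vec1 (f (x 0))"])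
       (use assms(3-5) vec1_Rn in \<open>auto simp: Ck_on_def\<close>)
  then show ?thesis by (simp add: Ck_on_def)
qed

lemma smooth_on_const: "smooth_on S (\<lambda>x. c)"
  and smooth_on_id: "smooth_on S (\<lambda>x. x)"
  by (simp_all add: smooth_on_def Ck_on_const Ck_on_id)

lemma smooth_on_add: "open S \<Longrightarrow> smooth_on S f \<Longrightarrow> smooth_on S g \<Longrightarrow> smooth_on S (\<lambda>x. f x + g x)"
  and smooth_on_mult: "open S \<Longrightarrow> smooth_on S f \<Longrightarrow> smooth_on S g \<Longrightarrow> smooth_on S (\<lambda>x. f x * g x)"
  by (simp_all add: smooth_on_def Ck_on_add Ck_on_mult)

lemma smooth_on_compose:
  "open S \<Longrightarrow> open T \<Longrightarrow> f ` S \<subseteq> T \<Longrightarrow> smooth_on T g \<Longrightarrow> smooth_on S f \<Longrightarrow> smooth_on S (\<lambda>x. g (f x))"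
  unfolding smooth_on_def using Ck_on_compose[of S T f] by blast

lemma smooth_on_compose_UNIV:
  "smooth_on UNIV g \<Longrightarrow> open S \<Longrightarrow> smooth_on S f \<Longrightarrow> smooth_on S (\<lambda>x. g (f x))"
  by (rule smooth_on_compose[of S UNIV f g]) auto

lemma smooth_on_minus: "open S \<Longrightarrow> smooth_on S f \<Longrightarrow> smooth_on S (\<lambda>x. - f x)"
  using smooth_on_mult[of S "\<lambda>x. -1" f] smooth_on_const[of S "-1"] by simp

lemma smooth_on_diff: "open S \<Longrightarrow> smooth_on S f \<Longrightarrow> smooth_on S g \<Longrightarrow> smooth_on S (\<lambda>x. f x - g x)"
  using smooth_on_add[of S f "\<lambda>x. - g x"] smooth_on_minus[of S g] by simp

lemma smooth_on_cmult: "open S \<Longrightarrow> smooth_on S f \<Longrightarrow> smooth_on S (\<lambda>x. c * f x)"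
  using smooth_on_mult[of S "\<lambda>x. c" f] smooth_on_const[of S c] by simp

lemma smooth_on_divide_const: "open S \<Longrightarrow> smooth_on S f \<Longrightarrow> smooth_on S (\<lambda>x. f x / c)"
  using smooth_on_cmult[of S f "1/c"] by simp

lemma smooth_on_inverse: 
  assumes "open S" "smooth_on S f" "\<And>x. x \<in> S \<Longrightarrow> f x \<noteq> 0"
  shows "smooth_on S (\<lambda>x. inverse (f x))"
proof -
  have "Ck_on k S (\<lambda>x. inverse (f x))" for k
  proof (induction k)
    case 0 show ?case using assms smooth_on_continuous[of S f] by (simp add: Ck_on_0 continuous_on_inverse)
  next
    case (Suc k)
    have "Ck_on k S (\<lambda>x. inverse (f x) * inverse (f x) * deriv f x)"
      using Suc smooth_on_deriv[OF assms(1,2)] by (intro Ck_on_mult) (auto simp: smooth_on_def)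
    then have "Ck_on k S (\<lambda>x. (-1) * (inverse (f x) * inverse (f x) * deriv f x))"
      by (intro Ck_on_mult[OF Ck_on_const])
    moreover have "((\<lambda>x. inverse (f x)) has_real_derivative
        (-1) * (inverse (f x) * inverse (f x) * deriv f x)) (at x)" if "x \<in> S" for x
      using DERIV_inverse'[OF smooth_on_DERIV[OF assms(2) that] assms(3)[OF that]] by (simp add: ac_simps)
    ultimately show ?case by (intro Ck_on_SucI[OF assms(1)]) auto
  qed
  then show ?thesis by (simp add: smooth_on_def)
qed

lemma smooth_on_divide:
  "open S \<Longrightarrow> smooth_on S f \<Longrightarrow> smooth_on S g \<Longrightarrow> (\<And>x. x \<in> S \<Longrightarrow> g x \<noteq> 0) \<Longrightarrow> smooth_on S (\<lambda>x. f x / g x)"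
  unfolding divide_inverse by (intro smooth_on_mult smooth_on_inverse)

lemma smooth_on_sin: "smooth_on UNIV (sin :: real \<Rightarrow> real)"
proof -
  have ds: "(sin has_real_derivative cos x) (at x)" and dc: "(cos has_real_derivative (-1) * sin x) (at x)" for x :: real
    using DERIV_cos[of x] by (simp_all add: DERIV_sin)
  have "Ck_on k UNIV (sin :: real \<Rightarrow> real) \<and> Ck_on k UNIV (cos :: real \<Rightarrow> real)" for k
  proof (induction k)
    case 0 show ?case by (simp add: Ck_on_0 continuous_intros)
  next
    case (Suc k)
    have "Ck_on k UNIV (\<lambda>x. (-1) * sin x :: real)" using Suc Ck_on_const by (intro Ck_on_mult) auto
    then show ?case using Suc Ck_on_SucI[OF open_UNIV ds] Ck_on_SucI[OF open_UNIV dc] by blast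
  qed
  then show ?thesis by (simp add: smooth_on_def)
qed

lemma smooth_fun_compose1:
  assumes U: "open_Rn n U" and q: "smooth_fun n U q" "q \<in> U \<rightarrow> S" and h: "smooth_on S h" and S: "open S"
  shows "smooth_fun n U (\<lambda>x. h (q x))"
proof -
  have "smooth_vec n U 1 {x \<in> Rn 1. x 0 \<in> S} (\<lambda>x. vec1 (q x))"
    using q vec1_Rn by (auto simp: smooth_vec_def)
  from smooth_fun_compose[OF openin_coord[OF S] U h[unfolded smooth_on_iff_smooth_fun[OF S]] this] show ?thesis by simp
qed

lemma smooth_fun_coord: "smooth_on UNIV r \<Longrightarrow> smooth_fun n (Rn n) (\<lambda>x. r (x i))"
  by (rule smooth_fun_compose1[OF openin_Rn_UNIV smooth_fun_proj[OF openin_Rn_UNIV]]) auto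

section \<open>Plots, curves and the 1-skeletal diffeology\<close>

lemma real_line_simps [simp]:
  "carrier real_line = UNIV"
  "q \<in> plots real_line n U \<longleftrightarrow> open_Rn n U \<and> smooth_fun n U q"
  by (simp_all add: real_line_def)

lemma subset_diff_simps [simp]:
  "carrier (subset_diff X A) = carrier X \<inter> A"
  "p \<in> plots (subset_diff X A) n U \<longleftrightarrow> p \<in> plots X n U \<and> p \<in> U \<rightarrow> A"
  by (simp_all add: subset_diff_def)

abbreviation curve :: "'a diffeology \<Rightarrow> (real \<Rightarrow> 'a) \<Rightarrow> bool" where
  "curve X \<equiv> smooth_map real_line X"

abbreviation paths_from :: "'a diffeology \<Rightarrow> 'a \<Rightarrow> (real \<Rightarrow> 'a) set" where
  "paths_from X x0 \<equiv> carrier (path_space X x0)"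

abbreviation geo_equiv :: "'a diffeology \<Rightarrow> 'a \<Rightarrow> (real \<Rightarrow> 'a) \<Rightarrow> (real \<Rightarrow> 'a) \<Rightarrow> bool" where
  "geo_equiv X x0 \<equiv> equivclp (geo_step X x0)"

context diffeological_space
begin

lemma plot_restrict:
  assumes "p \<in> plots X n U" "open_Rn n V" "V \<subseteq> U"
  shows "p \<in> plots X n V"
proof -
  have "smooth_vec n V n U (\<lambda>x. x)"
    using assms(2,3) by (auto simp: smooth_vec_def smooth_fun_proj)
  from plot_compose[OF assms(1,2) this] show ?thesis by (simp add: comp_def)
qed

lemma plot_localI:
  assumes "open_Rn n U"
    "\<And>u. u \<in> U \<Longrightarrow> \<exists>V p'. open_Rn n V \<and> u \<in> V \<and> p' \<in> plots X n V \<and> (\<forall>v\<in>V \<inter> U. p v = p' v)"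
  shows "p \<in> plots X n U"
proof (rule plot_local[OF assms(1)])
  fix u assume "u \<in> U"
  then obtain V p' where V: "open_Rn n V" "u \<in> V" "p' \<in> plots X n V" "\<forall>v\<in>V \<inter> U. p v = p' v"
    using assms(2) by blast
  have o: "open_Rn n (V \<inter> U)" using V(1) assms(1) by blast
  have "p' \<in> plots X n (V \<inter> U)" using plot_restrict[OF V(3) o] by simp
  then have "p \<in> plots X n (V \<inter> U)" by (rule plot_cong) (use V(4) in auto)
  then show "\<exists>V. open_Rn n V \<and> u \<in> V \<and> V \<subseteq> U \<and> p \<in> plots X n V"
    using o V(2) \<open>u \<in> U\<close> by (intro exI[of _ "V \<inter> U"]) auto
qed

lemma smooth_map_plot: "curve X f \<Longrightarrow> open_Rn n U \<Longrightarrow> smooth_fun n U q \<Longrightarrow>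
    (\<lambda>u. f (q u)) \<in> plots X n U"
  by (auto simp: smooth_map_def comp_def)

lemma curve_carrier: "curve X f \<Longrightarrow> f t \<in> carrier X"
  by (auto simp: smooth_map_def)

lemma curve_iff_plot: "curve X f \<longleftrightarrow> (\<lambda>x. f (x 0)) \<in> plots X 1 (Rn 1)"
proof
  show "(\<lambda>x. f (x 0)) \<in> plots X 1 (Rn 1)" if "curve X f"
    by (rule smooth_map_plot[OF that]) (auto simp: smooth_fun_proj)
next
  assume p: "(\<lambda>x. f (x 0)) \<in> plots X 1 (Rn 1)"
  have "f t \<in> carrier X" for t
    using plot_carrier[OF p] vec1_Rn[of t] by (metis Pi_mem vec1_0)
  moreover have "f \<circ> q \<in> plots X n U" if U: "open_Rn n U" and q: "smooth_fun n U q" for q n U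
  proof -
    have "smooth_vec n U 1 (Rn 1) (\<lambda>u. vec1 (q u))" using q vec1_Rn by (auto simp: smooth_vec_def)
    from plot_compose[OF p U this] show ?thesis by (simp add: comp_def)
  qed
  ultimately show "curve X f" by (simp add: smooth_map_def)
qed

lemma curve_localI:
  assumes "\<And>t. \<exists>B g. open B \<and> t \<in> B \<and> (\<lambda>x. g (x 0)) \<in> plots X 1 {x \<in> Rn 1. x 0 \<in> B} \<and> (\<forall>s\<in>B. f s = g s)"
  shows "curve X f"
  unfolding curve_iff_plot
proof (rule plot_localI)
  fix u assume "u \<in> Rn 1"
  obtain B g where B: "open B" "u 0 \<in> B" "(\<lambda>x. g (x 0)) \<in> plots X 1 {x \<in> Rn 1. x 0 \<in> B}" "\<forall>s\<in>B. f s = g s"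
    using assms by blast
  show "\<exists>V p'. open_Rn 1 V \<and> u \<in> V \<and> p' \<in> plots X 1 V \<and> (\<forall>v\<in>V \<inter> Rn 1. f (v 0) = p' v)"
    by (rule exI[of _ "{x \<in> Rn 1. x 0 \<in> B}"], rule exI[of _ "\<lambda>x. g (x 0)"])
       (use B openin_coord[OF B(1)] \<open>u \<in> Rn 1\<close> in auto)
qed simp

lemma curve_plot: "curve X f \<Longrightarrow> open B \<Longrightarrow> (\<lambda>x. f (x i)) \<in> plots X n {x \<in> Rn n. x j \<in> B}"
  by (intro smooth_map_plot smooth_fun_proj openin_coord)

lemma curve_glue:
  assumes "curve X g" "curve X h" "a < b"
    "\<And>t. t < b \<Longrightarrow> f t = g t" "\<And>t. t > a \<Longrightarrow> f t = h t"
  shows "curve X f"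
proof (rule curve_localI)
  fix t
  show "\<exists>B g. open B \<and> t \<in> B \<and> (\<lambda>x. g (x 0)) \<in> plots X 1 {x \<in> Rn 1. x 0 \<in> B} \<and> (\<forall>s\<in>B. f s = g s)"
  proof (cases "t < b")
    case True
    show ?thesis by (rule exI[of _ "{..<b}"], rule exI[of _ g])
      (use True assms(4) curve_plot[OF assms(1), of "{..<b}" 0 1 0] in auto)
  next
    case False
    show ?thesis by (rule exI[of _ "{a<..}"], rule exI[of _ h])
      (use False assms(3,5) curve_plot[OF assms(2), of "{a<..}" 0 1 0] in auto)
  qed
qed

lemma curve_const: "x \<in> carrier X \<Longrightarrow> curve X (\<lambda>t. x)"
  using plot_const by (simp add: curve_iff_plot)

lemma curve_compose: 
  assumes "curve X f" "smooth_on UNIV r"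
  shows "curve X (\<lambda>t. f (r t))"
  unfolding curve_iff_plot
  by (rule smooth_map_plot[OF assms(1)]) (use assms(2) smooth_fun_coord[of r 1 0] in auto)

lemma path_plot:
  assumes "smooth_map I01 X \<gamma>" "open_Rn n U" "smooth_fun n U q" "q \<in> U \<rightarrow> {0..1}"
  shows "(\<lambda>u. \<gamma> (q u)) \<in> plots X n U"
  using assms by (auto simp: smooth_map_def comp_def)

lemma path_compose:
  assumes "smooth_map I01 X \<gamma>" "smooth_on UNIV r" "\<And>t. r t \<in> {0..1}"
  shows "curve X (\<lambda>t. \<gamma> (r t))"
  unfolding curve_iff_plot
  by (rule path_plot[OF assms(1)]) (use assms(2,3) smooth_fun_coord[of r 1 0] in auto)

end

abbreviation unit_path :: "(real \<Rightarrow> 'a) \<Rightarrow> real \<Rightarrow> 'a" where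
  "unit_path f \<equiv> restrict f {0..1}"

lemma smooth_paths_iff: "\<gamma> \<in> smooth_paths X \<longleftrightarrow> \<gamma> \<in> extensional {0..1} \<and> smooth_map I01 X \<gamma>"
  by (simp add: fun_diff_def)

lemma path_space_iff: "\<gamma> \<in> paths_from X x0 \<longleftrightarrow> \<gamma> \<in> smooth_paths X \<and> \<gamma> 0 = x0"
  by (auto simp: path_space_def)

lemma (in diffeological_space) smooth_map_I01_cong:
  assumes "smooth_map I01 X f" "\<And>t. t \<in> {0..1} \<Longrightarrow> g t = f t"
  shows "smooth_map I01 X g"
  unfolding smooth_map_def
proof (intro conjI allI ballI)
  show "g \<in> carrier I01 \<rightarrow> carrier X" using assms by (auto simp: smooth_map_def)
  fix n U q assume q: "q \<in> plots I01 n U"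
  then have "f \<circ> q \<in> plots X n U" using assms(1) by (simp add: smooth_map_def)
  then show "g \<circ> q \<in> plots X n U" by (rule plot_cong) (use q in \<open>auto intro: assms(2)\<close>)
qed

lemma (in diffeological_space) unit_path_in_smooth_paths:
  "smooth_map I01 X f \<Longrightarrow> unit_path f \<in> smooth_paths X"
  unfolding smooth_paths_iff using smooth_map_I01_cong[of f "unit_path f"] by auto

lemma (in diffeological_space) curve_imp_I01: "curve X f \<Longrightarrow> smooth_map I01 X f"
  by (auto simp: smooth_map_def)

lemma (in diffeological_space) curve_in_smooth_paths:
  "curve X f \<Longrightarrow> unit_path f \<in> smooth_paths X"
  by (intro unit_path_in_smooth_paths curve_imp_I01)

lemma one_skeletal_carrier [simp]: "carrier (one_skeletal X) = carrier X"
  by (simp add: one_skeletal_def)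

definition skeletal_germ :: "'a diffeology \<Rightarrow> nat \<Rightarrow> vec set \<Rightarrow> (vec \<Rightarrow> 'a) \<Rightarrow> bool" where
  "skeletal_germ X n V p \<longleftrightarrow> (\<exists>x \<in> carrier X. \<forall>v\<in>V. p v = x) \<or>
           (\<exists>m\<le>1. \<exists>W P F. P \<in> plots X m W \<and> smooth_vec n V m W F \<and> (\<forall>v\<in>V. p v = P (F v)))"

lemma one_skeletal_plots: "p \<in> plots (one_skeletal X) n U \<longleftrightarrow> open_Rn n U \<and>
   (\<forall>u\<in>U. \<exists>V. open_Rn n V \<and> u \<in> V \<and> V \<subseteq> U \<and> skeletal_germ X n V p)"
  by (simp add: one_skeletal_def skeletal_germ_def)

lemma one_skeletal_diffeological:
  assumes "diffeological_space X"
  shows "diffeological_space (one_skeletal X)"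
proof
  interpret diffeological_space X by fact
  show "open_Rn n U" if "p \<in> plots (one_skeletal X) n U" for p n U
    using that by (simp add: one_skeletal_plots)
  show "p \<in> U \<rightarrow> carrier (one_skeletal X)" if p: "p \<in> plots (one_skeletal X) n U" for p n U
  proof
    fix u assume "u \<in> U"
    then obtain V where V: "u \<in> V" "skeletal_germ X n V p" using p by (meson one_skeletal_plots)
    then show "p u \<in> carrier (one_skeletal X)"
      using plot_carrier unfolding skeletal_germ_def smooth_vec_def by fastforce
  qed
  show "p' \<in> plots (one_skeletal X) n U" if "p \<in> plots (one_skeletal X) n U" "\<And>u. u \<in> U \<Longrightarrow> p' u = p u" for p p' n U
  proof -
    have "skeletal_germ X n V p'" if "skeletal_germ X n V p" "V \<subseteq> U" for V
    proof -
      have "\<forall>v\<in>V. p' v = p v" using that(2) \<open>\<And>u. u \<in> U \<Longrightarrow> p' u = p u\<close> by blast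
      then show ?thesis using that(1) unfolding skeletal_germ_def by (metis (no_types, lifting))
    qed
    then show ?thesis using that(1) unfolding one_skeletal_plots by meson
  qed
  show "(\<lambda>u. x) \<in> plots (one_skeletal X) n U" if "open_Rn n U" "x \<in> carrier (one_skeletal X)" for x n U
    using that unfolding one_skeletal_plots skeletal_germ_def by auto
  show "p \<in> plots (one_skeletal X) n U" if "open_Rn n U" and
    loc: "\<And>u. u \<in> U \<Longrightarrow> \<exists>V. open_Rn n V \<and> u \<in> V \<and> V \<subseteq> U \<and> p \<in> plots (one_skeletal X) n V" for p n U
    unfolding one_skeletal_plots
  proof (intro conjI ballI)
    fix u assume "u \<in> U"
    then obtain V where "u \<in> V" "V \<subseteq> U" "p \<in> plots (one_skeletal X) n V" using loc by blast
    then show "\<exists>V. open_Rn n V \<and> u \<in> V \<and> V \<subseteq> U \<and> skeletal_germ X n V p"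
      unfolding one_skeletal_plots by (meson order_trans)
  qed fact
  show "p \<circ> F \<in> plots (one_skeletal X) m V" if p: "p \<in> plots (one_skeletal X) n U" and V: "open_Rn m V"
    and F: "smooth_vec m V n U F" for p n U m V F
    unfolding one_skeletal_plots
  proof (intro conjI ballI)
    fix v assume v: "v \<in> V"
    have U: "open_Rn n U" using p by (simp add: one_skeletal_plots)
    have "F v \<in> U" using F v by (auto simp: smooth_vec_def)
    then obtain W where W: "open_Rn n W" "F v \<in> W" "W \<subseteq> U" "skeletal_germ X n W p"
      using p by (meson one_skeletal_plots)
    define V' where "V' = {x \<in> V. F x \<in> W}"
    have V': "open_Rn m V'" "v \<in> V'" "V' \<subseteq> V" "\<And>x. x \<in> V' \<Longrightarrow> F x \<in> W"
      using openin_smooth_vec_preimage[OF V U W(1) F] v W(2) by (auto simp: V'_def)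
    have F': "smooth_vec m V' n W F"
      using F V' smooth_fun_subset[OF V V'(1,3)] by (auto simp: smooth_vec_def)
    have "skeletal_germ X m V' (p \<circ> F)"
      using W(4) unfolding skeletal_germ_def
    proof (elim disjE)
      assume "\<exists>x\<in>carrier X. \<forall>v\<in>W. p v = x"
      then have "\<exists>x\<in>carrier X. \<forall>v\<in>V'. (p \<circ> F) v = x" using V'(4) by auto
      then show "(\<exists>x\<in>carrier X. \<forall>v\<in>V'. (p \<circ> F) v = x) \<or>
        (\<exists>ma\<le>1. \<exists>W P Fa. P \<in> plots X ma W \<and> smooth_vec m V' ma W Fa \<and> (\<forall>v\<in>V'. (p \<circ> F) v = P (Fa v)))" by (rule disjI1)
    next
      assume "\<exists>m\<le>1. \<exists>Wa P F. P \<in> plots X m Wa \<and> smooth_vec n W m Wa F \<and> (\<forall>v\<in>W. p v = P (F v))"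
      then obtain k Wa P G where P: "k \<le> 1" "P \<in> plots X k Wa" "smooth_vec n W k Wa G" "\<forall>v\<in>W. p v = P (G v)"
        by blast
      have "smooth_vec m V' k Wa (\<lambda>x. G (F x))" by (rule smooth_vec_compose[OF W(1) V'(1) P(3) F'])
      moreover have "\<forall>v\<in>V'. (p \<circ> F) v = P ((\<lambda>x. G (F x)) v)" using P(4) V'(4) by auto
      ultimately show "(\<exists>x\<in>carrier X. \<forall>v\<in>V'. (p \<circ> F) v = x) \<or>
        (\<exists>ma\<le>1. \<exists>W P Fa. P \<in> plots X ma W \<and> smooth_vec m V' ma W Fa \<and> (\<forall>v\<in>V'. (p \<circ> F) v = P (Fa v)))"
        using P(1,2) by blast
    qed
    then show "\<exists>Va. open_Rn m Va \<and> v \<in> Va \<and> Va \<subseteq> V \<and> skeletal_germ X m Va (p \<circ> F)" using V' by blast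
  qed fact
qed

context diffeological_space
begin

text \<open>The identity \<open>X\<^sub>1 \<rightarrow> X\<close> is smooth, because a plot of \<open>X\<^sub>1\<close> locally is a plot of \<open>X\<close> composed with a
smooth map.\<close>

lemma one_skeletal_plot_imp_plot:
  assumes "p \<in> plots (one_skeletal X) n U"
  shows "p \<in> plots X n U"
proof (rule plot_localI)
  show "open_Rn n U" using assms by (simp add: one_skeletal_plots)
  fix u assume "u \<in> U"
  then obtain V where V: "open_Rn n V" "u \<in> V" "V \<subseteq> U" "skeletal_germ X n V p"
    using assms by (meson one_skeletal_plots)
  from V(4) have "\<exists>p' \<in> plots X n V. \<forall>v\<in>V. p v = p' v"
    unfolding skeletal_germ_def
  proof (elim disjE bexE exE conjE)
    fix x assume "x \<in> carrier X" "\<forall>v\<in>V. p v = x"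
    then show ?thesis using plot_const[OF V(1)] by (intro bexI[of _ "\<lambda>v. x"]) auto
  next
    fix m W P F assume "P \<in> plots X m W" "smooth_vec n V m W F" "\<forall>v\<in>V. p v = P (F v)"
    then show ?thesis using plot_compose[of P m W n V F] V(1) by (intro bexI[of _ "P \<circ> F"]) auto
  qed
  then show "\<exists>V p'. open_Rn n V \<and> u \<in> V \<and> p' \<in> plots X n V \<and> (\<forall>v\<in>V \<inter> U. p v = p' v)"
    using V by blast
qed

text \<open>A plot of \<open>X\<close> with a domain of dimension one factors through itself. Hence the paths in \<open>X\<close> and in \<open>X\<^sub>1\<close>
are the same; the two spaces differ in plots of higher dimension such as homotopies.\<close>

lemma one_skeletal_curve_iff: "curve (one_skeletal X) f \<longleftrightarrow> curve X f"
proof -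
  interpret sk: diffeological_space "one_skeletal X"
    by (rule one_skeletal_diffeological) (rule diffeological_space_axioms)
  show ?thesis
  proof
    show "curve X f" if "curve (one_skeletal X) f"
      using that one_skeletal_plot_imp_plot unfolding curve_iff_plot sk.curve_iff_plot by blast
    assume f: "curve X f"
    have id: "smooth_vec 1 (Rn 1) 1 (Rn 1) (\<lambda>x. x)" by (auto simp: smooth_vec_def smooth_fun_proj)
    have "skeletal_germ X 1 (Rn 1) (\<lambda>x. f (x 0))"
      unfolding skeletal_germ_def using f[unfolded curve_iff_plot] id by blast
    then show "curve (one_skeletal X) f"
      unfolding sk.curve_iff_plot one_skeletal_plots by (metis openin_Rn_UNIV subset_refl)
  qed
qed

end

declare One_nat_def [simp]

section \<open>Elementary facts on derivatives\<close>

lemma DERIV_within_unique: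
  fixes f :: "real \<Rightarrow> real"
  assumes "(f has_real_derivative d) (at x within S)" "(f has_real_derivative e) (at x within S)" "x islimpt S"
  shows "d = e"
  using assms unfolding has_field_derivative_iff
  by (intro tendsto_unique[of "at x within S"]) (auto simp: trivial_limit_within)

lemma islimpt_Icc_real: "p < q \<Longrightarrow> x \<in> {p..q} \<Longrightarrow> x islimpt {p..q}" for x :: real
  using islimpt_Icc[of p q x] by simp

lemma DERIV_zero_if_constant_near:
  fixes f :: "real \<Rightarrow> real"
  assumes "(f has_real_derivative d) (at x within S)" "{p..q} \<subseteq> S" "p < q" "x \<in> {p..q}" "\<And>y. y \<in> {p..q} \<Longrightarrow> f y = k"
  shows "d = 0"
proof (rule DERIV_within_unique)
  show "(f has_real_derivative d) (at x within {p..q})" using assms(1,2) by (rule has_field_derivative_subset)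
  have "((\<lambda>y. k) has_real_derivative 0) (at x within {p..q})" by simp
  then show "(f has_real_derivative 0) (at x within {p..q})"
    by (rule has_field_derivative_transform_within[of _ _ _ _ 1]) (use assms(4,5) in auto)
  show "x islimpt {p..q}" using assms(3,4) by (rule islimpt_Icc_real)
qed

text \<open>This gives the derivative at the places where a function glued from two formulas vanishes to high order.\<close>

lemma DERIV_zero_if_quadratic:
  fixes f :: "real \<Rightarrow> real"
  assumes "f x0 = 0" "\<And>x. \<bar>f x\<bar> \<le> C * \<bar>x - x0\<bar>^2"
  shows "(f has_real_derivative 0) (at x0)"
proof -
  have "((\<lambda>x. (f x - f x0) / (x - x0)) \<longlongrightarrow> 0) (at x0)"
  proof (rule Lim_null_comparison[where g = "\<lambda>x. C * \<bar>x - x0\<bar>"])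
    show "\<forall>\<^sub>F x in at x0. norm ((f x - f x0) / (x - x0)) \<le> C * \<bar>x - x0\<bar>"
      unfolding eventually_at_filter
    proof (rule always_eventually, intro allI impI)
      fix x assume "x \<noteq> x0" 
      then have "\<bar>f x\<bar> / \<bar>x - x0\<bar> \<le> C * \<bar>x - x0\<bar>"
        using assms(2)[of x] by (simp add: field_simps power2_eq_square)
      then show "norm ((f x - f x0) / (x - x0)) \<le> C * \<bar>x - x0\<bar>" by (simp add: assms(1))
    qed
    have "((\<lambda>x. C * \<bar>x - x0\<bar>) \<longlongrightarrow> C * \<bar>x0 - x0\<bar>) (at x0)" by (intro tendsto_intros)
    then show "((\<lambda>x. C * \<bar>x - x0\<bar>) \<longlongrightarrow> 0) (at x0)" by simp
  qed
  then show ?thesis by (simp add: has_field_derivative_iff)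
qed

lemma DERIV_nonneg_if_mono:
  fixes f :: "real \<Rightarrow> real"
  assumes "(f has_real_derivative d) (at x)" "mono f"
  shows "d \<ge> 0"
proof (rule tendsto_lowerbound)
  show "((\<lambda>y. (f y - f x) / (y - x)) \<longlongrightarrow> d) (at x)" using assms(1) by (simp add: has_field_derivative_iff)
  show "\<forall>\<^sub>F y in at x. 0 \<le> (f y - f x) / (y - x)"
  proof (intro always_eventually allI)
    fix y show "0 \<le> (f y - f x) / (y - x)"
      using monoD[OF assms(2), of x y] monoD[OF assms(2), of y x]
      by (cases "x \<le> y") (auto simp: divide_nonpos_nonpos)
  qed
qed simp

section \<open>A smooth step function\<close>

text \<open>The powers of \<open>x\<close> in the denominator make the family closed under differentiation.\<close>

definition flat_exp :: "nat \<Rightarrow> real \<Rightarrow> real" where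
  "flat_exp n x = (if x \<le> 0 then 0 else exp (- 1 / x) / x ^ n)"

text \<open>From \<open>y \<le> exp y\<close> with \<open>y = 1 / (m * x)\<close>, raised to the power \<open>m = n + 2\<close>.\<close>

lemma flat_exp_quadratic: "\<exists>C. \<forall>x. \<bar>flat_exp n x\<bar> \<le> C * \<bar>x - 0\<bar>^2"
proof -
  define m where "m = real (n + 2)"
  have "\<bar>flat_exp n x\<bar> \<le> m ^ (n + 2) * \<bar>x\<bar>^2" for x
  proof (cases "x \<le> 0")
    case False
    then have x: "x > 0" by simp
    have m: "m > 0" by (simp add: m_def)
    have "1 / (m * x) \<le> exp (1 / (m * x))" using exp_ge_add_one_self[of "1 / (m * x)"] by linarith
    then have "(1 / (m * x)) ^ (n + 2) \<le> exp (1 / (m * x)) ^ (n + 2)" using x m by (intro power_mono) auto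
    also have "\<dots> = exp (real (n + 2) * (1 / (m * x)))" by (rule exp_of_nat_mult[symmetric])
    also have "real (n + 2) * (1 / (m * x)) = 1 / x" using m by (simp add: m_def)
    finally have "1 \<le> exp (1 / x) * (m * x) ^ (n + 2)" using x m by (simp add: power_one_over field_simps)
    then have "exp (- 1 / x) \<le> (m * x) ^ (n + 2)" by (simp add: exp_minus field_simps)
    then have "exp (- 1 / x) / x ^ n \<le> (m * x) ^ (n + 2) / x ^ n" using x by (intro divide_right_mono) auto
    also have "\<dots> = m ^ (n + 2) * x^2" using x by (simp add: power_mult_distrib power_add power2_eq_square)
    finally show ?thesis using x by (simp add: flat_exp_def)
  qed (simp add: flat_exp_def m_def)
  then show ?thesis by auto
qed

lemma flat_exp_DERIV: "(flat_exp n has_real_derivative flat_exp (n + 2) x - real n * flat_exp (n + 1) x) (at x)"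
proof -
  consider "x < 0" | "x = 0" | "x > 0" by linarith
  then show ?thesis
  proof cases
    case 1
    have "\<forall>\<^sub>F y in nhds x. flat_exp n y = 0"
      using eventually_nhds_in_open[of "{..<0}" x] 1 by (auto simp: flat_exp_def elim!: eventually_mono)
    from DERIV_cong_ev[OF refl this refl, of 0] have "(flat_exp n has_real_derivative 0) (at x)" by simp
    then show ?thesis using 1 by (simp add: flat_exp_def[of _ x])
  next
    case 2
    obtain C where "\<And>x. \<bar>flat_exp n x\<bar> \<le> C * \<bar>x - 0\<bar>^2" using flat_exp_quadratic by blast
    from DERIV_zero_if_quadratic[OF _ this] have "(flat_exp n has_real_derivative 0) (at 0)" by (simp add: flat_exp_def[of _ 0])
    then show ?thesis using 2 by (simp add: flat_exp_def[of _ 0])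
  next
    case 3
    have "\<forall>\<^sub>F y in nhds x. flat_exp n y = exp (- 1 / y) / y ^ n"
      using eventually_nhds_in_open[of "{0<..}" x] 3 by (auto simp: flat_exp_def elim!: eventually_mono)
    note ev = DERIV_cong_ev[OF refl this refl]
    have "((\<lambda>y. exp (- 1 / y) / y ^ n) has_real_derivative
      (exp (- 1 / x) * (1 / x^2) * x ^ n - exp (- 1 / x) * (real n * x ^ (n - 1))) / (x ^ n * x ^ n)) (at x)"
      using 3 by (auto intro!: derivative_eq_intros simp: field_simps power2_eq_square)
    moreover have "(exp (- 1 / x) * (1 / x^2) * x ^ n - exp (- 1 / x) * (real n * x ^ (n - 1))) / (x ^ n * x ^ n)
       = flat_exp (n + 2) x - real n * flat_exp (n + 1) x"
      using 3 by (cases n) (auto simp: flat_exp_def field_simps power2_eq_square)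
    ultimately show ?thesis unfolding ev by simp
  qed
qed

lemma DERIV_flat_exp_0: "(flat_exp 0 has_real_derivative flat_exp 2 x) (at x)"
  using flat_exp_DERIV[of 0 x] by (simp add: numeral_2_eq_2)

lemma smooth_flat_exp: "smooth_on UNIV (flat_exp n)"
proof -
  have "Ck_on k UNIV (flat_exp n)" for k n
  proof (induction k arbitrary: n)
    case 0
    show ?case using flat_exp_DERIV DERIV_isCont continuous_at_imp_continuous_on by (metis Ck_on_0)
  next
    case (Suc k)
    have "Ck_on k UNIV (\<lambda>x. flat_exp (n + 2) x + (- real n) * flat_exp (n + 1) x)"
      by (intro Ck_on_add Ck_on_mult Ck_on_const Suc open_UNIV)
    then show ?case
      by (intro Ck_on_SucI[OF open_UNIV, where f' = "\<lambda>x. flat_exp (n + 2) x + (- real n) * flat_exp (n + 1) x"])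
         (use flat_exp_DERIV[of n] in simp_all)
  qed
  then show ?thesis by (simp add: smooth_on_def)
qed

lemma flat_exp_0: "flat_exp 0 x > 0 \<longleftrightarrow> x > 0" "flat_exp 0 x = 0 \<longleftrightarrow> x \<le> 0" "flat_exp 0 x \<ge> 0"
  by (auto simp: flat_exp_def)

lemma flat_exp_2: "flat_exp 2 x > 0 \<longleftrightarrow> x > 0" "flat_exp 2 x \<ge> 0"
  by (auto simp: flat_exp_def)

definition step :: "real \<Rightarrow> real" where
  "step x = flat_exp 0 x / (flat_exp 0 x + flat_exp 0 (1 - x))"

lemma step_denominator: "flat_exp 0 x + flat_exp 0 (1 - x) > 0"
  using flat_exp_0(1)[of x] flat_exp_0(1)[of "1 - x"] flat_exp_0(3)[of x] flat_exp_0(3)[of "1 - x"] by linarith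

lemma smooth_step: "smooth_on UNIV step"
proof -
  have "smooth_on UNIV (\<lambda>x. flat_exp 0 (1 - x))"
    by (rule smooth_on_compose_UNIV[OF smooth_flat_exp]) (auto intro: smooth_on_diff smooth_on_const smooth_on_id)
  then show ?thesis unfolding step_def[abs_def]
    using step_denominator by (intro smooth_on_divide smooth_on_add smooth_flat_exp) (auto simp: less_le)
qed

lemma step_left: "x \<le> 0 \<Longrightarrow> step x = 0" and step_right: "x \<ge> 1 \<Longrightarrow> step x = 1"
  using step_denominator[of x] by (auto simp: step_def flat_exp_0)

lemma step_symmetric: "step (1 - x) = 1 - step x"
  using step_denominator[of x] by (simp add: step_def field_simps)

lemma deriv_step: "deriv step x = (flat_exp 2 x * flat_exp 0 (1 - x) + flat_exp 0 x * flat_exp 2 (1 - x))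
    / (flat_exp 0 x + flat_exp 0 (1 - x))^2"
proof (rule DERIV_imp_deriv)
  note d1 = DERIV_flat_exp_0
  have d2: "((\<lambda>x. flat_exp 0 (1 - x)) has_real_derivative flat_exp 2 (1 - x) * (- 1)) (at x)"
    by (rule DERIV_chain2[OF d1]) (auto intro!: derivative_eq_intros)
  have "((\<lambda>x. flat_exp 0 x / (flat_exp 0 x + flat_exp 0 (1 - x))) has_real_derivative
     (flat_exp 2 x * (flat_exp 0 x + flat_exp 0 (1 - x)) - flat_exp 0 x * (flat_exp 2 x + flat_exp 2 (1 - x) * (- 1)))
    / ((flat_exp 0 x + flat_exp 0 (1 - x)) * (flat_exp 0 x + flat_exp 0 (1 - x)))) (at x)"
    using step_denominator[of x] by (intro DERIV_divide DERIV_add d1 d2) auto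
  then show "(step has_real_derivative (flat_exp 2 x * flat_exp 0 (1 - x) + flat_exp 0 x * flat_exp 2 (1 - x))
    / (flat_exp 0 x + flat_exp 0 (1 - x))^2) (at x)"
    unfolding step_def[abs_def] by (simp add: algebra_simps power2_eq_square)
qed

lemma deriv_step_nonneg: "deriv step x \<ge> 0"
  by (simp add: deriv_step flat_exp_0(3) flat_exp_2(2))

lemma deriv_step_pos: "0 < x \<Longrightarrow> x < 1 \<Longrightarrow> deriv step x > 0"
  using step_denominator[of x] flat_exp_0(1)[of "1-x"] flat_exp_0(1)[of x] flat_exp_2(1)[of "1-x"] flat_exp_2(1)[of x]
  by (simp add: deriv_step add_pos_pos)

lemma step_range: "0 \<le> step x" "step x \<le> 1"
  using step_denominator[of x] flat_exp_0(3)[of x] flat_exp_0(3)[of "1-x"] by (simp_all add: step_def)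

lemma step_0_1: "step x = 0 \<longleftrightarrow> x \<le> 0" "step x = 1 \<longleftrightarrow> x \<ge> 1"
  using step_denominator[of x] flat_exp_0(2)[of x] flat_exp_0(2)[of "1-x"] by (auto simp: step_def field_simps)

section \<open>Smooth square roots and lifts through a folding map\<close>

text \<open>A ramp vanishes to infinite order at its last zero and may rest several times before it reaches \<open>1\<close>. Its
square root is nevertheless smooth: monotonicity makes the derivatives of \<open>c\<close> small where \<open>c\<close> is small,
namely \<open>\<bar>D j t\<bar> \<le> C * c t powr p\<close> for every \<open>p < 1\<close>. This lets all derivatives of the square root
extend by zero over the zeros of \<open>c\<close>.\<close>

locale smooth_ramp =
  fixes c :: "real \<Rightarrow> real" and a b :: real
  assumes smooth: "smooth_on UNIV c" and mono: "mono c" and ab: "a < b"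
    and left: "\<And>t. t \<le> a \<Longrightarrow> c t = 0" and right: "\<And>t. t \<ge> b \<Longrightarrow> c t = 1"
begin

definition D :: "nat \<Rightarrow> real \<Rightarrow> real" where
  "D j = (deriv ^^ j) c"

lemma D_0: "D 0 = c" by (simp add: D_def)

lemma smooth_D: "smooth_on UNIV (D j)"
  by (induction j) (auto simp: D_def smooth intro: smooth_on_deriv)

lemma DERIV_D: "(D j has_real_derivative D (Suc j) x) (at x)"
  using smooth_on_DERIV[OF smooth_D, of x j] by (simp add: D_def)

lemma c_nonneg: "c t \<ge> 0"
  using monoD[OF mono, of "min t a" t] left[of "min t a"] by simp

lemma c_le_1: "c t \<le> 1"
  using monoD[OF mono, of t "max t b"] right[of "max t b"] by simp

lemma D_zero: "c t = 0 \<Longrightarrow> s \<le> t \<Longrightarrow> D j s = 0"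
proof (induction j arbitrary: s)
  case 0
  then show ?case using monoD[OF mono, of s t] c_nonneg[of s] by (simp add: D_0)
next
  case (Suc j)
  show ?case
    by (rule DERIV_zero_if_constant_near[OF DERIV_D, of "s - 1" s]) (use Suc in auto)
qed

lemma D_Suc_right: "t \<ge> b \<Longrightarrow> D (Suc j) t = 0"
proof (induction j arbitrary: t)
  case 0
  show ?case by (rule DERIV_zero_if_constant_near[OF DERIV_D[of 0], of t "t + 1" _ 1]) (use 0 right in \<open>auto simp: D_0\<close>)
next
  case (Suc j)
  show ?case by (rule DERIV_zero_if_constant_near[OF DERIV_D[of "Suc j"], of t "t + 1" _ 0]) (use Suc in auto)
qed

lemma D_bounded: "\<exists>C. \<forall>t. \<bar>D j t\<bar> \<le> C"
proof (cases j)
  case 0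
  have "\<bar>D j t\<bar> \<le> 1" for t using c_nonneg[of t] c_le_1[of t] by (simp add: 0 D_0)
  then show ?thesis by blast
next
  case (Suc i)
  have "continuous_on {a..b} (D j)" using smooth_on_continuous[OF smooth_D[of j]] continuous_on_subset by blast
  then have "compact (D j ` {a..b})" using compact_continuous_image compact_Icc by blast
  then obtain C where C: "\<And>t. t \<in> {a..b} \<Longrightarrow> \<bar>D j t\<bar> \<le> C"
    using compact_imp_bounded bounded_iff by (metis image_eqI real_norm_def)
  have "\<bar>D j t\<bar> \<le> max C 0" for t
  proof -
    consider "t < a" | "t \<in> {a..b}" | "t > b" by force
    then show ?thesis
    proof cases
      case 1 then show ?thesis using D_zero[of a t j] left[of a] by simp
    next
      case 2 then show ?thesis using C[of t] by simp
    next
      case 3 then show ?thesis using D_Suc_right[of t i] Suc by simp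
    qed
  qed
  then show ?thesis by blast
qed

definition dominated :: "nat \<Rightarrow> real \<Rightarrow> bool" where
  "dominated j p \<longleftrightarrow> 0 \<le> p \<and> p \<le> 1 \<and> (\<exists>C. \<forall>t. c t > 0 \<longrightarrow> \<bar>D j t\<bar> \<le> C * c t powr p)"

lemma dominated_0: "dominated j 0"
  using D_bounded[of j] by (auto simp: dominated_def)

lemma dominated_base: "dominated 0 1"
  by (auto simp: dominated_def D_0 intro!: exI[of _ 1])

text \<open>A Landau inequality. By Taylor's formula between \<open>t - h\<close> and \<open>t\<close>, the middle derivative is at most
\<open>2 * A * c t powr p / h + B / 2 * h * c t powr q\<close>; here \<open>c s \<le> c t\<close> for \<open>s \<le> t\<close> is what makes bounds at
\<open>t\<close> valid on the whole interval. The choice \<open>h = c t powr ((p - q) / 2)\<close> balances the two terms.\<close>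

lemma dominated_interpolate:
  assumes "dominated j p" "dominated (j + 2) q"
  shows "dominated (j + 1) ((p + q) / 2)"
proof -
  obtain A B where A: "\<And>t. c t > 0 \<Longrightarrow> \<bar>D j t\<bar> \<le> A * c t powr p" and B: "\<And>t. c t > 0 \<Longrightarrow> \<bar>D (j + 2) t\<bar> \<le> B * c t powr q"
    and pq: "0 \<le> p" "p \<le> 1" "0 \<le> q" "q \<le> 1"
    using assms by (auto simp: dominated_def)
  have one: "c (max b 1) > 0" using right[of "max b 1"] by simp
  have "0 \<le> A * c (max b 1) powr p" "0 \<le> B * c (max b 1) powr q"
    using A[OF one] B[OF one] by linarith+
  then have AB: "A \<ge> 0" "B \<ge> 0" using one by (simp_all add: zero_le_mult_iff)
  have le: "\<bar>D i s\<bar> \<le> K * c t powr r" if "c t > 0" "s \<le> t" "0 \<le> r" "K \<ge> 0" "\<And>t. c t > 0 \<Longrightarrow> \<bar>D i t\<bar> \<le> K * c t powr r" for i s t r K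
  proof (cases "c s > 0")
    case True
    have "c s powr r \<le> c t powr r" using True monoD[OF mono that(2)] that(3) by (intro powr_mono2) auto
    then show ?thesis using that(5)[OF True] that(4) by (meson mult_left_mono order_trans)
  next
    case False
    then have "D i s = 0" using D_zero[of s s i] c_nonneg[of s] by simp
    then show ?thesis using that by simp
  qed
  have "\<bar>D (j + 1) t\<bar> \<le> (2 * A + B / 2) * c t powr ((p + q) / 2)" if t: "c t > 0" for t
  proof -
    define h where "h = c t powr ((p - q) / 2)"
    have h: "h > 0" using t by (simp add: h_def)
    have "\<exists>\<xi>. t - h < \<xi> \<and> \<xi> < t \<and> D j (t - h) = (\<Sum>m<2. (D (j + m) t / fact m) * (t - h - t)^m) + (D (j + 2) \<xi> / fact 2) * (t - h - t)^2"
      by (rule Taylor_down[where diff = "\<lambda>m. D (j + m)" and b = t]) (use h DERIV_D[of "j + _"] in auto)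
    then obtain \<xi> where \<xi>: "\<xi> < t" "D j (t - h) = D j t - h * D (j + 1) t + D (j + 2) \<xi> / 2 * h^2"
      by (auto simp: numeral_2_eq_2 algebra_simps)
    have "h * \<bar>D (j + 1) t\<bar> = \<bar>D j t - D j (t - h) + D (j + 2) \<xi> / 2 * h^2\<bar>"
    proof -
      have "h * D (j + 1) t = D j t - D j (t - h) + D (j + 2) \<xi> / 2 * h^2" using \<xi>(2) by simp
      then show ?thesis using h by (metis abs_mult abs_of_pos)
    qed
    also have "\<dots> \<le> \<bar>D j t\<bar> + \<bar>D j (t - h)\<bar> + \<bar>D (j + 2) \<xi> / 2 * h^2\<bar>" by linarith
    also have "\<dots> = \<bar>D j t\<bar> + \<bar>D j (t - h)\<bar> + \<bar>D (j + 2) \<xi>\<bar> / 2 * h^2" by (simp add: abs_mult)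
    also have "\<dots> \<le> A * c t powr p + A * c t powr p + (B * c t powr q) / 2 * h^2"
      using le[OF t _ pq(1) AB(1) A, of t] le[OF t _ pq(1) AB(1) A, of "t - h"] le[OF t _ pq(3) AB(2) B, of \<xi>] h \<xi>(1)
      by (intro add_mono mult_right_mono divide_right_mono) auto
    also have "\<dots> = h * ((2 * A + B / 2) * c t powr ((p + q) / 2))"
    proof -
      have 1: "h * c t powr ((p + q) / 2) = c t powr p" using t by (simp add: h_def powr_add[symmetric] add_divide_distrib[symmetric])
      have "c t powr q * h = c t powr ((p + q) / 2)" using t by (simp add: h_def powr_add[symmetric] field_simps)
      then have 2: "c t powr q * h^2 = c t powr p" using 1 by (simp add: power2_eq_square algebra_simps)
      have "A * c t powr p + A * c t powr p + (B * c t powr q) / 2 * h^2 = 2 * A * c t powr p + B / 2 * (c t powr q * h^2)"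
        by (simp add: algebra_simps)
      also have "\<dots> = (2 * A + B / 2) * c t powr p" unfolding 2 by (simp add: algebra_simps)
      also have "\<dots> = h * ((2 * A + B / 2) * c t powr ((p + q) / 2))" unfolding 1[symmetric] by (simp add: algebra_simps)
      finally show ?thesis .
    qed
    finally show ?thesis using h by simp
  qed
  then show ?thesis using pq unfolding dominated_def by (intro conjI exI[of _ "2 * A + B / 2"]) auto
qed

text \<open>Let \<open>\<alpha> j\<close> be the supremum of the exponents that dominate \<open>D j\<close>. It takes values in \<open>[0, 1]\<close>, and interpolation says that it is
concave in \<open>j\<close>. A bounded concave sequence cannot decrease, so \<open>\<alpha> j \<ge> \<alpha> 0 = 1\<close>.\<close>

lemma dominated_less_1:
  assumes "0 \<le> p" "p < 1"
  shows "dominated j p"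
proof -
  define \<alpha> where "\<alpha> i = Sup {p. dominated i p}" for i
  have bdd: "bdd_above {p. dominated i p}" for i by (rule bdd_aboveI[of _ 1]) (simp add: dominated_def)
  have ne: "{p. dominated i p} \<noteq> {}" for i using dominated_0 by blast
  have up: "dominated i p \<Longrightarrow> p \<le> \<alpha> i" for i p unfolding \<alpha>_def using bdd by (intro cSup_upper) auto
  have ge0: "\<alpha> i \<ge> 0" for i using up[OF dominated_0] .
  have concave: "\<alpha> i + \<alpha> (i + 2) \<le> 2 * \<alpha> (i + 1)" for i
  proof -
    have "p + q \<le> 2 * \<alpha> (i + 1)" if "dominated i p" "dominated (i + 2) q" for p q
      using up[OF dominated_interpolate[OF that]] by simp
    then have "p \<le> 2 * \<alpha> (i + 1) - q" if "dominated i p" "dominated (i + 2) q" for p q using that by force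
    then have "\<alpha> i \<le> 2 * \<alpha> (i + 1) - q" if "dominated (i + 2) q" for q
      unfolding \<alpha>_def[of i] using ne that by (intro cSup_least) auto
    then have "q \<le> 2 * \<alpha> (i + 1) - \<alpha> i" if "dominated (i + 2) q" for q using that by force
    then have "\<alpha> (i + 2) \<le> 2 * \<alpha> (i + 1) - \<alpha> i"
      unfolding \<alpha>_def[of "i + 2"] using ne by (intro cSup_least) auto
    then show ?thesis by simp
  qed
  define d where "d i = \<alpha> (Suc i) - \<alpha> i" for i
  have dec: "d (i + n) \<le> d i" for i n
  proof (induction n)
    case (Suc n) then show ?case using concave[of "i + n"] by (simp add: d_def)
  qed simp
  have "d i \<ge> 0" for i
  proof (rule ccontr)
    assume "\<not> d i \<ge> 0"
    have "\<alpha> (i + n) \<le> \<alpha> i + real n * d i" for n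
    proof (induction n)
      case (Suc n) then show ?case using dec[of i n] by (simp add: d_def algebra_simps)
    qed simp
    moreover obtain n where "real n * (- d i) > \<alpha> i"
      using reals_Archimedean3[of "- d i"] \<open>\<not> d i \<ge> 0\<close> by auto
    ultimately show False using ge0[of "i + n"] by (smt (verit) mult_minus_right)
  qed
  then have "\<alpha> i \<ge> \<alpha> 0" for i
  proof (induction i)
    case (Suc i)
    then have "\<alpha> 0 \<le> \<alpha> i" "d i \<ge> 0" by blast+
    then show ?case by (simp add: d_def)
  qed simp
  then have "\<alpha> j \<ge> 1" using up[OF dominated_base] by (meson order_trans)
  then obtain q where q: "dominated j q" "p < q"
    using less_cSupD[OF ne[of j], of p] assms(2) by (auto simp: \<alpha>_def)
  then obtain C where C: "\<And>t. c t > 0 \<Longrightarrow> \<bar>D j t\<bar> \<le> C * c t powr q" by (auto simp: dominated_def)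
  have "\<bar>D j t\<bar> \<le> \<bar>C\<bar> * c t powr p" if "c t > 0" for t
  proof -
    have "c t powr q \<le> c t powr p" using q(2) that c_le_1[of t] by (intro powr_mono') auto
    moreover have "C * c t powr q \<le> \<bar>C\<bar> * c t powr q" by (intro mult_right_mono) auto
    ultimately show ?thesis using C[OF that] by (meson abs_ge_zero mult_left_mono order_trans)
  qed
  then show ?thesis using assms unfolding dominated_def by (intro conjI exI[of _ "\<bar>C\<bar>"]) auto
qed

text \<open>Homogeneous polynomials of degree \<open>r\<close> in the derivatives of \<open>c\<close>: differentiation preserves the degree, and
they are bounded by almost the \<open>r\<close>-th power of \<open>c\<close>.\<close>

inductive homogeneous :: "nat \<Rightarrow> (real \<Rightarrow> real) \<Rightarrow> bool" where
  const: "homogeneous 0 (\<lambda>t. k)"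
| mult: "homogeneous r u \<Longrightarrow> homogeneous (Suc r) (\<lambda>t. u t * D j t)"
| add: "homogeneous r u \<Longrightarrow> homogeneous r v \<Longrightarrow> homogeneous r (\<lambda>t. u t + v t)"
| scale: "homogeneous r u \<Longrightarrow> homogeneous r (\<lambda>t. k * u t)"

lemma homogeneous_DERIV: "homogeneous r u \<Longrightarrow> \<exists>u'. homogeneous r u' \<and> (\<forall>t. (u has_real_derivative u' t) (at t))"
proof (induction rule: homogeneous.induct)
  case (const k)
  show ?case by (intro exI[of _ "\<lambda>t. 0"]) (auto intro: homogeneous.const)
next
  case (mult r u j)
  then obtain u' where u': "homogeneous r u'" "\<And>t. (u has_real_derivative u' t) (at t)" by blast
  have "((\<lambda>t. u t * D j t) has_real_derivative u' t * D j t + u t * D (Suc j) t) (at t)" for t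
    by (rule DERIV_cong[OF DERIV_mult[OF u'(2) DERIV_D]]) simp
  moreover have "homogeneous (Suc r) (\<lambda>t. u' t * D j t + u t * D (Suc j) t)"
    using u'(1) mult(1) by (intro homogeneous.add homogeneous.mult)
  ultimately show ?case by blast
next
  case (add r u v)
  then show ?case by (blast intro: homogeneous.add DERIV_add)
next
  case (scale r u k)
  then show ?case by (blast intro: homogeneous.scale DERIV_cmult)
qed

lemma homogeneous_bound: "homogeneous r u \<Longrightarrow> 0 < e \<Longrightarrow> e \<le> 1 \<Longrightarrow> \<exists>C. \<forall>t. c t > 0 \<longrightarrow> \<bar>u t\<bar> \<le> C * c t powr (real r * (1 - e))"
proof (induction rule: homogeneous.induct)
  case (const k)
  show ?case by (intro exI[of _ "\<bar>k\<bar>"]) auto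
next
  case (mult r u j)
  then obtain A where A: "\<And>t. c t > 0 \<Longrightarrow> \<bar>u t\<bar> \<le> A * c t powr (real r * (1 - e))" by blast
  obtain B where B: "\<And>t. c t > 0 \<Longrightarrow> \<bar>D j t\<bar> \<le> B * c t powr (1 - e)"
    using dominated_less_1[of "1 - e" j] mult.prems by (auto simp: dominated_def)
  have "\<bar>u t * D j t\<bar> \<le> (A * B) * c t powr (real (Suc r) * (1 - e))" if "c t > 0" for t
  proof -
    have "\<bar>u t * D j t\<bar> \<le> (A * c t powr (real r * (1 - e))) * (B * c t powr (1 - e))"
      unfolding abs_mult using A[OF that] B[OF that] by (intro mult_mono) (auto intro: order_trans[OF abs_ge_zero])
    also have "\<dots> = (A * B) * c t powr (real (Suc r) * (1 - e))"
      using that by (simp add: powr_add[symmetric] algebra_simps)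
    finally show ?thesis .
  qed
  then show ?case by blast
next
  case (add r u v)
  then obtain A B where "\<And>t. c t > 0 \<Longrightarrow> \<bar>u t\<bar> \<le> A * c t powr (real r * (1 - e))"
     "\<And>t. c t > 0 \<Longrightarrow> \<bar>v t\<bar> \<le> B * c t powr (real r * (1 - e))" by blast
  then have "\<bar>u t + v t\<bar> \<le> (A + B) * c t powr (real r * (1 - e))" if "c t > 0" for t
    using that by (smt (verit) distrib_right)
  then show ?case by blast
next
  case (scale r u k)
  then obtain A where "\<And>t. c t > 0 \<Longrightarrow> \<bar>u t\<bar> \<le> A * c t powr (real r * (1 - e))" by blast
  then have "\<bar>k * u t\<bar> \<le> (\<bar>k\<bar> * A) * c t powr (real r * (1 - e))" if "c t > 0" for t
    using that by (simp add: abs_mult mult.assoc mult_left_mono)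
  then show ?case by blast
qed

text \<open>The derivatives of \<open>c powr (1/2)\<close> are sums of such terms. If \<open>u\<close> is homogeneous of degree \<open>r\<close>, such a term has
size about \<open>c powr (1/2)\<close>, whatever \<open>r\<close> is.\<close>

definition rterm :: "nat \<Rightarrow> (real \<Rightarrow> real) \<Rightarrow> real \<Rightarrow> real" where
  "rterm r u t = (if c t = 0 then 0 else c t powr (1/2 - real r) * u t)"

text \<open>All derivatives vanish at a zero \<open>s\<close> of \<open>c\<close>, because \<open>c\<close> is zero on the left of \<open>s\<close>. The exponent \<open>8\<close> is
what \<open>rterm_quadratic\<close> needs: there the terms are bounded by a multiple of \<open>c powr (1/4)\<close>.\<close>

lemma c_flat: "\<exists>M. \<forall>t. \<forall>s. c s = 0 \<longrightarrow> c t \<le> M * \<bar>t - s\<bar>^8"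
proof -
  obtain M where M: "\<And>t. \<bar>D 8 t\<bar> \<le> M" using D_bounded by blast
  have M0: "M \<ge> 0" using M[of 0] by linarith
  have "c t \<le> M * \<bar>t - s\<bar>^8" if s: "c s = 0" for t s
  proof (cases "t \<le> s")
    case True
    then have "c t = 0" using D_zero[OF s, of t 0] by (simp add: D_0)
    then show ?thesis using M0 by simp
  next
    case False
    have "\<exists>\<xi>. s < \<xi> \<and> \<xi> < t \<and> c t = (\<Sum>m<8. (D m s / fact m) * (t - s)^m) + (D 8 \<xi> / fact 8) * (t - s)^8"
      by (rule Taylor_up[where a = s]) (use False DERIV_D D_0 in auto)
    then obtain \<xi> where "c t = (\<Sum>m<8. (D m s / fact m) * (t - s)^m) + (D 8 \<xi> / fact 8) * (t - s)^8" by blast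
    also have "(\<Sum>m<8. (D m s / fact m) * (t - s)^m) = 0" using D_zero[OF s order_refl] by simp
    finally have "c t = D 8 \<xi> / fact 8 * (t - s)^8" by simp
    also have "\<dots> \<le> M * (t - s)^8"
    proof (rule mult_right_mono)
      have "D 8 \<xi> / fact 8 \<le> \<bar>D 8 \<xi>\<bar> / 1" by (intro frac_le) auto
      then show "D 8 \<xi> / fact 8 \<le> M" using M[of \<xi>] by simp
    qed simp
    finally show ?thesis using False by simp
  qed
  then show ?thesis by blast
qed

lemma rterm_quadratic:
  assumes "homogeneous r u"
  shows "\<exists>C. \<forall>s. c s = 0 \<longrightarrow> (\<forall>t. \<bar>rterm r u t\<bar> \<le> C * \<bar>t - s\<bar>^2)"
proof -
  \<comment> \<open>the loss \<open>r * e\<close> in the exponent is at most \<open>1/4\<close>\<close>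
  define e where "e = 1 / (4 * (real r + 1))"
  have e: "0 < e" "e \<le> 1" "real r * e \<le> 1/4" by (auto simp: e_def field_simps)
  obtain C where C: "\<And>t. c t > 0 \<Longrightarrow> \<bar>u t\<bar> \<le> C * c t powr (real r * (1 - e))"
    using homogeneous_bound[OF assms e(1,2)] by blast
  obtain M where M: "\<And>t s. c s = 0 \<Longrightarrow> c t \<le> M * \<bar>t - s\<bar>^8" using c_flat by blast
  have "\<bar>rterm r u t\<bar> \<le> (\<bar>C\<bar> * \<bar>M\<bar> powr (1/4)) * \<bar>t - s\<bar>^2" if s: "c s = 0" for s t
  proof (cases "c t = 0")
    case False
    then have ct: "c t > 0" using c_nonneg[of t] by simp
    have "\<bar>u t\<bar> \<le> \<bar>C\<bar> * c t powr (real r * (1 - e))" using C[OF ct] by (smt (verit) mult_right_mono powr_ge_zero)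
    then have "\<bar>rterm r u t\<bar> \<le> c t powr (1/2 - real r) * (\<bar>C\<bar> * c t powr (real r * (1 - e)))"
    proof -
      have "\<bar>rterm r u t\<bar> = c t powr (1/2 - real r) * \<bar>u t\<bar>" using ct by (simp add: rterm_def abs_mult)
      then show ?thesis using mult_left_mono[OF \<open>\<bar>u t\<bar> \<le> _\<close>, of "c t powr (1/2 - real r)"] by simp
    qed
    also have "\<dots> = \<bar>C\<bar> * c t powr (1/2 - real r * e)" using ct by (simp add: powr_add[symmetric] algebra_simps)
    also have "\<dots> \<le> \<bar>C\<bar> * c t powr (1/4)" using ct c_le_1[of t] e(3) by (intro mult_left_mono powr_mono') auto
    also have "c t powr (1/4) \<le> (\<bar>M\<bar> * \<bar>t - s\<bar>^8) powr (1/4)"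
    proof (rule powr_mono2)
      have "M * \<bar>t - s\<bar>^8 \<le> \<bar>M\<bar> * \<bar>t - s\<bar>^8" by (intro mult_right_mono) auto
      then show "c t \<le> \<bar>M\<bar> * \<bar>t - s\<bar>^8" using M[OF s, of t] by linarith
    qed (use ct in auto)
    also have "(\<bar>M\<bar> * \<bar>t - s\<bar>^8) powr (1/4) = \<bar>M\<bar> powr (1/4) * \<bar>t - s\<bar>^2"
    proof -
      have "\<bar>t - s\<bar> > 0" using False s by auto
      define y where "y = \<bar>t - s\<bar>^2"
      have "y > 0" using \<open>\<bar>t - s\<bar> > 0\<close> by (simp add: y_def)
      have "(y ^ 4) powr (1/4) = (y powr 4) powr (1/4)" using \<open>y > 0\<close> by simp
      also have "\<dots> = y" using \<open>y > 0\<close> by (simp only: powr_powr) simp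
      finally have "(\<bar>t - s\<bar>^8) powr (1/4) = \<bar>t - s\<bar>^2" by (simp add: y_def flip: power_mult)
      then show ?thesis by (simp add: powr_mult)
    qed
    finally show ?thesis by (simp add: mult_left_mono mult.assoc)
  qed (simp add: rterm_def)
  then show ?thesis by blast
qed

text \<open>Differentiating the power of \<open>c\<close> lowers its exponent by one and adds the factor \<open>D 1\<close>, so the result
consists again of terms of the same kind. At a zero of \<open>c\<close> both sides are zero.\<close>

lemma rterm_DERIV:
  assumes u: "homogeneous r u" and u': "homogeneous r u'" "\<And>t. (u has_real_derivative u' t) (at t)"
  shows "(rterm r u has_real_derivative rterm (Suc r) (\<lambda>t. (1/2 - real r) * (u t * D 1 t)) t + rterm r u' t) (at t)"
proof (cases "c t = 0")
  case True
  obtain C where "\<And>x. \<bar>rterm r u x\<bar> \<le> C * \<bar>x - t\<bar>^2" using rterm_quadratic[OF u] True by blast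
  from DERIV_zero_if_quadratic[OF _ this] have "(rterm r u has_real_derivative 0) (at t)"
    using True by (simp add: rterm_def[of _ _ t])
  then show ?thesis using True by (simp add: rterm_def[of _ _ t])
next
  case False
  then have ct: "c t > 0" using c_nonneg[of t] by simp
  have "\<forall>\<^sub>F x in nhds t. c x > 0"
    using smooth_on_isCont[OF smooth, of t] ct unfolding isCont_def tendsto_at_iff_tendsto_nhds by (rule order_tendstoD)
  then have ev: "\<forall>\<^sub>F x in nhds t. rterm r u x = c x powr (1/2 - real r) * u x"
    by eventually_elim (simp add: rterm_def)
  have "((\<lambda>x. c x powr (1/2 - real r)) has_real_derivative (1/2 - real r) * c t powr (1/2 - real r - 1) * D 1 t) (at t)"
    using DERIV_fun_powr[of c "D 1 t" t "1/2 - real r"] DERIV_D[of 0 t] ct by (simp add: D_0 One_nat_def)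
  from DERIV_mult[OF this u'(2)]
  have "((\<lambda>x. c x powr (1/2 - real r) * u x) has_real_derivative
     rterm (Suc r) (\<lambda>t. (1/2 - real r) * (u t * D 1 t)) t + rterm r u' t) (at t)"
    by (rule DERIV_cong) (use False in \<open>simp add: rterm_def algebra_simps\<close>)
  then show ?thesis unfolding DERIV_cong_ev[OF refl ev refl] .
qed

lemma smooth_rterm: "homogeneous r u \<Longrightarrow> smooth_on UNIV (rterm r u)"
proof -
  have "homogeneous r u \<Longrightarrow> Ck_on k UNIV (rterm r u)" for k
  proof (induction k arbitrary: r u)
    case 0
    obtain u' where "homogeneous r u'" "\<And>t. (u has_real_derivative u' t) (at t)" using homogeneous_DERIV[OF 0] by blast
    from rterm_DERIV[OF 0 this] have "isCont (rterm r u) t" for t by (rule DERIV_isCont)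
    then show ?case by (simp add: Ck_on_0 continuous_at_imp_continuous_on)
  next
    case (Suc k)
    obtain u' where u': "homogeneous r u'" "\<And>t. (u has_real_derivative u' t) (at t)" using homogeneous_DERIV[OF Suc.prems] by blast
    have "homogeneous (Suc r) (\<lambda>t. (1/2 - real r) * (u t * D 1 t))"
      by (intro homogeneous.scale homogeneous.mult Suc.prems)
    then have "Ck_on k UNIV (\<lambda>t. rterm (Suc r) (\<lambda>t. (1/2 - real r) * (u t * D 1 t)) t + rterm r u' t)"
      using Suc.IH u'(1) by (intro Ck_on_add open_UNIV)
    then show ?case by (intro Ck_on_SucI[OF open_UNIV, where f' = "\<lambda>t. rterm (Suc r) (\<lambda>t. (1/2 - real r) * (u t * D 1 t)) t + rterm r u' t"] rterm_DERIV[OF Suc.prems u'])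
  qed
  then show "homogeneous r u \<Longrightarrow> smooth_on UNIV (rterm r u)" by (simp add: smooth_on_def)
qed

lemma smooth_sqrt: "smooth_on UNIV (\<lambda>t. sqrt (c t))"
proof -
  have "(\<lambda>t. sqrt (c t)) = rterm 0 (\<lambda>t. 1)" using c_nonneg by (auto simp: rterm_def powr_half_sqrt)
  then show ?thesis using smooth_rterm[OF homogeneous.const[of 1]] by simp
qed

end

lemma (in smooth_ramp) smooth_sqrt_complement: "smooth_on UNIV (\<lambda>t. sqrt (1 - c t))"
proof -
  interpret flip: smooth_ramp "\<lambda>t. 1 - c (- t)" "- b" "- a"
  proof
    have "smooth_on UNIV (\<lambda>t. c (- t))"
      by (rule smooth_on_compose_UNIV[OF smooth]) (auto intro: smooth_on_minus smooth_on_id)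
    then show "smooth_on UNIV (\<lambda>t. 1 - c (- t))" by (intro smooth_on_diff smooth_on_const) auto
    show "mono (\<lambda>t. 1 - c (- t))" using mono by (auto simp: mono_def)
  qed (use ab left right in auto)
  have "smooth_on UNIV (\<lambda>t. (\<lambda>t. sqrt (1 - c (- t))) (- t))"
    by (rule smooth_on_compose_UNIV[OF flip.smooth_sqrt]) (auto intro: smooth_on_minus smooth_on_id)
  then show ?thesis by simp
qed

text \<open>A path \<open>\<gamma>\<close> on \<open>[0, 1]\<close> need not extend to a larger interval, but \<open>\<gamma> \<circ> sin_fold\<close> is a curve on \<open>\<real>\<close>. It
follows \<open>\<gamma>\<close> on \<open>[0, 1]\<close> and turns back at the ends, where \<open>sin_fold\<close> has nondegenerate
extrema.\<close>

definition sin_fold :: "real \<Rightarrow> real" where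
  "sin_fold x = (sin (pi / 2 * x))^2"

lemma smooth_sin_fold: "smooth_on UNIV sin_fold"
proof -
  have "smooth_on UNIV (\<lambda>x. sin (pi / 2 * x))"
    by (rule smooth_on_compose_UNIV[OF smooth_on_sin open_UNIV smooth_on_cmult[OF open_UNIV smooth_on_id]])
  then show ?thesis unfolding sin_fold_def[abs_def] power2_eq_square by (intro smooth_on_mult) auto
qed

lemma sin_fold_range: "0 \<le> sin_fold x" "sin_fold x \<le> 1"
  by (auto simp: sin_fold_def abs_square_le_1)

lemma sin_fold_0 [simp]: "sin_fold 0 = 0" and sin_fold_1 [simp]: "sin_fold 1 = 1"
  by (simp_all add: sin_fold_def)

text \<open>The lift of a ramp \<open>c\<close> through the folding map, \<open>c = sin_fold \<circ> fold_lift c\<close>.\<close>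

definition fold_lift :: "(real \<Rightarrow> real) \<Rightarrow> real \<Rightarrow> real" where
  "fold_lift c t = 2 / pi * arcsin (sqrt (c t))"

context smooth_ramp
begin

lemma sqrt_c: "0 \<le> sqrt (c t)" "sqrt (c t) \<le> 1" "- 1 \<le> sqrt (c t)"
  using c_nonneg[of t] c_le_1[of t] by (auto intro: order_trans[of _ 0])

lemma sin_fold_lift: "sin_fold (fold_lift c t) = c t"
  using sqrt_c[of t] c_nonneg[of t] by (simp add: sin_fold_def fold_lift_def)

lemma fold_lift_cong: "c t = k \<Longrightarrow> fold_lift c t = 2 / pi * arcsin (sqrt k)"
  by (simp add: fold_lift_def)

lemma fold_lift_0: "c t = 0 \<Longrightarrow> fold_lift c t = 0" and fold_lift_1: "c t = 1 \<Longrightarrow> fold_lift c t = 1"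
  by (simp_all add: fold_lift_def)

lemma mono_fold_lift: "mono (fold_lift c)"
proof
  fix x y :: real assume "x \<le> y"
  then have "arcsin (sqrt (c x)) \<le> arcsin (sqrt (c y))"
    using sqrt_c[of x] sqrt_c[of y] monoD[OF mono, of x y] by (intro arcsin_le_arcsin real_sqrt_le_mono) auto
  then show "fold_lift c x \<le> fold_lift c y" by (simp add: fold_lift_def field_simps)
qed

lemma fold_lift_range: "0 \<le> fold_lift c t" "fold_lift c t \<le> 1"
  using monoD[OF mono_fold_lift, of "min t a" t] monoD[OF mono_fold_lift, of t "max t b"]
    fold_lift_0[OF left, of "min t a"] fold_lift_1[OF right, of "max t b"] by auto

text \<open>With \<open>p = sqrt c\<close> and \<open>q = sqrt (1 - c)\<close>, the point \<open>(q, p)\<close> moves smoothly on the unit circle and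
\<open>arcsin p\<close> is its angle. The angular velocity \<open>\<omega> = p' * q - p * q'\<close> is smooth also where the
derivative of \<open>arcsin\<close> is infinite.\<close>

lemma smooth_fold_lift: "smooth_on UNIV (fold_lift c)"
proof -
  define p where "p t = sqrt (c t)" for t
  define q where "q t = sqrt (1 - c t)" for t
  have p: "smooth_on UNIV p" and q: "smooth_on UNIV q"
    using smooth_sqrt smooth_sqrt_complement by (simp_all add: p_def[abs_def] q_def[abs_def])
  have dp: "(p has_real_derivative deriv p t) (at t)" and dq: "(q has_real_derivative deriv q t) (at t)" for t
    using smooth_on_DERIV[OF p] smooth_on_DERIV[OF q] by simp_all
  have sq: "p t * p t + q t * q t = 1" for t
    using c_nonneg[of t] c_le_1[of t] by (simp add: p_def q_def)
  have p0: "0 \<le> p t" "p t \<le> 1" and q0: "0 \<le> q t" "q t \<le> 1" for t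
    using c_nonneg[of t] c_le_1[of t] by (simp_all add: p_def q_def)
  have orth: "p t * deriv p t + q t * deriv q t = 0" for t
  proof -
    have "((\<lambda>t. p t * p t + q t * q t) has_real_derivative
       deriv p t * p t + deriv p t * p t + (deriv q t * q t + deriv q t * q t)) (at t)"
      by (intro DERIV_add DERIV_mult dp dq)
    moreover have "((\<lambda>t. p t * p t + q t * q t) has_real_derivative 0) (at t)" unfolding sq by simp
    ultimately show ?thesis using DERIV_unique by fastforce
  qed
  define \<omega> where "\<omega> t = deriv p t * q t - p t * deriv q t" for t
  have qw: "q t * \<omega> t = deriv p t" and pw: "p t * \<omega> t = - deriv q t" for t
  proof -
    have "q t * \<omega> t = deriv p t * (p t * p t + q t * q t) - p t * (p t * deriv p t + q t * deriv q t)"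
      by (simp add: \<omega>_def algebra_simps)
    then show "q t * \<omega> t = deriv p t" by (simp add: sq orth)
    have "p t * \<omega> t = q t * (p t * deriv p t + q t * deriv q t) - deriv q t * (p t * p t + q t * q t)"
      by (simp add: \<omega>_def algebra_simps)
    then show "p t * \<omega> t = - deriv q t" by (simp add: sq orth)
  qed
  have qp: "q t = sqrt (1 - (p t)^2)" and pq: "p t = sqrt (1 - (q t)^2)" for t
    using c_nonneg[of t] c_le_1[of t] by (simp_all add: p_def q_def)
  have "((\<lambda>t. arcsin (p t)) has_real_derivative \<omega> t) (at t)" for t
  proof (cases "q t = 0")
    case False
    have "p t \<noteq> 1" using sq[of t] False by auto
    then have "(arcsin has_real_derivative inverse (sqrt (1 - (p t)^2))) (at (p t))"
      using p0[of t] by (intro DERIV_arcsin) auto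
    from DERIV_chain2[OF this dp]
    have "((\<lambda>t. arcsin (p t)) has_real_derivative inverse (q t) * deriv p t) (at t)" by (simp only: qp[symmetric])
    moreover have "inverse (q t) * deriv p t = \<omega> t" unfolding qw[of t, symmetric] using False by simp
    ultimately show ?thesis by simp
  next
    case True
    then have "p t = 1" using pq[of t] by simp
    have "(arccos has_real_derivative inverse (- sqrt (1 - (q t)^2))) (at (q t))"
      using True by (intro DERIV_arccos) auto
    from DERIV_chain2[OF this dq] have "((\<lambda>t. arccos (q t)) has_real_derivative inverse (- p t) * deriv q t) (at t)"
      by (simp only: pq[symmetric])
    then have "((\<lambda>t. arccos (q t)) has_real_derivative \<omega> t) (at t)"
      using pw[of t] \<open>p t = 1\<close> by simp
    moreover have "arccos (q t) = arcsin (p t)" for t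
      using arcsin_arccos_sqrt_pos[OF p0[of t]] by (simp add: qp)
    ultimately show ?thesis by simp
  qed
  moreover have "smooth_on UNIV \<omega>"
    unfolding \<omega>_def[abs_def]
    by (rule smooth_on_diff[OF open_UNIV smooth_on_mult[OF open_UNIV smooth_on_deriv[OF open_UNIV p] q]
          smooth_on_mult[OF open_UNIV p smooth_on_deriv[OF open_UNIV q]]])
  ultimately have "smooth_on UNIV (\<lambda>t. arcsin (p t))"
    using smooth_on_DERIV_intro[OF open_UNIV, of "\<lambda>t. arcsin (p t)" \<omega>] by blast
  then have "smooth_on UNIV (\<lambda>t. 2 / pi * arcsin (p t))" by (rule smooth_on_cmult[OF open_UNIV])
  then show ?thesis by (simp add: fold_lift_def[abs_def] p_def)
qed

lemma deriv_fold_lift_nonneg: "deriv (fold_lift c) t \<ge> 0"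
  using smooth_on_DERIV[OF smooth_fold_lift, of t] mono_fold_lift by (intro DERIV_nonneg_if_mono[of "fold_lift c"]) auto

lemma deriv_fold_lift_pos:
  assumes "deriv c t > 0"
  shows "deriv (fold_lift c) t > 0"
proof -
  have "((\<lambda>t. sin_fold (fold_lift c t)) has_real_derivative deriv sin_fold (fold_lift c t) * deriv (fold_lift c) t) (at t)"
    using DERIV_chain2[OF smooth_on_DERIV[OF smooth_sin_fold] smooth_on_DERIV[OF smooth_fold_lift]] by simp
  then have "deriv c t = deriv sin_fold (fold_lift c t) * deriv (fold_lift c) t"
    unfolding sin_fold_lift by (rule DERIV_imp_deriv)
  then have "deriv (fold_lift c) t \<noteq> 0" using assms by auto
  then show ?thesis using deriv_fold_lift_nonneg[of t] by simp
qed

end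

section \<open>Reparametrizations with finitely many rests\<close>

lemma smooth_on_affine: "smooth_on UNIV (\<lambda>t. p * t + q)"
  by (rule smooth_on_add[OF open_UNIV smooth_on_cmult[OF open_UNIV smooth_on_id] smooth_on_const])

lemma smooth_on_compose_affine: "smooth_on UNIV f \<Longrightarrow> smooth_on UNIV (\<lambda>t. f (p * t + q))"
  by (rule smooth_on_compose_UNIV[OF _ open_UNIV smooth_on_affine])

lemma deriv_compose_affine: "smooth_on UNIV f \<Longrightarrow> ((\<lambda>t. f (p * t + q)) has_real_derivative deriv f (p * t + q) * p) (at t)"
proof -
  assume f: "smooth_on UNIV f"
  have 1: "(f has_real_derivative deriv f (p * t + q)) (at (p * t + q))" using smooth_on_DERIV[OF f] by simp
  have 2: "((\<lambda>t. p * t + q) has_real_derivative p) (at t)"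
    by (rule DERIV_cong[OF DERIV_add[OF DERIV_cmult_Id DERIV_const]]) simp
  show ?thesis using DERIV_chain2[where f = f and g = "\<lambda>t. p * t + q" and x = t, OF 1 2] .
qed

lemma mono_if_deriv_nonneg:
  assumes "smooth_on UNIV c" "\<And>t. deriv c t \<ge> 0" shows "mono c"
proof
  fix x y :: real assume "x \<le> y"
  then show "c x \<le> c y"
  proof (rule DERIV_nonneg_imp_nondecreasing)
    fix z assume "x \<le> z" "z \<le> y"
    show "\<exists>d. (c has_real_derivative d) (at z) \<and> 0 \<le> d"
      by (rule exI[of _ "deriv c z"], rule conjI[OF smooth_on_DERIV[OF assms(1)]]) (simp_all add: assms(2))
  qed
qed

text \<open>Two points with the same value bound an interval on which \<open>w\<close> is constant.\<close>

lemma unique_point_if_deriv_pos: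
  assumes w: "smooth_on UNIV w" "mono w" and pos: "deriv w x > 0" and z: "w z = w x"
  shows "z = x"
proof (rule ccontr)
  assume "z \<noteq> x"
  have "deriv w x = 0"
  proof (rule DERIV_zero_if_constant_near[OF smooth_on_DERIV[OF w(1)]])
    show "min z x < max z x" "x \<in> {min z x..max z x}" using \<open>z \<noteq> x\<close> by auto
    show "w y = w x" if "y \<in> {min z x..max z x}" for y
      using that monoD[OF w(2), of "min z x" y] monoD[OF w(2), of y "max z x"] z by (auto simp: min_def max_def split: if_splits)
  qed simp_all
  then show False using pos by simp
qed

lemma smooth_on_local:
  assumes "open S" "\<And>x. x \<in> S \<Longrightarrow> \<exists>B g. open B \<and> x \<in> B \<and> smooth_on B g \<and> (\<forall>y\<in>B \<inter> S. f y = g y)"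
  shows "smooth_on S f"
  unfolding smooth_on_iff_smooth_fun[OF assms(1)]
proof (rule smooth_fun_local[OF openin_coord[OF assms(1)]])
  fix x :: vec assume x: "x \<in> {x \<in> Rn 1. x 0 \<in> S}"
  then obtain B g where B: "open B" "x 0 \<in> B" "smooth_on B g" "\<forall>y\<in>B \<inter> S. f y = g y" using assms(2) by blast
  have BS: "open (B \<inter> S)" by (rule open_Int[OF B(1) assms(1)])
  have "smooth_on (B \<inter> S) g" by (rule smooth_on_subset[OF B(3,1) BS]) simp
  then have "smooth_fun 1 {x \<in> Rn 1. x 0 \<in> B \<inter> S} (\<lambda>x. f (x 0))"
    unfolding smooth_on_iff_smooth_fun[OF BS] by (rule smooth_fun_cong[OF openin_coord[OF BS]]) (use B(4) in auto)
  then show "\<exists>V. open_Rn 1 V \<and> x \<in> V \<and> V \<subseteq> {x \<in> Rn 1. x 0 \<in> S} \<and> smooth_fun 1 V (\<lambda>x. f (x 0))"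
    using openin_coord[OF BS, of 1 0] x B(2) by (intro exI[of _ "{x \<in> Rn 1. x 0 \<in> B \<inter> S}"]) auto
qed

lemma smooth_map_real_subsets:
  assumes g: "smooth_on B g" "open B" and S: "S \<subseteq> B" "\<And>x. x \<in> S \<Longrightarrow> f x = g x" and fT: "f \<in> S \<rightarrow> T"
  shows "smooth_map (subset_diff real_line S) (subset_diff real_line T) f"
  unfolding smooth_map_def
proof (intro conjI allI ballI)
  show "f \<in> carrier (subset_diff real_line S) \<rightarrow> carrier (subset_diff real_line T)" using fT by auto
  fix n U q assume "q \<in> plots (subset_diff real_line S) n U"
  then have U: "open_Rn n U" and q: "smooth_fun n U q" "q \<in> U \<rightarrow> S" by auto
  have "smooth_fun n U (\<lambda>u. g (q u))" by (rule smooth_fun_compose1[OF U q(1) _ g]) (use q(2) S(1) in auto)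
  then have "smooth_fun n U (\<lambda>u. f (q u))" by (rule smooth_fun_cong[OF U]) (use q(2) S(2) in force)
  then show "f \<circ> q \<in> plots (subset_diff real_line T) n U" using U q(2) fT by (auto simp: comp_def Pi_iff)
qed

lemma smooth_inv_into:
  assumes g: "smooth_on A g" and A: "open A" and inj: "inj_on g A" and pos: "\<And>t. t \<in> A \<Longrightarrow> deriv g t > 0"
  shows "open (g ` A)" "smooth_on (g ` A) (inv_into A g)"
proof -
  let ?J = "g ` A" and ?h = "inv_into A g"
  have cont: "continuous_on A g" using smooth_on_continuous[OF g] .
  show J: "open ?J" by (rule invariance_of_domain[OF cont A inj])
  have hg: "?h (g t) = t" if "t \<in> A" for t using inj that by (rule inv_into_f_f)
  have hJ: "?h ` ?J \<subseteq> A" using hg by auto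
  have D: "(?h has_real_derivative inverse (deriv g (?h y))) (at y)" if y: "y \<in> ?J" for y
  proof -
    obtain t where t: "t \<in> A" "y = g t" using y by blast
    define c where "c = deriv g t"
    have c: "c > 0" using pos[OF t(1)] by (simp add: c_def)
    have "(g has_derivative (\<lambda>x. c * x)) (at t)"
      using smooth_on_DERIV[OF g t(1)] by (simp add: c_def has_field_derivative_def)
    then have "(?h has_derivative (\<lambda>x. inverse c * x)) (at (g t))"
    proof (rule has_derivative_inverse_strong[rotated 4])
      show "(\<lambda>x. c * x) \<circ> (\<lambda>x. inverse c * x) = id" using c by (auto simp: fun_eq_iff)
    qed (use t(1) A cont hg in auto)
    then have "(?h has_real_derivative inverse (deriv g t)) (at (g t))"
      by (simp add: c_def has_field_derivative_def)
    then show ?thesis using t hg by simp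
  qed
  have inv: "smooth_on A (\<lambda>t. inverse (deriv g t))"
    using pos by (intro smooth_on_inverse smooth_on_deriv g A) (auto simp: less_le)
  have "Ck_on k ?J ?h" for k
  proof (induction k)
    case 0
    show ?case using D DERIV_isCont continuous_at_imp_continuous_on by (metis Ck_on_0)
  next
    case (Suc k)
    have "Ck_on k ?J (\<lambda>y. inverse (deriv g (?h y)))"
      using Ck_on_compose[OF J A hJ, of k "\<lambda>t. inverse (deriv g t)"] inv Suc by (simp add: smooth_on_def)
    then show ?case using Ck_on_SucI[OF J D] by blast
  qed
  then show "smooth_on ?J ?h" by (simp add: smooth_on_def)
qed

lemma op_diffeo_restrict:
  assumes g: "smooth_on UNIV g" and A: "open A" "inj_on g A" "\<And>t. t \<in> A \<Longrightarrow> deriv g t > 0" and S: "S \<subseteq> A"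
  shows "op_diffeo S (g ` S) g"
  unfolding op_diffeo_def
proof (intro conjI ballI)
  have gA: "smooth_on A g" by (rule smooth_on_subset[OF g open_UNIV A(1)]) simp
  note inv = smooth_inv_into[OF gA A]
  have inj: "inj_on g S" using inj_on_subset[OF A(2) S] .
  then show "bij_betw g S (g ` S)" by (simp add: bij_betw_def)
  show "smooth_map (subset_diff real_line S) (subset_diff real_line (g ` S)) g"
    by (rule smooth_map_real_subsets[OF g open_UNIV]) auto
  show "smooth_map (subset_diff real_line (g ` S)) (subset_diff real_line S) (inv_into S g)"
  proof (rule smooth_map_real_subsets[OF inv(2,1)])
    show "inv_into S g y = inv_into A g y" if "y \<in> g ` S" for y
      using that S inv_into_f_f[OF inj] inv_into_f_f[OF A(2)] by auto
  qed (use S inv_into_into[of _ g S] in auto)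
  fix t assume "t \<in> S"
  then show "\<exists>d>0. (g has_real_derivative d) (at t within S)"
    using A(3) S smooth_on_DERIV[OF gA] has_field_derivative_at_within by blast
qed

text \<open>Zero up to \<open>1/8\<close>, strictly increasing afterwards, and unbounded. It is used to make maps
strictly increasing in chosen regions without changing them elsewhere.\<close>

definition delayed :: "real \<Rightarrow> real" where
  "delayed v = v * step (8 * v - 1)"

lemma delayed_left: "v \<le> 1/8 \<Longrightarrow> delayed v = 0" and delayed_right: "v \<ge> 1/4 \<Longrightarrow> delayed v = v"
  by (simp_all add: delayed_def step_left step_right)

lemma delayed_range: "v \<ge> 0 \<Longrightarrow> delayed v \<le> v" "delayed v \<ge> 0"
proof -
  show "delayed v \<ge> 0"
    using step_range(1)[of "8 * v - 1"] by (cases "v \<ge> 0") (auto simp: delayed_left, simp add: delayed_def)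
  show "v \<ge> 0 \<Longrightarrow> delayed v \<le> v" using step_range(2)[of "8 * v - 1"] by (simp add: delayed_def mult_left_le)
qed

lemma smooth_delayed: "smooth_on UNIV delayed"
proof -
  have "smooth_on UNIV (\<lambda>v. v * step (8 * v + (- 1)))"
    by (rule smooth_on_mult[OF open_UNIV smooth_on_id smooth_on_compose_affine[OF smooth_step]])
  then show ?thesis by (simp add: delayed_def[abs_def])
qed

lemma deriv_delayed: "deriv delayed v = step (8 * v - 1) + v * (deriv step (8 * v - 1) * 8)"
proof (rule DERIV_imp_deriv)
  have "((\<lambda>v. step (8 * v + (- 1))) has_real_derivative deriv step (8 * v + (- 1)) * 8) (at v)"
    by (rule deriv_compose_affine[OF smooth_step])
  from DERIV_mult[OF DERIV_ident this]
  show "(delayed has_real_derivative step (8 * v - 1) + v * (deriv step (8 * v - 1) * 8)) (at v)"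
    by (simp add: delayed_def[abs_def] algebra_simps)
qed

lemma deriv_delayed_left: "v \<le> 1/8 \<Longrightarrow> deriv delayed v = 0"
proof -
  assume "v \<le> 1/8"
  show ?thesis
  proof (rule DERIV_zero_if_constant_near[OF smooth_on_DERIV[OF smooth_delayed]])
    show "v - 1 < v" "v \<in> {v - 1..v}" by auto
    show "delayed y = 0" if "y \<in> {v - 1..v}" for y using that \<open>v \<le> 1/8\<close> by (simp add: delayed_left)
  qed simp_all
qed

lemma deriv_delayed_pos: "v > 1/8 \<Longrightarrow> deriv delayed v > 0"
proof -
  assume v: "v > 1/8"
  have "step (8 * v - 1) > 0" using step_range(1)[of "8 * v - 1"] step_0_1(1)[of "8 * v - 1"] v by (simp add: less_le)
  moreover have "v * (deriv step (8 * v - 1) * 8) \<ge> 0" using v deriv_step_nonneg[of "8 * v - 1"] by simp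
  ultimately show ?thesis unfolding deriv_delayed by linarith
qed

lemma deriv_delayed_nonneg: "deriv delayed v \<ge> 0"
  using deriv_delayed_left[of v] deriv_delayed_pos[of v] by force

abbreviation rests_at :: "(real \<Rightarrow> real) \<Rightarrow> real \<Rightarrow> bool" where
  "rests_at w v \<equiv> \<exists>p q. p < q \<and> {p..q} \<subseteq> {0..1} \<and> (\<forall>t\<in>{p..q}. w t = v)"

text \<open>A nondecreasing map of the unit interval that stands still only at the finitely many values in \<open>V\<close>. The
generators \<open>reparam\<close> and \<open>stop\<close> of the equivalence of paths have no rest and one rest; the lemmas below
show that every rest map is a composition of such maps.\<close>

definition rest_map :: "(real \<Rightarrow> real) \<Rightarrow> real set \<Rightarrow> bool" where
  "rest_map w V \<longleftrightarrow> smooth_on UNIV w \<and> w 0 = 0 \<and> w 1 = 1 \<and> finite V \<and> (\<forall>t. deriv w t \<ge> 0) \<and>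
     (\<forall>t\<in>{0..1}. w t \<notin> V \<longrightarrow> deriv w t > 0) \<and> (\<forall>v\<in>V. rests_at w v)"

lemma rest_mapI:
  assumes "smooth_on UNIV w" "w 0 = 0" "w 1 = 1" "finite V" "\<And>t. deriv w t \<ge> 0"
    "\<And>t. t \<in> {0..1} \<Longrightarrow> w t \<notin> V \<Longrightarrow> deriv w t > 0" "\<And>v. v \<in> V \<Longrightarrow> rests_at w v"
  shows "rest_map w V"
  using assms unfolding rest_map_def by blast

lemma rest_mapD:
  assumes "rest_map w V"
  shows "smooth_on UNIV w" "w 0 = 0" "w 1 = 1" "finite V" "\<And>t. deriv w t \<ge> 0"
    "\<And>t. t \<in> {0..1} \<Longrightarrow> w t \<notin> V \<Longrightarrow> deriv w t > 0" "\<And>v. v \<in> V \<Longrightarrow> rests_at w v" "mono w" "w ` {0..1} = {0..1}"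
proof -
  show 1: "smooth_on UNIV w" "w 0 = 0" "w 1 = 1" "finite V" "\<And>t. deriv w t \<ge> 0"
    "\<And>t. t \<in> {0..1} \<Longrightarrow> w t \<notin> V \<Longrightarrow> deriv w t > 0" "\<And>v. v \<in> V \<Longrightarrow> rests_at w v"
    using assms unfolding rest_map_def by blast+
  show mono: "mono w" by (rule mono_if_deriv_nonneg[OF 1(1,5)])
  show "w ` {0..1} = {0..1}"
  proof
    show "w ` {0..1} \<subseteq> {0..1}" using monoD[OF mono, of 0] monoD[OF mono, of _ 1] 1(2,3) by auto
    have "continuous_on {0..1} w" using smooth_on_continuous[OF 1(1)] continuous_on_subset by blast
    then show "{0..1} \<subseteq> w ` {0..1}" using IVT'[of w 0 _ 1] 1(2,3) by fastforce
  qed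
qed

text \<open>Outside the unit interval such a map is strictly increasing and unbounded. This removes all boundary cases
when \<open>[0, 1]\<close> is cut at a rest.\<close>

definition proper_rest_map :: "(real \<Rightarrow> real) \<Rightarrow> real set \<Rightarrow> bool" where
  "proper_rest_map w V \<longleftrightarrow> rest_map w V \<and> surj w \<and> (\<forall>t. t \<notin> {0..1} \<longrightarrow> deriv w t > 0)"

lemma surj_if_unbounded:
  fixes w :: "real \<Rightarrow> real"
  assumes "smooth_on UNIV w" "\<And>y. \<exists>t. w t \<le> y" "\<And>y. \<exists>t. w t \<ge> y" "mono w"
  shows "surj w"
  unfolding surj_def
proof
  fix y
  obtain s t where st: "w s \<le> y" "y \<le> w t" using assms(2,3) by blast
  have "min s t \<le> t" "w (min s t) \<le> y" using st(1) monoD[OF assms(4), of "min s t" s] by auto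
  moreover have "continuous_on {min s t..t} w" using smooth_on_continuous[OF assms(1)] continuous_on_subset by blast
  ultimately show "\<exists>x. y = w x" using IVT'[of w "min s t" y t] st(2) by metis
qed

lemma proper_rest_map_exists:
  assumes w: "rest_map w V"
  shows "\<exists>w'. proper_rest_map w' V \<and> (\<forall>t\<in>{0..1}. w' t = w t)"
proof -
  note W = rest_mapD[OF w]
  \<comment> \<open>the correction terms start at \<open>t = 0\<close> downwards and at \<open>t = 1\<close> upwards\<close>
  define w' where "w' t = w t - delayed (- 1 * t + 1/8) + delayed (1 * t + (- 7/8))" for t
  have s: "smooth_on UNIV w'" unfolding w'_def[abs_def]
    by (intro smooth_on_add smooth_on_diff smooth_on_compose_affine smooth_delayed W(1) open_UNIV)
  have d: "deriv w' t = deriv w t + deriv delayed (1/8 - t) + deriv delayed (t - 7/8)" for t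
  proof (rule DERIV_imp_deriv)
    have "(w' has_real_derivative deriv w t - deriv delayed (- 1 * t + 1/8) * (- 1) + deriv delayed (1 * t + (- 7/8)) * 1) (at t)"
      unfolding w'_def[abs_def] using smooth_on_DERIV[OF W(1)] 
      by (intro DERIV_add DERIV_diff deriv_compose_affine[OF smooth_delayed]) simp
    then show "(w' has_real_derivative deriv w t + deriv delayed (1/8 - t) + deriv delayed (t - 7/8)) (at t)" by simp
  qed
  have eq: "w' t = w t" if "t \<in> {0..1}" for t using that by (simp add: w'_def delayed_left)
  have nonneg: "deriv w' t \<ge> deriv w t" for t unfolding d using deriv_delayed_nonneg by simp
  have out: "deriv w' t > 0" if "t \<notin> {0..1}" for t
  proof -
    have "1/8 - t > 1/8 \<or> t - 7/8 > 1/8" using that by auto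
    then show ?thesis unfolding d using W(5)[of t] deriv_delayed_pos[of "1/8 - t"] deriv_delayed_pos[of "t - 7/8"]
        deriv_delayed_nonneg[of "1/8 - t"] deriv_delayed_nonneg[of "t - 7/8"] by linarith
  qed
  have r: "rest_map w' V"
  proof (rule rest_mapI[OF s _ _ W(4)])
    show "w' 0 = 0" "w' 1 = 1" using eq[of 0] eq[of 1] W(2,3) by simp_all
    show "deriv w' t \<ge> 0" for t using nonneg[of t] W(5)[of t] by linarith
    show "deriv w' t > 0" if "t \<in> {0..1}" "w' t \<notin> V" for t
      using W(6)[OF that(1)] that eq[OF that(1)] nonneg[of t] by simp
    show "rests_at w' v" if vV: "v \<in> V" for v
    proof -
      obtain p q where pq: "p < q" "{p..q} \<subseteq> {0..1}" "\<forall>t\<in>{p..q}. w t = v" using W(7)[OF vV] by blast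
      then have "\<forall>t\<in>{p..q}. w' t = v" using eq subsetD[OF pq(2)] by simp
      then show ?thesis using pq(1,2) by blast
    qed
  qed
  have "surj w'"
  proof (rule surj_if_unbounded[OF s _ _ rest_mapD(8)[OF r]])
    show "\<exists>t. w' t \<ge> y" for y
    proof
      show "w' (max y 0 + 2) \<ge> y"
        using monoD[OF W(8), of 1 "max y 0 + 2"] W(3) by (simp add: w'_def delayed_left delayed_right)
    qed
    show "\<exists>t. w' t \<le> y" for y
    proof
      define t where "t = min y 0 - 2"
      have t: "t \<le> - 1" "t \<le> y" by (simp_all add: t_def)
      have "w t \<le> 0" using monoD[OF W(8), of t 0] W(2) t(1) by simp
      then show "w' t \<le> y" using t by (simp add: w'_def delayed_left delayed_right)
    qed
  qed
  then show ?thesis using r out eq unfolding proper_rest_map_def by blast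
qed

text \<open>Strict increase outside \<open>[0, 1]\<close> keeps the fibre inside, so it is a compact interval.\<close>

lemma proper_rest_map_fibre:
  assumes w: "proper_rest_map w V" and v: "v \<in> V"
  shows "\<exists>a b. a < b \<and> {a..b} \<subset> {0..1} \<and> (\<forall>t. w t = v \<longleftrightarrow> t \<in> {a..b})"
proof -
  have r: "rest_map w V" and out: "\<And>t. t \<notin> {0..1} \<Longrightarrow> deriv w t > 0" using w by (auto simp: proper_rest_map_def)
  note W = rest_mapD[OF r]
  define F where "F = {t. w t = v}"
  obtain p q where pq: "p < q" "{p..q} \<subseteq> {0..1}" "\<forall>t\<in>{p..q}. w t = v" using W(7)[OF v] by blast
  then have pF: "p \<in> F" "q \<in> F" "p \<in> {0..1}" by (auto simp: F_def)
  have F01: "F \<subseteq> {0..1}"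
  proof
    fix t assume "t \<in> F"
    then show "t \<in> {0..1}" using unique_point_if_deriv_pos[OF W(1,8) out, of t p] pF by (auto simp: F_def)
  qed
  then have bd: "bdd_above F" "bdd_below F" by (rule bdd_above_mono[OF bdd_above_Icc], rule bdd_below_mono[OF bdd_below_Icc])
  have "continuous_on UNIV w" using smooth_on_continuous[OF W(1)] .
  then have "closed F" unfolding F_def using continuous_closed_preimage_constant[of UNIV w v] by simp
  then have ab: "Inf F \<in> F" "Sup F \<in> F" using closed_contains_Inf closed_contains_Sup bd pF(1) by blast+
  have Fab: "t \<in> F \<longleftrightarrow> t \<in> {Inf F..Sup F}" for t
  proof
    show "t \<in> F \<Longrightarrow> t \<in> {Inf F..Sup F}" using bd by (auto intro: cInf_lower cSup_upper)
    show "t \<in> {Inf F..Sup F} \<Longrightarrow> t \<in> F"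
      using ab monoD[OF W(8), of "Inf F" t] monoD[OF W(8), of t "Sup F"] by (auto simp: F_def)
  qed
  have "Inf F < Sup F" using Fab[of p] Fab[of q] pF pq(1) by auto
  moreover have "{Inf F..Sup F} \<subseteq> {0..1}" using ab F01 by auto
  moreover have "{Inf F..Sup F} \<noteq> {0..1}"
  proof
    assume "{Inf F..Sup F} = {0..1}"
    then have "0 \<in> F" "1 \<in> F" using Fab[of 0] Fab[of 1] by simp_all
    then show False using W(2,3) by (simp add: F_def)
  qed
  moreover have "w t = v \<longleftrightarrow> t \<in> {Inf F..Sup F}" for t
  proof -
    have "w t = v \<longleftrightarrow> t \<in> F" by (simp add: F_def)
    then show ?thesis unfolding Fab .
  qed
  ultimately show ?thesis by (intro exI[of _ "Inf F"] exI[of _ "Sup F"] conjI allI psubsetI)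
qed

text \<open>One rest can be split off: \<open>w = \<xi> \<circ> \<sigma>\<close> where \<open>\<sigma>\<close> stops only at \<open>v\<close> and \<open>\<xi>\<close> only at the other values. The map \<open>\<sigma>\<close> is, up to
normalization, \<open>s = w + \<mu>\<close>, where \<open>\<mu>\<close> vanishes near the rest at \<open>v\<close> and increases strictly away from it,
so that all other rests are removed. Near the rest \<open>s = w\<close>, hence \<open>\<xi>\<close> is affine near the image of the rest; elsewhere
\<open>\<sigma>\<close> is invertible and \<open>\<xi> = w \<circ> \<sigma>\<^sup>-\<^sup>1\<close> is smooth.\<close>

lemma proper_rest_map_split:
  assumes w: "proper_rest_map w V" and v: "v \<in> V"
  obtains \<sigma> \<xi> a b t0 where "proper_rest_map \<xi> (V - {v})" "\<And>t. w t = \<xi> (\<sigma> t)" "smooth_on UNIV \<sigma>" "\<sigma> ` {0..1} = {0..1}"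
    "a < b" "{a..b} \<subset> {0..1}" "\<sigma> ` {a..b} = {t0}" "op_diffeo ({0..1} - {a..b}) ({0..1} - {t0}) \<sigma>"
proof -
  have r: "rest_map w V" and surj: "surj w" and out: "\<And>t. t \<notin> {0..1} \<Longrightarrow> deriv w t > 0"
    using w by (auto simp: proper_rest_map_def)
  note W = rest_mapD[OF r]
  obtain a b where ab: "a < b" "{a..b} \<subset> {0..1}" and fib: "\<And>t. w t = v \<longleftrightarrow> t \<in> {a..b}"
    using proper_rest_map_fibre[OF w v] by blast
  have ab01: "0 \<le> a" "b \<le> 1" "0 < a \<or> b < 1" using ab by auto
  obtain \<eta> where \<eta>: "\<eta> > 0" "\<And>v'. v' \<in> V \<Longrightarrow> v' \<noteq> v \<Longrightarrow> \<eta> \<le> dist v v'" using finite_set_avoid[OF W(4), of v] by blast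
  have wa: "w a = v" "w b = v" using fib ab(1) by auto
  have near: "\<exists>e>0. \<forall>t. \<bar>t - c\<bar> \<le> e \<longrightarrow> \<bar>w t - v\<bar> < \<eta>" if "w c = v" for c
  proof -
    obtain e where "e > 0" "\<forall>t. dist t c < e \<longrightarrow> dist (w t) (w c) < \<eta>"
      using smooth_on_isCont[OF W(1), of c] \<eta>(1) unfolding continuous_at_eps_delta by blast
    then show ?thesis by (intro exI[of _ "e/2"]) (auto simp: dist_real_def that)
  qed
  obtain e1 where e1: "e1 > 0" "\<And>t. \<bar>t - a\<bar> \<le> e1 \<Longrightarrow> \<bar>w t - v\<bar> < \<eta>" using near[OF wa(1)] by blast
  obtain e2 where e2: "e2 > 0" "\<And>t. \<bar>t - b\<bar> \<le> e2 \<Longrightarrow> \<bar>w t - v\<bar> < \<eta>" using near[OF wa(2)] by blast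
  \<comment> \<open>between \<open>l\<close> and \<open>r\<close> the only rest of \<open>w\<close> is the one at \<open>v\<close>\<close>
  define l r where "l = a - e1" and "r = b + e2"
  have inner: "deriv w t > 0" if t: "l \<le> t" "t \<le> r" "t \<notin> {a..b}" for t
  proof (cases "t \<in> {0..1}")
    case True
    have "\<bar>t - a\<bar> \<le> e1 \<or> \<bar>t - b\<bar> \<le> e2" using t by (auto simp: l_def r_def)
    then have "\<bar>w t - v\<bar> < \<eta>" using e1(2) e2(2) by blast
    moreover have "w t \<noteq> v" using fib t(3) by simp
    ultimately have "w t \<notin> V" using \<eta>(2)[of "w t"] by (auto simp: dist_real_def abs_minus_commute)
    then show ?thesis by (rule W(6)[OF True])
  qed (rule out)
  define \<mu> where "\<mu> t = delayed (1 * t + (1/8 - r)) - delayed (- 1 * t + (l + 1/8))" for t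
  have \<mu>s: "smooth_on UNIV \<mu>" unfolding \<mu>_def[abs_def]
    by (intro smooth_on_diff smooth_on_compose_affine smooth_delayed open_UNIV)
  have \<mu>d: "(\<mu> has_real_derivative deriv delayed (t + 1/8 - r) + deriv delayed (l + 1/8 - t)) (at t)" for t
  proof -
    have "(\<mu> has_real_derivative deriv delayed (1 * t + (1/8 - r)) * 1 - deriv delayed (- 1 * t + (l + 1/8)) * (- 1)) (at t)"
      unfolding \<mu>_def[abs_def] by (intro DERIV_diff deriv_compose_affine[OF smooth_delayed])
    then show ?thesis by (simp add: algebra_simps)
  qed
  have \<mu>0: "\<mu> t = 0" if "l \<le> t" "t \<le> r" for t using that by (simp add: \<mu>_def delayed_left)
  define s where "s t = w t + \<mu> t" for t
  have sd: "(s has_real_derivative deriv w t + (deriv delayed (t + 1/8 - r) + deriv delayed (l + 1/8 - t))) (at t)" for t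
    unfolding s_def[abs_def] using DERIV_add[OF smooth_on_DERIV[OF W(1)] \<mu>d] by simp
  have s_nonneg: "deriv s t \<ge> 0" and s_pos: "t \<notin> {a..b} \<Longrightarrow> deriv s t > 0" for t
  proof -
    note D = DERIV_imp_deriv[OF sd, of t] W(5)[of t] deriv_delayed_nonneg[of "t + 1/8 - r"] deriv_delayed_nonneg[of "l + 1/8 - t"]
    show "deriv s t \<ge> 0" using D by linarith
    assume t: "t \<notin> {a..b}"
    consider "l \<le> t" "t \<le> r" | "t < l" | "t > r" by linarith
    then show "deriv s t > 0"
    proof cases
      case 1 then show ?thesis using inner[OF 1 t] D by linarith
    next
      case 2 then show ?thesis using deriv_delayed_pos[of "l + 1/8 - t"] D by linarith
    next
      case 3 then show ?thesis using deriv_delayed_pos[of "t + 1/8 - r"] D by linarith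
    qed
  qed
  have ss: "smooth_on UNIV s" unfolding s_def[abs_def] by (intro smooth_on_add W(1) \<mu>s open_UNIV)
  have smono: "mono s" by (rule mono_if_deriv_nonneg[OF ss s_nonneg])
  have suniq: "s z = s x \<Longrightarrow> x \<notin> {a..b} \<Longrightarrow> z = x" for x z
    using unique_point_if_deriv_pos[OF ss smono s_pos] by blast
  define L where "L = s 1 - s 0"
  have L: "L > 0"
  proof -
    have "s 0 \<noteq> s 1" using suniq[of 0 1] suniq[of 1 0] ab01 by auto
    then show ?thesis using monoD[OF smono, of 0 1] by (simp add: L_def)
  qed
  define \<sigma> where "\<sigma> t = (s t - s 0) / L" for t
  have \<sigma>s: "smooth_on UNIV \<sigma>" unfolding \<sigma>_def[abs_def] by (intro smooth_on_divide_const smooth_on_diff ss smooth_on_const open_UNIV)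
  have \<sigma>d: "deriv \<sigma> t = deriv s t / L" for t
  proof (rule DERIV_imp_deriv)
    have "(s has_real_derivative deriv s t) (at t)" using smooth_on_DERIV[OF ss] by simp
    then have "(\<sigma> has_real_derivative (deriv s t - 0) / L) (at t)"
      unfolding \<sigma>_def[abs_def] by (intro DERIV_cdivide DERIV_diff DERIV_const)
    then show "(\<sigma> has_real_derivative deriv s t / L) (at t)" by simp
  qed
  have \<sigma>01: "\<sigma> 0 = 0" "\<sigma> 1 = 1" using L by (simp_all add: \<sigma>_def L_def)
  have \<sigma>pos: "deriv \<sigma> t > 0" if "t \<notin> {a..b}" for t using s_pos[OF that] L by (simp add: \<sigma>d)
  have \<sigma>mono: "mono \<sigma>" by (rule mono_if_deriv_nonneg[OF \<sigma>s]) (use s_nonneg L in \<open>simp add: \<sigma>d\<close>)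
  have \<sigma>uniq: "\<sigma> z = \<sigma> x \<Longrightarrow> x \<notin> {a..b} \<Longrightarrow> z = x" for x z
    using unique_point_if_deriv_pos[OF \<sigma>s \<sigma>mono \<sigma>pos] by blast
  have \<sigma>surj: "surj \<sigma>"
  proof (rule surj_if_unbounded[OF \<sigma>s _ _ \<sigma>mono])
    have w_le: "\<mu> t \<ge> 0" if "t \<ge> l" for t using that delayed_range(2) by (simp add: \<mu>_def delayed_left)
    have w_ge: "\<mu> t \<le> 0" if "t \<le> r" for t using that delayed_range(2) by (simp add: \<mu>_def delayed_left)
    fix y
    obtain t where t: "w t = L * y + s 0" using surj by (metis surjD)
    have "s (max t l) \<ge> L * y + s 0" using monoD[OF W(8), of t "max t l"] w_le[of "max t l"] t by (simp add: s_def)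
    then show "\<exists>t. \<sigma> t \<ge> y" using L by (intro exI[of _ "max t l"]) (simp add: \<sigma>_def field_simps)
    have "s (min t r) \<le> L * y + s 0" using monoD[OF W(8), of "min t r" t] w_ge[of "min t r"] t by (simp add: s_def)
    then show "\<exists>t. \<sigma> t \<le> y" using L by (intro exI[of _ "min t r"]) (simp add: \<sigma>_def field_simps)
  qed
  define t0 where "t0 = \<sigma> a"
  have lr: "l < a" "b < r" using e1(1) e2(1) by (auto simp: l_def r_def)
  have \<sigma>lr: "\<sigma> t = (w t - s 0) / L" if "l \<le> t" "t \<le> r" for t using \<mu>0[OF that] by (simp add: \<sigma>_def s_def)
  have \<sigma>ab: "\<sigma> t = t0" if "t \<in> {a..b}" for t
    using that \<sigma>lr[of t] \<sigma>lr[of a] fib[of t] wa(1) lr ab(1) by (simp add: t0_def)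
  have \<sigma>t0: "\<sigma> t = t0 \<longleftrightarrow> t \<in> {a..b}" for t
  proof
    show "\<sigma> t = t0 \<Longrightarrow> t \<in> {a..b}" using \<sigma>uniq[of a t] ab(1) by (cases "t \<in> {a..b}") (auto simp: t0_def)
  qed (rule \<sigma>ab)
  have wfib: "w x = w y" if "\<sigma> x = \<sigma> y" for x y
    using that \<sigma>t0[of x] \<sigma>t0[of y] fib[of x] fib[of y] \<sigma>uniq[of x y] by metis
  define \<tau> where "\<tau> = inv_into UNIV \<sigma>"
  define \<xi> where "\<xi> u = w (\<tau> u)" for u
  have \<sigma>\<tau>: "\<sigma> (\<tau> u) = u" for u unfolding \<tau>_def using \<sigma>surj by (rule surj_f_inv_f)
  have \<xi>\<sigma>: "w t = \<xi> (\<sigma> t)" for t unfolding \<xi>_def by (rule wfib) (simp add: \<sigma>\<tau>)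
  have \<sigma>im: "\<sigma> ` {0..1} = {0..1}"
  proof
    show "\<sigma> ` {0..1} \<subseteq> {0..1}" using monoD[OF \<sigma>mono, of 0] monoD[OF \<sigma>mono, of _ 1] \<sigma>01 by auto
    have "continuous_on {0..1} \<sigma>" using smooth_on_continuous[OF \<sigma>s] continuous_on_subset by blast
    then show "{0..1} \<subseteq> \<sigma> ` {0..1}" using IVT'[of \<sigma> 0 _ 1] \<sigma>01 by fastforce
  qed
  let ?A = "- {a..b}"
  have A: "open ?A" "inj_on \<sigma> ?A" "\<And>t. t \<in> ?A \<Longrightarrow> deriv \<sigma> t > 0"
    using \<sigma>uniq \<sigma>pos by (auto simp: inj_on_def)
  have \<sigma>A: "\<sigma> ` ?A = - {t0}" 
  proof (intro equalityI subsetI)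
    show "u \<in> \<sigma> ` ?A" if "u \<in> - {t0}" for u
      using that \<sigma>t0[of "\<tau> u"] \<sigma>\<tau>[of u] by (intro image_eqI[of _ _ "\<tau> u"]) auto
  qed (use \<sigma>t0 in blast)
  have window: "\<xi> u = L * u + s 0" if "u \<in> {\<sigma> l<..<\<sigma> r}" for u
  proof -
    let ?t = "\<tau> u"
    have "\<not> ?t \<le> l" "\<not> r \<le> ?t" using that \<sigma>\<tau>[of u] monoD[OF \<sigma>mono, of ?t l] monoD[OF \<sigma>mono, of r ?t] by auto
    then have "l \<le> ?t" "?t \<le> r" by linarith+
    from \<sigma>lr[OF this] show ?thesis using L \<sigma>\<tau>[of u] by (simp add: \<xi>_def field_simps)
  qed
  have t0_window: "t0 \<in> {\<sigma> l<..<\<sigma> r}"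
    using monoD[OF \<sigma>mono, of l a] monoD[OF \<sigma>mono, of a r] \<sigma>t0[of l] \<sigma>t0[of r] lr ab(1) by (auto simp: t0_def less_le)
  have affine: "smooth_on B (\<lambda>u. L * u + s 0)" if "open B" for B
    by (rule smooth_on_subset[OF smooth_on_affine open_UNIV that]) simp
  have \<xi>s: "smooth_on UNIV \<xi>"
  proof (rule smooth_on_local[OF open_UNIV])
    fix u :: real
    show "\<exists>B g. open B \<and> u \<in> B \<and> smooth_on B g \<and> (\<forall>y\<in>B \<inter> UNIV. \<xi> y = g y)"
    proof (cases "u = t0")
      case True
      then show ?thesis using t0_window window affine[of "{\<sigma> l<..<\<sigma> r}"]
        by (intro exI[of _ "{\<sigma> l<..<\<sigma> r}"] exI[of _ "\<lambda>u. L * u + s 0"]) auto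
    next
      case False
      have \<sigma>onA: "smooth_on ?A \<sigma>" by (rule smooth_on_subset[OF \<sigma>s open_UNIV A(1)]) simp
      note inv = smooth_inv_into[OF \<sigma>onA A, unfolded \<sigma>A]
      have "smooth_on (- {t0}) (\<lambda>u. w (inv_into ?A \<sigma> u))" by (rule smooth_on_compose_UNIV[OF W(1) inv])
      moreover have "\<xi> y = w (inv_into ?A \<sigma> y)" if "y \<in> - {t0}" for y
        unfolding \<xi>_def by (rule wfib) (use that f_inv_into_f[of y \<sigma> ?A] \<sigma>A in \<open>simp add: \<sigma>\<tau>\<close>)
      ultimately show ?thesis using False inv(1)
        by (intro exI[of _ "- {t0}"] exI[of _ "\<lambda>u. w (inv_into ?A \<sigma> u)"]) auto
    qed
  qed
  have chain: "deriv w t = deriv \<xi> (\<sigma> t) * deriv \<sigma> t" for t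
  proof (rule DERIV_imp_deriv)
    have "((\<lambda>t. \<xi> (\<sigma> t)) has_real_derivative deriv \<xi> (\<sigma> t) * deriv \<sigma> t) (at t)"
      using DERIV_chain2[OF smooth_on_DERIV[OF \<xi>s] smooth_on_DERIV[OF \<sigma>s]] by simp
    then show "(w has_real_derivative deriv \<xi> (\<sigma> t) * deriv \<sigma> t) (at t)" by (simp only: \<xi>\<sigma>[symmetric])
  qed
  have at_t0: "deriv \<xi> t0 = L"
  proof (rule DERIV_imp_deriv)
    have ev: "\<forall>\<^sub>F u in nhds t0. \<xi> u = L * u + s 0"
      using eventually_nhds_in_open[OF open_greaterThanLessThan t0_window] by eventually_elim (rule window)
    show "(\<xi> has_real_derivative L) (at t0)"
      unfolding DERIV_cong_ev[OF refl ev refl] by (auto intro!: derivative_eq_intros)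
  qed
  have off_t0: "\<tau> u \<notin> {a..b}" "deriv \<xi> u = deriv w (\<tau> u) / deriv \<sigma> (\<tau> u)" "deriv \<sigma> (\<tau> u) > 0" if "u \<noteq> t0" for u
  proof -
    show 1: "\<tau> u \<notin> {a..b}" using \<sigma>t0[of "\<tau> u"] \<sigma>\<tau>[of u] that by simp
    show 2: "deriv \<sigma> (\<tau> u) > 0" by (rule \<sigma>pos[OF 1])
    show "deriv \<xi> u = deriv w (\<tau> u) / deriv \<sigma> (\<tau> u)" using chain[of "\<tau> u"] 2 by (simp add: \<sigma>\<tau>)
  qed
  have \<xi>01: "\<xi> 0 = 0" "\<xi> 1 = 1" using \<xi>\<sigma>[of 0] \<xi>\<sigma>[of 1] \<sigma>01 W(2,3) by simp_all
  have "rest_map \<xi> (V - {v})"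
  proof (rule rest_mapI[OF \<xi>s \<xi>01])
    show "finite (V - {v})" using W(4) by simp
    show "deriv \<xi> u \<ge> 0" for u
      using at_t0 L off_t0(2,3)[of u] W(5)[of "\<tau> u"] by (cases "u = t0") auto
    show "deriv \<xi> u > 0" if u: "u \<in> {0..1}" "\<xi> u \<notin> V - {v}" for u
    proof (cases "u = t0")
      case False
      have "\<tau> u \<in> {0..1} \<Longrightarrow> deriv w (\<tau> u) > 0"
        using W(6)[of "\<tau> u"] u(2) fib[of "\<tau> u"] off_t0(1)[OF False] by (auto simp: \<xi>_def)
      then have "deriv w (\<tau> u) > 0" using out by blast
      then show ?thesis using off_t0(2,3)[OF False] by simp
    qed (simp add: at_t0 L)
    fix v' assume v': "v' \<in> V - {v}"
    then obtain p q where pq: "p < q" "{p..q} \<subseteq> {0..1}" "\<forall>t\<in>{p..q}. w t = v'" using W(7) by blast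
    then have "w p = v'" by simp
    then have p: "p \<notin> {a..b}" using fib[of p] v' by auto
    have "\<sigma> p < \<sigma> q" using monoD[OF \<sigma>mono, of p q] \<sigma>uniq[of q p] p pq(1) by (auto simp: less_le)
    moreover have "\<sigma> p \<in> {0..1}" "\<sigma> q \<in> {0..1}" using \<sigma>im pq by auto
    moreover have "\<xi> u = v'" if u: "u \<in> {\<sigma> p..\<sigma> q}" for u
    proof -
      have "continuous_on {p..q} \<sigma>" using smooth_on_continuous[OF \<sigma>s] continuous_on_subset by blast
      then obtain t where "p \<le> t" "t \<le> q" "\<sigma> t = u" using IVT'[of \<sigma> p u q] u pq(1) by auto
      then show ?thesis using \<xi>\<sigma>[of t] pq(3) by auto
    qed
    ultimately show "rests_at \<xi> v'" by (intro exI[of _ "\<sigma> p"] exI[of _ "\<sigma> q"]) auto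
  qed
  moreover have "deriv \<xi> u > 0" if u: "u \<notin> {0..1}" for u
  proof (cases "u = t0")
    case False
    have "\<tau> u \<notin> {0..1}" using u \<sigma>im \<sigma>\<tau>[of u] by (metis imageI)
    from out[OF this] show ?thesis using off_t0(2,3)[OF False] by simp
  qed (simp add: at_t0 L)
  moreover have "surj \<xi>" using surj \<xi>\<sigma> by (metis surj_def)
  ultimately have "proper_rest_map \<xi> (V - {v})" unfolding proper_rest_map_def by blast
  moreover have "op_diffeo ({0..1} - {a..b}) ({0..1} - {t0}) \<sigma>"
  proof -
    have "\<sigma> ` ({0..1} - {a..b}) = {0..1} - {t0}"
    proof -
      have "t \<in> {a..b} \<longleftrightarrow> \<sigma> t \<in> {t0}" for t using \<sigma>t0[of t] by simp
      then have "\<sigma> ` ({0..1} - {a..b}) = \<sigma> ` {0..1} - {t0}" by blast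
      then show ?thesis by (simp only: \<sigma>im)
    qed
    moreover have "op_diffeo ({0..1} - {a..b}) (\<sigma> ` ({0..1} - {a..b})) \<sigma>"
      by (rule op_diffeo_restrict[OF \<sigma>s A]) blast+
    ultimately show ?thesis by simp
  qed
  moreover have "\<sigma> ` {a..b} = {t0}" using \<sigma>ab ab(1) by force
  ultimately show ?thesis using that \<xi>\<sigma> \<sigma>s \<sigma>im ab by blast
qed

context diffeological_space
begin

lemma smooth_paths_reparam:
  assumes \<gamma>: "\<gamma> \<in> smooth_paths X" and \<psi>: "smooth_map I01 I01 \<psi>"
  shows "unit_path (\<gamma> \<circ> \<psi>) \<in> smooth_paths X"
proof (rule unit_path_in_smooth_paths)
  have "smooth_map I01 X \<gamma>" using \<gamma> by (simp add: smooth_paths_iff)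
  with \<psi> show "smooth_map I01 X (\<gamma> \<circ> \<psi>)"
    unfolding smooth_map_def by (auto simp: comp_assoc Pi_iff)
qed

lemma path_reparam_in_path_space:
  "\<gamma> \<in> paths_from X x0 \<Longrightarrow> smooth_map I01 I01 \<psi> \<Longrightarrow> \<psi> 0 = 0 \<Longrightarrow> unit_path (\<gamma> \<circ> \<psi>) \<in> paths_from X x0"
  by (simp add: path_space_iff smooth_paths_reparam)

lemma rest_map_path:
  assumes "K \<in> paths_from X x0" "rest_map w V"
  shows "unit_path (K \<circ> w) \<in> paths_from X x0"
proof (rule path_reparam_in_path_space[where \<psi> = w, OF assms(1) _ rest_mapD(2)[OF assms(2)]])
  show "smooth_map I01 I01 w"
    by (rule smooth_map_real_subsets[OF rest_mapD(1)[OF assms(2)] open_UNIV]) (use rest_mapD(9)[OF assms(2)] in auto)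
qed

text \<open>By induction on the number of rests, each split off as one \<open>stop\<close>. A map without
rests is a diffeomorphism.\<close>

lemma geo_proper_rest:
  assumes "K \<in> paths_from X x0" "proper_rest_map w V"
  shows "geo_equiv X x0 K (unit_path (K \<circ> w))"
proof -
  have "finite V" using rest_mapD(4) assms(2) by (auto simp: proper_rest_map_def)
  then show ?thesis using assms
  proof (induction "card V" arbitrary: V w K)
    case 0
    then have r: "rest_map w {}" and out: "\<And>t. t \<notin> {0..1} \<Longrightarrow> deriv w t > 0" by (auto simp: proper_rest_map_def)
    note wD = rest_mapD[OF r]
    have pos: "deriv w t > 0" for t using out wD(6) by (cases "t \<in> {0..1}") auto
    have "op_diffeo {0..1} {0..1} w"
      using op_diffeo_restrict[OF wD(1) open_UNIV _ pos, of "{0..1}"] unique_point_if_deriv_pos[OF wD(1,8) pos] wD(9)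
      by (simp add: inj_on_def)
    then have "geo_step X x0 K (unit_path (K \<circ> w))" using 0 by (intro geo_step.reparam)
    then show ?case by (rule r_into_equivclp[of "geo_step X x0"])
  next
    case (Suc n)
    then obtain v where v: "v \<in> V" by (metis card.empty ex_in_conv nat.distinct(1))
    obtain \<sigma> \<xi> a b t0 where sp: "proper_rest_map \<xi> (V - {v})" "\<And>t. w t = \<xi> (\<sigma> t)"
      "smooth_on UNIV \<sigma>" "\<sigma> ` {0..1} = {0..1}" "a < b" "{a..b} \<subset> {0..1}" "\<sigma> ` {a..b} = {t0}"
      "op_diffeo ({0..1} - {a..b}) ({0..1} - {t0}) \<sigma>"
      by (rule proper_rest_map_split[OF Suc.prems(3) v]) (rule that; assumption)
    have "geo_equiv X x0 K (unit_path (K \<circ> \<xi>))"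
      using Suc.hyps(1)[of "V - {v}"] Suc.hyps(2) Suc.prems v sp(1) by simp
    moreover have "geo_step X x0 (unit_path (K \<circ> \<xi>)) (unit_path (unit_path (K \<circ> \<xi>) \<circ> \<sigma>))"
    proof (rule geo_step.stop[OF _ _ sp(5-8)])
      show "unit_path (K \<circ> \<xi>) \<in> paths_from X x0"
        using rest_map_path[OF Suc.prems(2)] sp(1) by (auto simp: proper_rest_map_def)
      show "smooth_map I01 I01 \<sigma>" by (rule smooth_map_real_subsets[OF sp(3) open_UNIV]) (use sp(4) in auto)
    qed
    moreover have "unit_path (unit_path (K \<circ> \<xi>) \<circ> \<sigma>) = unit_path (K \<circ> w)"
    proof
      fix t show "unit_path (unit_path (K \<circ> \<xi>) \<circ> \<sigma>) t = unit_path (K \<circ> w) t"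
        using sp(2)[of t] sp(4) by (cases "t \<in> {0..1}") auto
    qed
    ultimately show ?case by (metis equivclp_into_equivclp)
  qed
qed

lemma geo_rest:
  assumes "K \<in> paths_from X x0" "rest_map w V"
  shows "geo_equiv X x0 K (unit_path (K \<circ> w))"
proof -
  obtain w' where w': "proper_rest_map w' V" "\<forall>t\<in>{0..1}. w' t = w t" using proper_rest_map_exists[OF assms(2)] by blast
  have "unit_path (K \<circ> w') = unit_path (K \<circ> w)" using w'(2) by (intro restrict_ext) simp
  then show ?thesis using geo_proper_rest[OF assms(1) w'(1)] by simp
qed

end

section \<open>Flat steps\<close>

text \<open>A path becomes a curve on \<open>\<real>\<close> with sitting instants when it is composed with such a step.\<close>

definition flat_step :: "(real \<Rightarrow> real) \<Rightarrow> real set \<Rightarrow> bool" where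
  "flat_step c V \<longleftrightarrow> smooth_on UNIV c \<and> mono c \<and> finite V \<and>
     (\<exists>e>0. e < 1/2 \<and> (\<forall>t\<le>e. c t = 0) \<and> (\<forall>t\<ge>1-e. c t = 1)) \<and>
     (\<forall>t. c t \<notin> V \<longrightarrow> deriv c t > 0) \<and>
     (\<forall>v\<in>V. rests_at c v)"

lemma flat_stepD:
  assumes "flat_step c V"
  shows "smooth_on UNIV c" "mono c" "finite V" "\<And>t. t \<le> 0 \<Longrightarrow> c t = 0" "\<And>t. t \<ge> 1 \<Longrightarrow> c t = 1"
    "0 \<le> c t" "c t \<le> 1" "c t \<in> {0..1}" "\<And>t. c t \<notin> V \<Longrightarrow> deriv c t > 0"
    "\<And>v. v \<in> V \<Longrightarrow> rests_at c v"
    "deriv c t \<ge> 0"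
proof -
  obtain e where e: "e > 0" "e < 1/2" "\<forall>t\<le>e. c t = 0" "\<forall>t\<ge>1-e. c t = 1" using assms by (auto simp: flat_step_def)
  show 1: "smooth_on UNIV c" "mono c" "finite V" "\<And>t. c t \<notin> V \<Longrightarrow> deriv c t > 0"
    "\<And>v. v \<in> V \<Longrightarrow> rests_at c v"
    using assms unfolding flat_step_def by blast+
  show l: "c t = 0" if "t \<le> 0" for t using e that by auto
  show r: "c t = 1" if "t \<ge> 1" for t using e that by auto
  show "0 \<le> c t" "c t \<le> 1" using monoD[OF 1(2), of "min t 0" t] monoD[OF 1(2), of t "max t 1"] l[of "min t 0"] r[of "max t 1"] by auto
  then show "c t \<in> {0..1}" by simp
  show "deriv c t \<ge> 0" using smooth_on_DERIV[OF 1(1)] 1(2) by (intro DERIV_nonneg_if_mono[of c]) auto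
qed

lemma flat_step_flat: "flat_step c V \<Longrightarrow> \<exists>e>0. e < 1/2 \<and> (\<forall>t\<le>e. c t = 0) \<and> (\<forall>t\<ge>1-e. c t = 1)"
  by (simp add: flat_step_def)

lemma flat_step_ramp: "flat_step c V \<Longrightarrow> \<exists>a b. smooth_ramp c a b"
proof -
  assume c: "flat_step c V"
  obtain e where e: "e > 0" "e < 1/2" "\<forall>t\<le>e. c t = 0" "\<forall>t\<ge>1-e. c t = 1" using flat_step_flat[OF c] by blast
  have "smooth_ramp c e (1 - e)"
    by unfold_locales (use e flat_stepD[OF c] in auto)
  then show ?thesis by blast
qed

lemma flat_step_rest_map:
  assumes "flat_step c V"
  shows "rest_map c V"
  using flat_stepD[OF assms] by (intro rest_mapI) auto

definition base_step :: "real \<Rightarrow> real" where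
  "base_step t = step (3 * t - 1)"

lemma base_step_values: "t \<le> 1/3 \<Longrightarrow> base_step t = 0" "t \<ge> 2/3 \<Longrightarrow> base_step t = 1"
  by (simp_all add: base_step_def step_left step_right)

lemma base_step_symmetric: "base_step (1 - t) = 1 - base_step t"
  using step_symmetric[of "3 * t - 1"] by (simp add: base_step_def algebra_simps)

lemma deriv_base_step: "(base_step has_real_derivative deriv step (3 * t - 1) * 3) (at t)"
  using deriv_compose_affine[OF smooth_step, of 3 "-1" t] by (simp add: base_step_def[abs_def])

lemma base_step_0_1: "base_step t = 0 \<longleftrightarrow> t \<le> 1/3" "base_step t = 1 \<longleftrightarrow> t \<ge> 2/3"
  by (auto simp: base_step_def step_0_1)

lemma smooth_base_step: "smooth_on UNIV base_step"
  using smooth_on_compose_affine[OF smooth_step, of 3 "-1"] by (simp add: base_step_def[abs_def])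

lemma flat_base_step: "flat_step base_step {0, 1}"
  unfolding flat_step_def
proof (intro conjI allI impI ballI)
  have d: "deriv base_step t = deriv step (3 * t - 1) * 3" for t by (rule DERIV_imp_deriv[OF deriv_base_step])
  show "mono base_step" by (rule mono_if_deriv_nonneg[OF smooth_base_step]) (simp add: d deriv_step_nonneg)
  show "\<exists>e>0. e < 1/2 \<and> (\<forall>t\<le>e. base_step t = 0) \<and> (\<forall>t\<ge>1-e. base_step t = 1)"
    by (intro exI[of _ "1/3"]) (auto simp: base_step_values)
  show "deriv base_step t > 0" if "base_step t \<notin> {0, 1}" for t
    using that deriv_step_pos[of "3 * t - 1"] by (auto simp: d base_step_0_1)
  fix v :: real assume "v \<in> {0, 1}"
  then consider "v = 0" | "v = 1" by auto
  then show "rests_at base_step v"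
  proof cases
    case 1 then show ?thesis by (intro exI[of _ 0] exI[of _ "1/3"]) (auto simp: base_step_values)
  next
    case 2 then show ?thesis by (intro exI[of _ "2/3"] exI[of _ 1]) (auto simp: base_step_values)
  qed
qed (auto simp: smooth_base_step)

lemma flat_step_reflect:
  assumes c: "flat_step c V"
  shows "flat_step (\<lambda>t. 1 - c (1 - t)) ((\<lambda>v. 1 - v) ` V)"
proof -
  note C = flat_stepD[OF c]
  obtain e where e: "e > 0" "e < 1/2" "\<forall>t\<le>e. c t = 0" "\<forall>t\<ge>1-e. c t = 1" using flat_step_flat[OF c] by blast
  have d: "((\<lambda>t. 1 - c (- 1 * t + 1)) has_real_derivative 0 - deriv c (- 1 * t + 1) * (- 1)) (at t)" for t
    by (intro DERIV_diff DERIV_const deriv_compose_affine[OF C(1)])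
  have s: "smooth_on UNIV (\<lambda>t. 1 - c (- 1 * t + 1))"
    by (intro smooth_on_diff smooth_on_const smooth_on_compose_affine C(1) open_UNIV)
  show ?thesis
    unfolding flat_step_def
  proof (intro conjI allI impI ballI)
    show "smooth_on UNIV (\<lambda>t. 1 - c (1 - t))" using s by simp
    show "mono (\<lambda>t. 1 - c (1 - t))" using monoD[OF C(2)] by (simp add: mono_def)
    show "\<exists>e>0. e < 1/2 \<and> (\<forall>t\<le>e. 1 - c (1 - t) = 0) \<and> (\<forall>t\<ge>1-e. 1 - c (1 - t) = 1)"
      using e by (intro exI[of _ e]) auto
    show "deriv (\<lambda>t. 1 - c (1 - t)) t > 0" if "1 - c (1 - t) \<notin> (\<lambda>v. 1 - v) ` V" for t
      using DERIV_imp_deriv[OF d, of t] C(9)[of "1 - t"] that by force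
    show "rests_at (\<lambda>t. 1 - c (1 - t)) v" if v: "v \<in> (\<lambda>v. 1 - v) ` V" for v
    proof -
      obtain u where u: "u \<in> V" "v = 1 - u" using v by blast
      obtain p q where "p < q" "{p..q} \<subseteq> {0..1}" "\<forall>t\<in>{p..q}. c t = u" using C(10)[OF u(1)] by blast
      then show ?thesis using u(2) by (intro exI[of _ "1 - q"] exI[of _ "1 - p"]) auto
    qed
  qed (simp add: C(3))
qed

text \<open>Joining two steps with weights \<open>l\<close> and \<open>1 - l\<close>. Concatenation is turned into composition by these
maps: \<open>join f g\<close> composed with a weighted join is a concatenation of composed curves, and other ways of bracketing
correspond to other weights.\<close>

definition wjoin :: "real \<Rightarrow> (real \<Rightarrow> real) \<Rightarrow> (real \<Rightarrow> real) \<Rightarrow> real \<Rightarrow> real" where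
  "wjoin l c c' t = l * c (2 * t) + (1 - l) * c' (2 * t - 1)"

text \<open>The degenerate weights \<open>0\<close> and \<open>1\<close> are included; they describe concatenation with a constant curve.\<close>

lemma flat_step_wjoin:
  assumes l: "0 \<le> l" "l \<le> 1" and c: "flat_step c V" and c': "flat_step c' V'"
  shows "\<exists>W. flat_step (wjoin l c c') W"
proof -
  note C = flat_stepD[OF c] and C' = flat_stepD[OF c']
  define W where "W = (\<lambda>v. l * v) ` V \<union> (\<lambda>v. l + (1 - l) * v) ` V'"
  have D: "(wjoin l c c' has_real_derivative l * (deriv c (2 * t) * 2) + (1 - l) * (deriv c' (2 * t - 1) * 2)) (at t)" for t
    unfolding wjoin_def[abs_def]
    using deriv_compose_affine[OF C(1), of 2 0 t] deriv_compose_affine[OF C'(1), of 2 "-1" t]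
    by (intro DERIV_add DERIV_cmult) simp_all
  have d: "deriv (wjoin l c c') t = l * (deriv c (2 * t) * 2) + (1 - l) * (deriv c' (2 * t - 1) * 2)" for t
    by (rule DERIV_imp_deriv[OF D])
  have s: "smooth_on UNIV (wjoin l c c')"
  proof -
    have "smooth_on UNIV (\<lambda>t. l * c (2 * t + 0) + (1 - l) * c' (2 * t + (- 1)))"
      by (rule smooth_on_add[OF open_UNIV smooth_on_cmult[OF open_UNIV smooth_on_compose_affine[OF C(1)]]
            smooth_on_cmult[OF open_UNIV smooth_on_compose_affine[OF C'(1)]]])
    then show ?thesis by (simp add: wjoin_def[abs_def])
  qed
  have dn: "deriv c t \<ge> 0" "deriv c' t \<ge> 0" for t using flat_stepD(11)[OF c] flat_stepD(11)[OF c'] by simp_all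
  have "flat_step (wjoin l c c') W"
    unfolding flat_step_def
  proof (intro conjI allI impI ballI)
    show "smooth_on UNIV (wjoin l c c')" by (rule s)
    show "mono (wjoin l c c')" by (rule mono_if_deriv_nonneg[OF s]) (use l dn in \<open>simp add: d\<close>)
    show "finite W" using C(3) C'(3) by (simp add: W_def)
    obtain e where e: "e > 0" "e < 1/2" "\<forall>t\<le>e. c t = 0" "\<forall>t\<ge>1-e. c t = 1" using flat_step_flat[OF c] by blast
    obtain e' where e': "e' > 0" "e' < 1/2" "\<forall>t\<le>e'. c' t = 0" "\<forall>t\<ge>1-e'. c' t = 1" using flat_step_flat[OF c'] by blast
    show "\<exists>e>0. e < 1/2 \<and> (\<forall>t\<le>e. wjoin l c c' t = 0) \<and> (\<forall>t\<ge>1-e. wjoin l c c' t = 1)"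
      by (rule exI[of _ "min e e' / 2"]) (use e e' in \<open>auto simp: wjoin_def\<close>)
    show "deriv (wjoin l c c') t > 0" if "wjoin l c c' t \<notin> W" for t
    proof (cases "t \<le> 1/2")
      case True
      then have eq: "wjoin l c c' t = l * c (2 * t)" using C'(4) by (simp add: wjoin_def)
      then have nV: "c (2 * t) \<notin> V" using that by (auto simp: W_def)
      \<comment> \<open>otherwise \<open>wjoin\<close> is constant here; its value \<open>0\<close> lies in \<open>W\<close> since \<open>c\<close> itself rests at \<open>0\<close>\<close>
      moreover have "l \<noteq> 0"
      proof
        assume "l = 0"
        have "0 \<in> V" 
        proof (rule ccontr)
          assume "0 \<notin> V"
          then have "deriv c (-1) > 0" using C(9)[of "-1"] C(4)[of "-1"] by simp
          moreover have "deriv c (-1) = 0"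
            by (rule DERIV_zero_if_constant_near[OF smooth_on_DERIV[OF C(1)], of "-1" "-2" 0 0]) (use C(4) in auto)
          ultimately show False by simp
        qed
        then show False using that eq \<open>l = 0\<close> by (auto simp: W_def)
      qed
      ultimately have "l * (deriv c (2 * t) * 2) > 0" using C(9)[OF nV] l by simp
      moreover have "(1 - l) * (deriv c' (2 * t - 1) * 2) \<ge> 0" using l dn by simp
      ultimately show ?thesis unfolding d by linarith
    next
      case False
      then have eq: "wjoin l c c' t = l + (1 - l) * c' (2 * t - 1)" using C(5) by (simp add: wjoin_def)
      then have nV: "c' (2 * t - 1) \<notin> V'" using that by (auto simp: W_def)
      moreover have "l \<noteq> 1"
      proof
        assume "l = 1"
        have "0 \<in> V'" 
        proof (rule ccontr)
          assume "0 \<notin> V'"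
          then have "deriv c' (-1) > 0" using C'(9)[of "-1"] C'(4)[of "-1"] by simp
          moreover have "deriv c' (-1) = 0"
            by (rule DERIV_zero_if_constant_near[OF smooth_on_DERIV[OF C'(1)], of "-1" "-2" 0 0]) (use C'(4) in auto)
          ultimately show False by simp
        qed
        then show False using that eq \<open>l = 1\<close> by (auto simp: W_def)
      qed
      ultimately have "(1 - l) * (deriv c' (2 * t - 1) * 2) > 0" using C'(9)[OF nV] l by simp
      moreover have "l * (deriv c (2 * t) * 2) \<ge> 0" using l dn by simp
      ultimately show ?thesis unfolding d by linarith
    qed
    fix v assume "v \<in> W"
    then consider u where "u \<in> V" "v = l * u" | u where "u \<in> V'" "v = l + (1 - l) * u" by (auto simp: W_def)
    then show "rests_at (wjoin l c c') v"
    proof cases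
      case 1
      then obtain p q where pq: "p < q" "{p..q} \<subseteq> {0..1}" "\<forall>t\<in>{p..q}. c t = u" using C(10) by blast
      then show ?thesis using 1 C'(4)
        by (intro exI[of _ "p / 2"] exI[of _ "q / 2"]) (auto simp: wjoin_def)
    next
      case 2
      then obtain p q where pq: "p < q" "{p..q} \<subseteq> {0..1}" "\<forall>t\<in>{p..q}. c' t = u" using C'(10) by blast
      then show ?thesis using 2 C(5)
        by (intro exI[of _ "(1 + p) / 2"] exI[of _ "(1 + q) / 2"]) (auto simp: wjoin_def)
    qed
  qed
  then show ?thesis by blast
qed

lemma wjoin_range: "flat_step c V \<Longrightarrow> flat_step c' V' \<Longrightarrow> 0 \<le> l \<Longrightarrow> l \<le> 1 \<Longrightarrow> wjoin l c c' t \<in> {0..1}"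
  using flat_step_wjoin flat_stepD(8) by blast

lemma join_wjoin:
  assumes "flat_step c V" "flat_step c' V'" "f 1 = g 0"
  shows "join f g (wjoin (1/2) c c' t) = join (\<lambda>t. f (c t)) (\<lambda>t. g (c' t)) t"
proof (cases "t \<le> 1/2")
  case True
  then show ?thesis using flat_stepD(4)[OF assms(2), of "2 * t - 1"] flat_stepD(7)[OF assms(1), of "2 * t"] by (simp add: wjoin_def join_def)
next
  case False
  then have 1: "wjoin (1/2) c c' t = 1/2 + 1/2 * c' (2 * t - 1)" using flat_stepD(5)[OF assms(1), of "2 * t"] by (simp add: wjoin_def)
  show ?thesis
  proof (cases "c' (2 * t - 1) = 0")
    case True
    then show ?thesis unfolding 1 using False assms(3) by (simp add: join_def)
  next
    case False
    then have "c' (2 * t - 1) > 0" using flat_stepD(6)[OF assms(2), of "2 * t - 1"] by simp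
    then show ?thesis unfolding 1 using \<open>\<not> t \<le> 1/2\<close> by (simp add: join_def)
  qed
qed

text \<open>The weights give the three pieces of \<open>join f (join g h)\<close> their shares \<open>1/2\<close>, \<open>1/4\<close>, \<open>1/4\<close> of the unit
interval.\<close>

lemma join_assoc_wjoin:
  assumes "flat_step c V" "flat_step c' V'" "flat_step c'' V''" "f 1 = g 0" "g 1 = h 0"
  shows "join f (join g h) (wjoin (3/4) (wjoin (2/3) c c') c'' t) =
     join (join (\<lambda>t. f (c t)) (\<lambda>t. g (c' t))) (\<lambda>t. h (c'' t)) t"
proof -
  let ?w = "wjoin (3/4) (wjoin (2/3) c c') c'' t"
  have w: "?w = c (4 * t) / 2 + c' (4 * t - 1) / 4 + c'' (2 * t - 1) / 4"
    by (simp add: wjoin_def algebra_simps)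
  consider "t \<le> 1/4" | "1/4 < t" "t \<le> 1/2" | "1/2 < t" by linarith
  then show ?thesis
  proof cases
    case 1
    then have 2: "?w = c (4 * t) / 2" using w flat_stepD(4)[OF assms(2), of "4 * t - 1"] flat_stepD(4)[OF assms(3), of "2 * t - 1"] by simp
    show ?thesis unfolding 2 using 1 flat_stepD(7)[OF assms(1), of "4 * t"] by (simp add: join_def)
  next
    case 2
    then have 3: "?w = 1/2 + c' (4 * t - 1) / 4" using w flat_stepD(5)[OF assms(1), of "4 * t"] flat_stepD(4)[OF assms(3), of "2 * t - 1"] by simp
    show ?thesis
    proof (cases "c' (4 * t - 1) = 0")
      case True then show ?thesis unfolding 3 using 2 assms(4) by (simp add: join_def)
    next
      case False
      then have "c' (4 * t - 1) > 0" using flat_stepD(6)[OF assms(2), of "4 * t - 1"] by simp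
      then show ?thesis unfolding 3 using 2 flat_stepD(7)[OF assms(2), of "4 * t - 1"] by (simp add: join_def)
    qed
  next
    case 3
    then have 4: "?w = 3/4 + c'' (2 * t - 1) / 4" using w flat_stepD(5)[OF assms(1), of "4 * t"] flat_stepD(5)[OF assms(2), of "4 * t - 1"] by simp
    show ?thesis
    proof (cases "c'' (2 * t - 1) = 0")
      case True then show ?thesis unfolding 4 using 3 assms(5) by (simp add: join_def)
    next
      case False
      then have "c'' (2 * t - 1) > 0" using flat_stepD(6)[OF assms(3), of "2 * t - 1"] by simp
      then show ?thesis unfolding 4 using 3 by (simp add: join_def)
    qed
  qed
qed

lemma join_const_right: "flat_step c V \<Longrightarrow> join (\<lambda>t. f (c t)) (\<lambda>t. f 1) t = f (wjoin 1 c c' t)"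
  using flat_stepD(5)[of c V "2 * t"] by (simp add: join_def wjoin_def)

lemma join_const_left: "flat_step c' V \<Longrightarrow> join (\<lambda>t. f 0) (\<lambda>t. f (c' t)) t = f (wjoin 0 c c' t)"
  using flat_stepD(4)[of c' V "2 * t - 1"] by (simp add: join_def wjoin_def)

text \<open>The maps \<open>\<psi>\<close> by which a generator reparametrizes a path are smooth only on \<open>[0, 1]\<close>. Composed with
\<open>base_step\<close> they become flat steps, so that no boundary behaviour of \<open>\<psi>\<close> is left to consider.\<close>

lemma flat_step_compose:
  assumes \<psi>: "smooth_map I01 I01 \<psi>" and im: "\<psi> ` {0..1} = {0..1}" and T: "finite T"
    and pos: "\<And>u. 0 < u \<Longrightarrow> u < 1 \<Longrightarrow> \<psi> u \<notin> T \<Longrightarrow> \<exists>d>0. (\<psi> has_real_derivative d) (at u)"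
    and rest: "\<And>u. 0 < u \<Longrightarrow> u < 1 \<Longrightarrow> \<psi> u \<in> T \<Longrightarrow> \<exists>p q. p < q \<and> {p..q} \<subseteq> {0..1} \<and> u \<in> {p..q} \<and> (\<forall>t\<in>{p..q}. \<psi> t = \<psi> u)"
    and restT: "\<And>v. v \<in> T \<Longrightarrow> rests_at \<psi> v"
  shows "flat_step (\<lambda>t. \<psi> (base_step t)) ({0, 1} \<union> T)" "\<psi> 0 = 0" "\<psi> 1 = 1"
proof -
  note B = flat_stepD[OF flat_base_step]
  let ?c = "\<lambda>t. \<psi> (base_step t)"
  have s: "smooth_on UNIV ?c"
  proof -
    have "(\<lambda>x. base_step (x 0)) \<in> plots I01 1 (Rn 1)"
      using smooth_fun_coord[OF smooth_base_step, of 1 0] B(8) by simp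
    then have "\<psi> \<circ> (\<lambda>x. base_step (x 0)) \<in> plots I01 1 (Rn 1)" using \<psi> unfolding smooth_map_def by blast
    then have "smooth_fun 1 {x \<in> Rn 1. x 0 \<in> UNIV} (\<lambda>x. ?c (x 0))" by (simp add: comp_def)
    then show ?thesis using smooth_on_iff_smooth_fun[OF open_UNIV] by blast
  qed
  have surj: "\<exists>t\<in>{0..1}. base_step t = u" if u: "u \<in> {0..1}" for u
    using IVT'[of base_step 0 u 1] u B(4)[of 0] B(5)[of 1] smooth_on_continuous[OF B(1)] continuous_on_subset
    by (metis atLeastAtMost_iff order_refl subset_UNIV zero_le_one)
  have preimage_Icc: "\<exists>p' q'. p' < q' \<and> {p'..q'} \<subseteq> {0..1} \<and> base_step ` {p'..q'} \<subseteq> {p..q}" if pq: "p < q" "{p..q} \<subseteq> {0..1}" for p q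
  proof -
    have "p \<in> {0..1}" "q \<in> {0..1}" using pq by auto
    then obtain p' q' where p': "p' \<in> {0..1}" "base_step p' = p" and q': "q' \<in> {0..1}" "base_step q' = q"
      using surj by blast
    have "p' < q'" using monoD[OF B(2), of q' p'] p' q' pq(1) by (meson leD not_le_imp_less)
    moreover have "{p'..q'} \<subseteq> {0..1}" using p' q' by auto
    moreover have "base_step ` {p'..q'} \<subseteq> {p..q}" using monoD[OF B(2)] p'(2) q'(2) by auto
    ultimately show ?thesis by blast
  qed
  have zero_out: "deriv ?c t = 0" if "t \<le> 1/3 \<or> t \<ge> 2/3" for t
    using that
  proof
    assume "t \<le> 1/3"
    then show ?thesis
      by (intro DERIV_zero_if_constant_near[OF smooth_on_DERIV[OF s], of t "t - 1" t "\<psi> 0"]) (auto simp: base_step_values)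
  next
    assume "t \<ge> 2/3"
    then show ?thesis
      by (intro DERIV_zero_if_constant_near[OF smooth_on_DERIV[OF s], of t t "t + 1" "\<psi> 1"]) (auto simp: base_step_values)
  qed
  have inner: "0 < base_step t \<and> base_step t < 1" if "1/3 < t" "t < 2/3" for t
    using base_step_0_1[of t] B(6)[of t] B(7)[of t] that by (simp add: less_le)
  have pos_in: "deriv ?c t > 0" if t: "1/3 < t" "t < 2/3" "?c t \<notin> T" for t
  proof -
    obtain d where d: "d > 0" "(\<psi> has_real_derivative d) (at (base_step t))" using pos inner[OF t(1,2)] t(3) by blast
    have "(?c has_real_derivative d * deriv base_step t) (at t)"
      by (rule DERIV_chain2[OF d(2) smooth_on_DERIV[OF B(1)]]) simp
    then have "deriv ?c t = d * deriv base_step t" by (rule DERIV_imp_deriv)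
    moreover have "deriv base_step t > 0" using B(9)[of t] inner[OF t(1,2)] by simp
    ultimately show ?thesis using d(1) by simp
  qed
  have nonneg: "deriv ?c t \<ge> 0" for t
  proof (cases "1/3 < t \<and> t < 2/3")
    case True
    show ?thesis
    proof (cases "?c t \<in> T")
      case False then show ?thesis using pos_in[of t] True by simp
    next
      case inT: True
      then obtain p q where pq: "p < q" "{p..q} \<subseteq> {0..1}" "base_step t \<in> {p..q}" "\<forall>s\<in>{p..q}. \<psi> s = \<psi> (base_step t)"
        using rest[of "base_step t"] inner[of t] True by blast
      obtain p' q' where pq': "p' < q'" "base_step ` {p'..q'} \<subseteq> {p..q}" using preimage_Icc[OF pq(1,2)] by blast
      have img: "base_step p' \<in> {p..q}" "base_step q' \<in> {p..q}"
      proof -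
        have "p' \<in> {p'..q'}" "q' \<in> {p'..q'}" using pq'(1) by auto
        then show "base_step p' \<in> {p..q}" "base_step q' \<in> {p..q}" using pq'(2) by blast+
      qed
      have "base_step y \<in> {p..q}" if "y \<in> {min p' t..max q' t}" for y
      proof -
        have "p \<le> base_step (min p' t)" "base_step (max q' t) \<le> q" using img pq(3) by (auto simp: min_def max_def)
        then show ?thesis using monoD[OF B(2), of "min p' t" y] monoD[OF B(2), of y "max q' t"] that by auto
      qed
      then have const: "?c y = ?c t" if "y \<in> {min p' t..max q' t}" for y using pq(4) that by blast
      have "deriv ?c t = 0"
      proof (rule DERIV_zero_if_constant_near[OF smooth_on_DERIV[OF s]])
        show "min p' t < max q' t" "t \<in> {min p' t..max q' t}" using pq'(1) by auto
        show "?c y = ?c t" if "y \<in> {min p' t..max q' t}" for y using that by (rule const)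
      qed simp_all
      then show ?thesis by simp
    qed
  next
    case False then show ?thesis using zero_out[of t] by auto
  qed
  have mono: "mono ?c" by (rule mono_if_deriv_nonneg[OF s nonneg])
  have rng: "?c t \<in> {0..1}" for t using im B(8)[of t] by blast
  show \<psi>0: "\<psi> 0 = 0"
  proof -
    obtain u where "u \<in> {0..1}" "\<psi> u = 0" using im by (metis atLeastAtMost_iff imageE order_refl zero_le_one)
    then obtain t where "t \<in> {0..1}" "?c t = 0" using surj by metis
    then have "?c 0 \<le> 0" using monoD[OF mono, of 0 t] by simp
    then show ?thesis using rng[of 0] B(4)[of 0] by simp
  qed
  show \<psi>1: "\<psi> 1 = 1"
  proof -
    obtain u where "u \<in> {0..1}" "\<psi> u = 1" using im by (metis atLeastAtMost_iff imageE order_refl zero_le_one)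
    then obtain t where "t \<in> {0..1}" "?c t = 1" using surj by metis
    then have "?c 1 \<ge> 1" using monoD[OF mono, of t 1] by simp
    then show ?thesis using rng[of 1] B(5)[of 1] by simp
  qed
  show "flat_step ?c ({0, 1} \<union> T)"
    unfolding flat_step_def
  proof (intro conjI allI impI ballI)
    show "\<exists>e>0. e < 1/2 \<and> (\<forall>t\<le>e. ?c t = 0) \<and> (\<forall>t\<ge>1-e. ?c t = 1)"
      by (intro exI[of _ "1/3"]) (auto simp: base_step_values \<psi>0 \<psi>1)
    show "deriv ?c t > 0" if t: "?c t \<notin> {0, 1} \<union> T" for t
    proof (rule pos_in)
      have "base_step t \<noteq> 0" "base_step t \<noteq> 1" using t \<psi>0 \<psi>1 by auto
      then show "1/3 < t" "t < 2/3" by (auto simp: base_step_0_1)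
    qed (use t in blast)
    fix v assume "v \<in> {0, 1} \<union> T"
    then consider "v = 0" | "v = 1" | "v \<in> T" by auto
    then show "rests_at ?c v"
    proof cases
      case 1 then show ?thesis by (intro exI[of _ 0] exI[of _ "1/3"]) (auto simp: base_step_values \<psi>0)
    next
      case 2 then show ?thesis by (intro exI[of _ "2/3"] exI[of _ 1]) (auto simp: base_step_values \<psi>1)
    next
      case 3
      then obtain p q where pq: "p < q" "{p..q} \<subseteq> {0..1}" "\<forall>t\<in>{p..q}. \<psi> t = v" using restT by blast
      obtain p' q' where pq': "p' < q'" "{p'..q'} \<subseteq> {0..1}" "base_step ` {p'..q'} \<subseteq> {p..q}" using preimage_Icc[OF pq(1,2)] by blast
      then have "\<forall>t\<in>{p'..q'}. ?c t = v" using pq(3) by blast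
      then show ?thesis using pq' by blast
    qed
  qed (use s mono T in auto)
qed

lemma flat_step_reparam:
  assumes "op_diffeo {0..1} {0..1} \<phi>"
  shows "flat_step (\<lambda>t. \<phi> (base_step t)) {0, 1}" "\<phi> 0 = 0" "\<phi> 1 = 1"
proof -
  have a: "smooth_map I01 I01 \<phi>" "\<phi> ` {0..1} = {0..1}"
    using assms by (auto simp: op_diffeo_def bij_betw_def)
  have "\<exists>d>0. (\<phi> has_real_derivative d) (at u)" if "0 < u" "u < 1" for u
    using assms that unfolding op_diffeo_def by (metis at_within_Icc_at atLeastAtMost_iff less_imp_le)
  then show "flat_step (\<lambda>t. \<phi> (base_step t)) {0, 1}" "\<phi> 0 = 0" "\<phi> 1 = 1"
    using flat_step_compose[OF a, of "{}"] by auto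
qed

lemma flat_step_stop:
  assumes \<psi>: "smooth_map I01 I01 \<psi>" and ab: "a < b" "{a..b} \<subset> {0..1}" and t0: "\<psi> ` {a..b} = {t0}"
    and od: "op_diffeo ({0..1} - {a..b}) ({0..1} - {t0}) \<psi>"
  shows "flat_step (\<lambda>t. \<psi> (base_step t)) ({0, 1} \<union> {t0})" "\<psi> 0 = 0" "\<psi> 1 = 1"
proof -
  have imS: "\<psi> ` ({0..1} - {a..b}) = {0..1} - {t0}" using od by (simp add: op_diffeo_def bij_betw_def)
  have "\<psi> a \<in> {0..1}" using \<psi> ab by (auto simp: smooth_map_def)
  then have t01: "t0 \<in> {0..1}" using t0 ab(1) by (metis atLeastAtMost_iff imageI less_imp_le order_refl singletonD)
  have "{0..1} = ({0..1} - {a..b}) \<union> {a..b}" using ab(2) by auto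
  then have im: "\<psi> ` {0..1} = {0..1}" using imS t0 t01 by (metis image_Un insert_Diff insert_is_Un sup_commute)
  have const: "\<psi> t = t0" if "t \<in> {a..b}" for t using t0 that by blast
  have fib: "u \<in> {a..b}" if "u \<in> {0..1}" "\<psi> u = t0" for u
    using that imS by blast
  have pos: "\<exists>d>0. (\<psi> has_real_derivative d) (at u)" if u: "0 < u" "u < 1" "\<psi> u \<notin> {t0}" for u
  proof -
    have "u \<in> {0..1} - {a..b}" using u const by auto
    moreover have "\<forall>u\<in>{0..1} - {a..b}. \<exists>d>0. (\<psi> has_real_derivative d) (at u within {0..1} - {a..b})"
      using od by (simp add: op_diffeo_def)
    ultimately obtain d where d: "d > 0" "(\<psi> has_real_derivative d) (at u within {0..1} - {a..b})" by blast
    have "open ({0<..<1} - {a..b})" by (simp add: open_Diff)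
    moreover have "u \<in> {0<..<1} - {a..b}" using u \<open>u \<in> _\<close> by auto
    ultimately have "u \<in> interior ({0..1} - {a..b})" by (rule interiorI) auto
    then have "at u within {0..1} - {a..b} = at u" by (rule at_within_interior)
    then show ?thesis using d by auto
  qed
  have sub: "{a..b} \<subseteq> {0..1}" using ab(2) by blast
  have restT: "rests_at \<psi> v" if "v \<in> {t0}" for v
  proof -
    have "v = t0" using that by blast
    then have "a < b \<and> {a..b} \<subseteq> {0..1} \<and> (\<forall>t\<in>{a..b}. \<psi> t = v)" using ab(1) sub const by blast
    then show ?thesis by blast
  qed
  have restu: "\<exists>p q. p < q \<and> {p..q} \<subseteq> {0..1} \<and> u \<in> {p..q} \<and> (\<forall>t\<in>{p..q}. \<psi> t = \<psi> u)"
    if "0 < u" "u < 1" "\<psi> u \<in> {t0}" for u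
  proof -
    have "u \<in> {a..b}" "\<psi> u = t0" using fib[of u] that by auto
    then have "a < b \<and> {a..b} \<subseteq> {0..1} \<and> u \<in> {a..b} \<and> (\<forall>t\<in>{a..b}. \<psi> t = \<psi> u)" using ab(1) sub const by metis
    then show ?thesis by blast
  qed
  have f: "finite {t0}" by simp
  show "flat_step (\<lambda>t. \<psi> (base_step t)) ({0, 1} \<union> {t0})" by (rule flat_step_compose(1)[OF \<psi> im f pos restu restT])
  show "\<psi> 0 = 0" by (rule flat_step_compose(2)[OF \<psi> im f pos restu restT])
  show "\<psi> 1 = 1" by (rule flat_step_compose(3)[OF \<psi> im f pos restu restT])
qed

section \<open>Concatenation of flat curves\<close>

text \<open>Flat curves have sitting instants, so that their concatenation is smooth.\<close>

definition flat :: "(real \<Rightarrow> 'a) \<Rightarrow> bool" where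
  "flat f \<longleftrightarrow> (\<exists>e>0. e < 1/2 \<and> (\<forall>t\<le>e. f t = f 0) \<and> (\<forall>t\<ge>1-e. f t = f 1))"

lemma flat_compose_flat_step: "flat_step c V \<Longrightarrow> flat (\<lambda>t. f (c t))"
proof -
  assume c: "flat_step c V"
  obtain e where e: "e > 0" "e < 1/2" "\<forall>t\<le>e. c t = 0" "\<forall>t\<ge>1-e. c t = 1" using flat_step_flat[OF c] by blast
  have "c 0 = 0" using flat_stepD(4)[OF c, of 0] by simp
  moreover have "c 1 = 1" using flat_stepD(5)[OF c, of 1] by simp
  ultimately have "\<forall>t\<le>e. f (c t) = f (c 0)" "\<forall>t\<ge>1-e. f (c t) = f (c 1)" using e(3,4) by metis+
  then show ?thesis unfolding flat_def using e(1,2) by blast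
qed

lemma flat_rev: "flat f \<Longrightarrow> flat (\<lambda>t. f (1 - t))"
proof -
  assume "flat f"
  then obtain e where e: "e > 0" "e < 1/2" "\<forall>t\<le>e. f t = f 0" "\<forall>t\<ge>1-e. f t = f 1" unfolding flat_def by blast
  have "f (1 - t) = f (1 - 0)" if "t \<le> e" for t using e(4)[rule_format, of "1 - t"] that by simp
  moreover have "f (1 - t) = f (1 - 1)" if "t \<ge> 1 - e" for t using e(3)[rule_format, of "1 - t"] that by simp
  ultimately show ?thesis unfolding flat_def using e(1,2) by blast
qed

lemma flat_const: "flat (\<lambda>t. x)"
  unfolding flat_def by (intro exI[of _ "1/4"]) auto

lemma join_ends: "join f g 0 = f 0" "join f g 1 = g 1"
  by (simp_all add: join_def)

lemma flat_join: 
  assumes "flat f" "flat g"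
  shows "flat (join f g)"
proof -
  obtain e where e: "e > 0" "e < 1/2" "\<forall>t\<le>e. f t = f 0" using assms(1) by (auto simp: flat_def)
  obtain e' where e': "e' > 0" "e' < 1/2" "\<forall>t\<ge>1-e'. g t = g 1" using assms(2) by (auto simp: flat_def)
  define h where "h = min e e' / 2"
  have h: "h > 0" "h < 1/2" "2 * h \<le> e" "2 * h \<le> e'" using e(1,2) e'(1,2) by (auto simp: h_def)
  have "join f g t = join f g 0" if "t \<le> h" for t
    using e(3)[rule_format, of "2 * t"] h that by (simp add: join_def)
  moreover have "join f g t = join f g 1" if "t \<ge> 1 - h" for t
    using e'(3)[rule_format, of "2 * t - 1"] h that by (simp add: join_def)
  ultimately show ?thesis unfolding flat_def using h(1,2) by blast
qed

lemma path_concat_unit: "unit_path f \<star> unit_path g = unit_path (join f g)"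
  by (auto simp: path_concat_def join_def restrict_def fun_eq_iff)

lemma path_rev_unit: "path_rev (unit_path f) = unit_path (\<lambda>t. f (1 - t))"
  by (auto simp: path_rev_def restrict_def fun_eq_iff)

lemma unit_path_cong: "(\<And>t. t \<in> {0..1} \<Longrightarrow> f t = g t) \<Longrightarrow> unit_path f = unit_path g"
  by (rule restrict_ext)

lemma path_concat_wjoin:
  assumes "flat_step c V" "flat_step c' V'" "\<gamma> 1 = \<delta> 0"
  shows "(\<gamma> \<star> \<delta>) (wjoin (1/2) c c' t) = join (\<lambda>t. \<gamma> (c t)) (\<lambda>t. \<delta> (c' t)) t"
proof -
  have "wjoin (1/2) c c' t \<in> {0..1}" using wjoin_range[OF assms(1,2)] by simp
  then show ?thesis using join_wjoin[where f = \<gamma> and g = \<delta>, OF assms] unfolding path_concat_def by simp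
qed

context diffeological_space
begin

lemma curve_affine: "curve X f \<Longrightarrow> curve X (\<lambda>t. f (p * t + q))"
  by (rule curve_compose[OF _ smooth_on_affine])

lemma curve_rev: "curve X f \<Longrightarrow> curve X (\<lambda>t. f (1 - t))"
  using curve_affine[of f "-1" 1] by simp

lemma curve_join:
  assumes f: "curve X f" "e > 0" "\<And>t. t \<ge> 1 - e \<Longrightarrow> f t = f 1"
    and g: "curve X g" "e' > 0" "\<And>t. t \<le> e' \<Longrightarrow> g t = g 0" and fg: "f 1 = g 0"
  shows "curve X (join f g)"
proof (rule curve_glue)
  show "curve X (\<lambda>t. f (2 * t))" using curve_affine[OF f(1), of 2 0] by simp
  show "curve X (\<lambda>t. g (2 * t - 1))" using curve_affine[OF g(1), of 2 "-1"] by simp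
  show "(1 - e) / 2 < (1 + e') / 2" using f(2) g(2) by (simp add: field_simps)
  show "join f g t = f (2 * t)" if "t < (1 + e') / 2" for t
  proof (cases "t \<le> 1/2")
    case False
    then have "g (2 * t - 1) = g 0" "f (2 * t) = f 1" using that f(2) by (auto intro!: g(3) f(3) simp: field_simps)
    then show ?thesis using False fg by (simp add: join_def)
  qed (simp add: join_def)
  show "join f g t = g (2 * t - 1)" if "t > (1 - e) / 2" for t
  proof (cases "t \<le> 1/2")
    case True
    then have "g (2 * t - 1) = g 0" "f (2 * t) = f 1" using that g(2) by (auto intro!: g(3) f(3) simp: field_simps)
    then show ?thesis using True fg by (simp add: join_def)
  qed (simp add: join_def)
qed

lemma curve_join_flat:
  assumes f: "curve X f" "flat f" and g: "curve X g" "flat g" and fg: "f 1 = g 0"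
  shows "curve X (join f g)"
proof -
  obtain e where e: "e > 0" "\<forall>t\<ge>1-e. f t = f 1" using f(2) by (auto simp: flat_def)
  obtain e' where e': "e' > 0" "\<forall>t\<le>e'. g t = g 0" using g(2) by (auto simp: flat_def)
  show ?thesis
  proof (rule curve_join[OF f(1) e(1) _ g(1) e'(1) _ fg])
    show "f t = f 1" if "t \<ge> 1 - e" for t using e(2) that by blast
    show "g t = g 0" if "t \<le> e'" for t using e'(2) that by blast
  qed
qed

lemma smooth_paths_curve: 
  "\<gamma> \<in> smooth_paths X \<Longrightarrow> smooth_on UNIV r \<Longrightarrow> (\<And>t. r t \<in> {0..1}) \<Longrightarrow> curve X (\<lambda>t. \<gamma> (r t))"
  unfolding smooth_paths_iff by (intro path_compose) auto

lemma flat_step_curve: "\<gamma> \<in> smooth_paths X \<Longrightarrow> flat_step c V \<Longrightarrow> curve X (\<lambda>t. \<gamma> (c t))"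
  using smooth_paths_curve[of \<gamma> c] flat_stepD(1,8)[of c V] by blast

lemma fold_curve: "\<gamma> \<in> smooth_paths X \<Longrightarrow> smooth_on UNIV k \<Longrightarrow> curve X (\<lambda>t. \<gamma> (sin_fold (k t)))"
  by (rule smooth_paths_curve) (auto intro: smooth_on_compose_UNIV[OF smooth_sin_fold] simp: sin_fold_range)

end

text \<open>What the equivalence of paths and homotopy relative to the endpoints have in common. Associativity and the unit
laws up to \<open>E\<close> follow from it alone, because both sides of each law become equal after composition
with suitable flat steps.\<close>

definition step_invariant :: "'a diffeology \<Rightarrow> 'a \<Rightarrow> ((real \<Rightarrow> 'a) \<Rightarrow> (real \<Rightarrow> 'a) \<Rightarrow> bool) \<Rightarrow> bool" where
  "step_invariant X x0 E \<longleftrightarrow> symp E \<and> transp E \<and>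
     (\<forall>k c V. curve X k \<longrightarrow> k 0 = x0 \<longrightarrow> flat_step c V \<longrightarrow> E k (\<lambda>t. k (c t)))"

lemma step_invariantD:
  assumes "step_invariant X x0 E"
  shows "E f g \<Longrightarrow> E g f" "E f g \<Longrightarrow> E g h \<Longrightarrow> E f h"
    "curve X k \<Longrightarrow> k 0 = x0 \<Longrightarrow> flat_step c V \<Longrightarrow> E k (\<lambda>t. k (c t))"
  using assms unfolding step_invariant_def by (blast dest: sympD transpD)+

context diffeological_space
begin

lemma curve_flat_join_simps:
  assumes "curve X f" "flat f" "curve X g" "flat g" "f 1 = g 0"
  shows "curve X (join f g)" "flat (join f g)" "join f g 0 = f 0" "join f g 1 = g 1"
  using assms curve_join_flat flat_join by (auto simp: join_ends)

context
  fixes x0 and E :: "(real \<Rightarrow> 'a) \<Rightarrow> (real \<Rightarrow> 'a) \<Rightarrow> bool"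
  assumes E: "step_invariant X x0 E"
begin

lemma invariant_join_flat_step:
  assumes f: "curve X f" "flat f" "f 0 = x0" and g: "curve X g" "flat g" and fg: "f 1 = g 0"
    and c: "flat_step c V" "flat_step c' V'"
  shows "E (join f g) (join (\<lambda>t. f (c t)) (\<lambda>t. g (c' t)))"
proof -
  obtain W where "flat_step (wjoin (1/2) c c') W" using flat_step_wjoin[OF _ _ c, of "1/2"] by auto
  from step_invariantD(3)[OF E curve_join_flat[OF f(1,2) g fg] _ this] show ?thesis
    using join_wjoin[where f = f and g = g, OF c fg] f(3) by (simp add: join_ends)
qed

lemma invariant_assoc:
  assumes f: "curve X f" "flat f" "f 0 = x0" and g: "curve X g" "flat g"
    and h: "curve X h" "flat h" and fg: "f 1 = g 0" and gh: "g 1 = h 0"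
  shows "E (join (join f g) h) (join f (join g h))"
proof -
  note b = flat_base_step
  note jfg = curve_flat_join_simps[OF f(1,2) g fg] and jgh = curve_flat_join_simps[OF g h gh]
  have e: "join f g 1 = h 0" "f 1 = join g h 0" using jfg(4) jgh(3) fg gh by simp_all
  let ?c = "wjoin (1/2) base_step base_step" and ?w = "wjoin (3/4) (wjoin (2/3) base_step base_step) base_step"
  obtain V where V: "flat_step ?c V" using flat_step_wjoin[OF _ _ b b, of "1/2"] by auto
  obtain V' where V': "flat_step (wjoin (2/3) base_step base_step) V'" using flat_step_wjoin[OF _ _ b b, of "2/3"] by auto
  obtain W where W: "flat_step ?w W" using flat_step_wjoin[OF _ _ V' b, of "3/4"] by auto
  let ?J = "join (join (\<lambda>t. f (base_step t)) (\<lambda>t. g (base_step t))) (\<lambda>t. h (base_step t))"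
  have "E (join (join f g) h) (join (\<lambda>t. join f g (?c t)) (\<lambda>t. h (base_step t)))"
    by (rule invariant_join_flat_step[OF jfg(1,2) _ h e(1) V b]) (simp add: jfg(3) f(3))
  then have 1: "E (join (join f g) h) ?J" using join_wjoin[where f = f and g = g, OF b b fg] by simp
  have "E (join f (join g h)) (\<lambda>t. join f (join g h) (?w t))"
    by (rule step_invariantD(3)[OF E curve_join_flat[OF f(1,2) jgh(1,2) e(2)] _ W]) (simp add: join_ends f(3))
  then have "E (join f (join g h)) ?J"
    using join_assoc_wjoin[where f = f and g = g and h = h, OF b b b fg gh] by simp
  with 1 show ?thesis using step_invariantD(1,2)[OF E] by blast
qed

lemma invariant_const_left:
  assumes f: "curve X f" "flat f" "f 0 = x0"
  shows "E (join (\<lambda>t. f 0) f) f"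
proof -
  note b = flat_base_step
  note x0 = curve_carrier[OF f(1), of 0]
  obtain W where W: "flat_step (wjoin 0 base_step base_step) W" using flat_step_wjoin[OF _ _ b b, of 0] by auto
  have "E (join (\<lambda>t. f 0) f) (join (\<lambda>t. f 0) (\<lambda>t. f (base_step t)))"
    using invariant_join_flat_step[OF curve_const[OF x0] flat_const f(3) f(1,2) refl b b] .
  also have "join (\<lambda>t. f 0) (\<lambda>t. f (base_step t)) = (\<lambda>t. f (wjoin 0 base_step base_step t))"
    using join_const_left[OF b, where f = f and c = base_step] by (simp add: fun_eq_iff)
  finally show ?thesis using step_invariantD[OF E] step_invariantD(3)[OF E f(1,3) W] by blast
qed

lemma invariant_const_right:
  assumes f: "curve X f" "flat f" "f 0 = x0"
  shows "E (join f (\<lambda>t. f 1)) f"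
proof -
  note b = flat_base_step
  note x1 = curve_carrier[OF f(1), of 1]
  obtain W where W: "flat_step (wjoin 1 base_step base_step) W" using flat_step_wjoin[OF _ _ b b, of 1] by auto
  have "E (join f (\<lambda>t. f 1)) (join (\<lambda>t. f (base_step t)) (\<lambda>t. f 1))"
    using invariant_join_flat_step[OF f curve_const[OF x1] flat_const refl b b] .
  also have "join (\<lambda>t. f (base_step t)) (\<lambda>t. f 1) = (\<lambda>t. f (wjoin 1 base_step base_step t))"
    using join_const_right[OF b, where f = f and c' = base_step] by (simp add: fun_eq_iff)
  finally show ?thesis using step_invariantD[OF E] step_invariantD(3)[OF E f(1,3) W] by blast
qed

end

end

section \<open>Concatenation is well defined on the geometric path space\<close>

lemma smooth_cutoff: "smooth_on UNIV (\<lambda>x. x * (1 - step (p * x + q)))"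
  by (rule smooth_on_mult[OF open_UNIV smooth_on_id smooth_on_diff[OF open_UNIV smooth_on_const smooth_on_compose_affine[OF smooth_step]]])

lemma flat_step_lift:
  assumes c: "flat_step c V"
  defines "\<rho> \<equiv> fold_lift c"
  shows "smooth_on UNIV \<rho>" "\<And>t. sin_fold (\<rho> t) = c t" "\<And>t. 0 \<le> \<rho> t" "\<And>t. \<rho> t \<le> 1"
    "\<And>t. t \<le> 0 \<Longrightarrow> \<rho> t = 0" "\<And>t. t \<ge> 1 \<Longrightarrow> \<rho> t = 1" "\<And>t. deriv \<rho> t \<ge> 0"
    "\<exists>U. finite U \<and> (\<forall>t. \<rho> t \<notin> U \<longrightarrow> deriv \<rho> t > 0) \<and>
      (\<forall>v\<in>U. rests_at \<rho> v)"
    "\<And>t. t \<ge> 1 \<Longrightarrow> deriv \<rho> t = 0" "\<And>t. t \<le> 0 \<Longrightarrow> deriv \<rho> t = 0"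
proof -
  note C = flat_stepD[OF c]
  obtain a b where "smooth_ramp c a b" using flat_step_ramp[OF c] by blast
  then interpret smooth_ramp c a b .
  show s: "smooth_on UNIV \<rho>" unfolding \<rho>_def by (rule smooth_fold_lift)
  show "sin_fold (\<rho> t) = c t" "0 \<le> \<rho> t" "\<rho> t \<le> 1" for t unfolding \<rho>_def using sin_fold_lift fold_lift_range by blast+
  show l: "\<rho> t = 0" if "t \<le> 0" for t unfolding \<rho>_def using fold_lift_0 C(4)[OF that] by blast
  show r: "\<rho> t = 1" if "t \<ge> 1" for t unfolding \<rho>_def using fold_lift_1 C(5)[OF that] by blast
  show "deriv \<rho> t \<ge> 0" for t unfolding \<rho>_def by (rule deriv_fold_lift_nonneg)
  define U where "U = (\<lambda>v. 2 / pi * arcsin (sqrt v)) ` V"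
  have "finite U" using C(3) by (simp add: U_def)
  moreover have "deriv \<rho> t > 0" if "\<rho> t \<notin> U" for t
  proof -
    have "c t \<notin> V" using that by (auto simp: U_def \<rho>_def fold_lift_def)
    then show ?thesis unfolding \<rho>_def by (intro deriv_fold_lift_pos C(9))
  qed
  moreover have "rests_at \<rho> v" if vU: "v \<in> U" for v
  proof -
    obtain u where u: "u \<in> V" "v = 2 / pi * arcsin (sqrt u)" using vU unfolding U_def by blast
    obtain p q where "p < q" "{p..q} \<subseteq> {0..1}" "\<forall>t\<in>{p..q}. c t = u" using C(10)[OF u(1)] by blast
    then show ?thesis unfolding \<rho>_def u(2) using fold_lift_cong by blast
  qed
  ultimately show "\<exists>U. finite U \<and> (\<forall>t. \<rho> t \<notin> U \<longrightarrow> deriv \<rho> t > 0) \<and>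
      (\<forall>v\<in>U. rests_at \<rho> v)" by blast
  show "deriv \<rho> t = 0" if "t \<ge> 1" for t
  proof (rule DERIV_zero_if_constant_near[OF smooth_on_DERIV[OF s]])
    show "t < t + 1" "t \<in> {t..t + 1}" by auto
    show "\<rho> y = 1" if "y \<in> {t..t + 1}" for y using that \<open>t \<ge> 1\<close> by (intro r) simp
  qed simp_all
  show "deriv \<rho> t = 0" if "t \<le> 0" for t
  proof (rule DERIV_zero_if_constant_near[OF smooth_on_DERIV[OF s]])
    show "t - 1 < t" "t \<in> {t - 1..t}" by auto
    show "\<rho> y = 0" if "y \<in> {t - 1..t}" for y using that \<open>t \<le> 0\<close> by (intro l) simp
  qed simp_all
qed

context diffeological_space
begin

abbreviation geo_eq :: "'a \<Rightarrow> (real \<Rightarrow> 'a) \<Rightarrow> (real \<Rightarrow> 'a) \<Rightarrow> bool" where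
  "geo_eq x0 f g \<equiv> geo_equiv X x0 (unit_path f) (unit_path g)"

lemma curve_path_space: "curve X f \<Longrightarrow> f 0 = x0 \<Longrightarrow> unit_path f \<in> paths_from X x0"
  by (simp add: path_space_iff curve_in_smooth_paths)

lemma geo_flat_step_path:
  assumes "K \<in> paths_from X x0" "flat_step c V"
  shows "geo_equiv X x0 K (unit_path (\<lambda>t. K (c t)))"
  using geo_rest[OF assms(1) flat_step_rest_map[OF assms(2)]] by (simp add: comp_def)

lemma geo_rest_curve:
  assumes f: "curve X f" "f 0 = x0" and w: "rest_map w V"
  shows "geo_eq x0 f (\<lambda>t. f (w t))"
proof -
  have "w t \<in> {0..1}" if "t \<in> {0..1}" for t using rest_mapD(9)[OF w] that by blast
  then have "unit_path (unit_path f \<circ> w) = unit_path (\<lambda>t. f (w t))" by (intro unit_path_cong) simp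
  then show ?thesis using geo_rest[OF curve_path_space[OF f] w] by simp
qed

lemma geo_flat_step:
  "curve X f \<Longrightarrow> f 0 = x0 \<Longrightarrow> flat_step c V \<Longrightarrow> geo_eq x0 f (\<lambda>t. f (c t))"
  using geo_rest_curve flat_step_rest_map by blast

lemma geo_step_invariant: "step_invariant X x0 (geo_eq x0)"
  unfolding step_invariant_def
proof (intro conjI allI impI)
  show "symp (geo_eq x0)" by (rule sympI) (rule equivclp_sym)
  show "transp (geo_eq x0)" by (rule transpI) (rule equivclp_trans)
qed (rule geo_flat_step)

lemmas geo_join_flat_step = invariant_join_flat_step[OF geo_step_invariant]
  and geo_assoc = invariant_assoc[OF geo_step_invariant]
  and geo_const_left = invariant_const_left[OF geo_step_invariant]
  and geo_const_right = invariant_const_right[OF geo_step_invariant]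

lemma geo_backtrack:
  assumes f: "curve X f" "flat f" "f 0 = x0" and b: "curve X b" "flat b"
    and h: "curve X h" "flat h" and fb: "f 1 = b 0" and bh: "b 0 = h 0"
  shows "geo_eq x0 (join (join (join f b) (\<lambda>t. b (1 - t))) h) (join f h)"
proof -
  have r: "curve X (\<lambda>t. b (1 - t))" "flat (\<lambda>t. b (1 - t))" using curve_rev[OF b(1)] flat_rev[OF b(2)] .
  have c1: "curve X (join f b)" "flat (join f b)"
    using curve_join_flat[OF f(1,2) b fb] flat_join[OF f(2) b(2)] .
  have c2: "curve X (join (join f b) (\<lambda>t. b (1 - t)))" "flat (join (join f b) (\<lambda>t. b (1 - t)))"
    using curve_join_flat[OF c1 r] flat_join[OF c1(2) r(2)] by (simp_all add: join_ends)
  have c3: "curve X (join (join (join f b) (\<lambda>t. b (1 - t))) h)"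
    using curve_join_flat[OF c2 h] bh by (simp add: join_ends)
  have c4: "curve X (join f h)" using curve_join_flat[OF f(1,2) h] fb bh by simp
  have "geo_step X x0 (unit_path f \<star> unit_path b \<star> path_rev (unit_path b) \<star> unit_path h) (unit_path f \<star> unit_path h)"
  proof (rule geo_step.backtrack)
    show "unit_path f \<star> unit_path b \<star> path_rev (unit_path b) \<star> unit_path h \<in> paths_from X x0"
      unfolding path_rev_unit path_concat_unit using c3 f(3) by (intro curve_path_space) (simp_all add: join_ends)
    show "unit_path f \<star> unit_path h \<in> paths_from X x0"
      unfolding path_concat_unit using c4 f(3) by (intro curve_path_space) (simp_all add: join_ends)
  qed (use f b h fb bh curve_in_smooth_paths in auto)
  then show ?thesis unfolding path_rev_unit path_concat_unit by (rule r_into_equivclp[of "geo_step X x0"])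
qed

lemma geo_backtrack_empty:
  assumes b: "curve X b" "flat b" "b 0 = x0"
    and h: "curve X h" "flat h" and bh: "b 0 = h 0"
  shows "geo_eq x0 (join (join b (\<lambda>t. b (1 - t))) h) h"
proof -
  have r: "curve X (\<lambda>t. b (1 - t))" "flat (\<lambda>t. b (1 - t))" using curve_rev[OF b(1)] flat_rev[OF b(2)] .
  have c1: "curve X (join b (\<lambda>t. b (1 - t)))" "flat (join b (\<lambda>t. b (1 - t)))"
    using curve_join_flat[OF b(1,2) r] flat_join[OF b(2) r(2)] by simp_all
  have c3: "curve X (join (join b (\<lambda>t. b (1 - t))) h)"
    using curve_join_flat[OF c1 h] bh by (simp add: join_ends)
  have "geo_step X x0 (unit_path b \<star> path_rev (unit_path b) \<star> unit_path h) (unit_path h)"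
  proof (rule geo_step.backtrack_empty)
    show "unit_path b \<star> path_rev (unit_path b) \<star> unit_path h \<in> paths_from X x0"
      unfolding path_rev_unit path_concat_unit using c3 b(3) by (intro curve_path_space) (simp_all add: join_ends)
    show "unit_path h \<in> paths_from X x0" using h b bh by (intro curve_path_space) simp_all
  qed (use b h bh curve_in_smooth_paths in auto)
  then show ?thesis unfolding path_rev_unit path_concat_unit by (rule r_into_equivclp[of "geo_step X x0"])
qed

text \<open>In \<open>join (\<lambda>t. \<gamma> (c t)) d\<close> the curve rests where the two pieces meet, and a path without this rest need not
exist, because \<open>\<gamma>\<close> and \<open>d\<close> need not fit together smoothly. A backtrack removes the obstruction: the
curve \<open>K\<close> follows \<open>\<gamma>\<close>, turns back along \<open>\<gamma>\<close> by means of \<open>sin_fold\<close> without resting at \<open>\<gamma> 1\<close>, then retraces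
this excursion and continues with \<open>d\<close>. It does not depend on \<open>c\<close>. The curve
\<open>\<gamma> \<circ> c\<close>, followed by the excursion and its reverse and by \<open>d\<close>, is \<open>K \<circ> w\<close> for a rest map \<open>w\<close>
built from the lift of \<open>c\<close>.\<close>

lemma fold_right:
  assumes \<gamma>: "\<gamma> \<in> paths_from X x0" and d: "curve X d" "flat d" "d 0 = \<gamma> 1"
  shows "\<exists>K. \<forall>c V. flat_step c V \<longrightarrow> geo_equiv X x0 K (unit_path (join (\<lambda>t. \<gamma> (c t)) d))"
proof -
  have \<gamma>p: "\<gamma> \<in> smooth_paths X" "\<gamma> 0 = x0" using \<gamma> by (simp_all add: path_space_iff)
  define \<kappa> where "\<kappa> x = x * (1 - step (2 * x + (- 5/2)))" for x :: real
  have \<kappa>: "\<kappa> x = x" if "x \<le> 5/4" for x using that by (simp add: \<kappa>_def step_left)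
  have \<kappa>0: "\<kappa> x = 0" if "x \<ge> 7/4" for x using that by (simp add: \<kappa>_def step_right)
  \<comment> \<open>the excursion: \<open>D\<close> follows \<open>\<gamma>\<close> up to time \<open>1\<close>, turns back, and is constant from \<open>7/4\<close> on\<close>
  define D where "D x = \<gamma> (sin_fold (\<kappa> x))" for x
  have D: "curve X D" unfolding D_def[abs_def] \<kappa>_def[abs_def] by (rule fold_curve[OF \<gamma>p(1) smooth_cutoff])
  have D1: "D 1 = \<gamma> 1" "D 0 = x0" using \<kappa>[of 1] \<kappa>[of 0] \<gamma>p(2) by (simp_all add: D_def)
  have D2: "D x = D 2" if "x \<ge> 7/4" for x using \<kappa>0[OF that] \<kappa>0[of 2] by (simp add: D_def)
  \<comment> \<open>the part of \<open>D\<close> after time \<open>1\<close>, with sitting instants\<close>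
  define b where "b v = D (1 + delayed v)" for v
  have b: "curve X b" unfolding b_def[abs_def]
    by (rule curve_compose[OF D]) (rule smooth_on_add[OF open_UNIV smooth_on_const smooth_delayed])
  have b0: "b v = \<gamma> 1" if "v \<le> 1/8" for v using that D1 by (simp add: b_def delayed_left)
  have b1: "b v = b 1" if "v \<ge> 3/4" for v using that D2[of "1 + v"] by (simp add: b_def delayed_right)
  have bflat: "flat b" unfolding flat_def
  proof (intro exI[of _ "1/8"] conjI allI impI)
    show "b t = b 0" if "t \<le> 1/8" for t using b0[OF that] b0[of 0] by simp
    show "b t = b 1" if "t \<ge> 1 - 1/8" for t using b1[of t] b1[of 1] that by simp
  qed simp_all
  have rb: "curve X (\<lambda>v. b (1 - v))" "flat (\<lambda>v. b (1 - v))" using curve_rev[OF b] flat_rev[OF bflat] .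
  define A where "A u = D (2 * u)" for u
  have A: "curve X A" unfolding A_def[abs_def] using curve_affine[OF D, of 2 0] by simp
  define K where "K = join (join A (\<lambda>v. b (1 - v))) d"
  have b11: "b 1 = D 2" by (simp add: b_def delayed_right)
  have AB: "curve X (join A (\<lambda>v. b (1 - v)))"
  proof (rule curve_join[OF A, of "1/8" _ "1/8"])
    show "A t = A 1" if "t \<ge> 1 - 1/8" for t using D2[of "2 * t"] that by (simp add: A_def)
    show "b (1 - t) = b (1 - 0)" if "t \<le> 1/8" for t using b1[of "1 - t"] that by simp
  qed (use rb b11 in \<open>auto simp: A_def\<close>)
  obtain e where e: "e > 0" "\<forall>t\<le>e. d t = d 0" using d(2) by (auto simp: flat_def)
  have K: "curve X K" unfolding K_def
  proof (rule curve_join[OF AB, of "1/16" _ e])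
    show "join A (\<lambda>v. b (1 - v)) t = join A (\<lambda>v. b (1 - v)) 1" if "t \<ge> 1 - 1/16" for t
      using b0[of "1 - (2 * t - 1)"] b0[of 0] that by (simp add: join_def)
    show "d t = d 0" if "t \<le> e" for t using e(2) that by blast
    show "join A (\<lambda>v. b (1 - v)) 1 = d 0" using b0[of 0] d(3) by (simp add: join_ends)
  qed (use d(1) e(1) in simp_all)
  have K0: "K 0 = x0" using D1 by (simp add: K_def join_def A_def)
  have "geo_eq x0 K (join (\<lambda>t. \<gamma> (c t)) d)" if c: "flat_step c V" for c V
  proof -
    define \<rho> where "\<rho> = fold_lift c"
    note L = flat_step_lift[OF c, folded \<rho>_def]
    obtain U where U: "finite U" "\<forall>t. \<rho> t \<notin> U \<longrightarrow> deriv \<rho> t > 0"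
      "\<forall>v\<in>U. rests_at \<rho> v" using L(8) by blast
    \<comment> \<open>reaches \<open>1/8\<close> by the lift of \<open>c\<close>, rests there, and is the identity from \<open>1/4\<close> on\<close>
    define w where "w t = (\<rho> (8 * t + 0) + delayed (8 * t + (- 1))) / 8" for t
    have ws: "smooth_on UNIV w" unfolding w_def[abs_def]
      by (rule smooth_on_divide_const[OF open_UNIV smooth_on_add[OF open_UNIV smooth_on_compose_affine[OF L(1)] smooth_on_compose_affine[OF smooth_delayed]]])
    have w1: "w t = \<rho> (8 * t) / 8" if "t \<le> 1/8" for t using that by (simp add: w_def delayed_left)
    have w2: "w t = (1 + delayed (8 * t - 1)) / 8" if "t \<ge> 1/8" for t using that L(6)[of "8 * t"] by (simp add: w_def)
    have w3: "w t = t" if "t \<ge> 1/4" for t using w2[of t] that by (simp add: delayed_right)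
    have wd: "deriv w t = deriv \<rho> (8 * t) + deriv delayed (8 * t - 1)" for t
    proof (rule DERIV_imp_deriv)
      have "(w has_real_derivative (deriv \<rho> (8 * t + 0) * 8 + deriv delayed (8 * t + (- 1)) * 8) / 8) (at t)"
        unfolding w_def[abs_def]
        by (rule DERIV_cdivide[OF DERIV_add[OF deriv_compose_affine[OF L(1)] deriv_compose_affine[OF smooth_delayed]]])
      then show "(w has_real_derivative deriv \<rho> (8 * t) + deriv delayed (8 * t - 1)) (at t)"
        by (simp add: add_divide_distrib)
    qed
    define W where "W = insert (1/8) ((\<lambda>u. u / 8) ` U)"
    have wr: "rest_map w W"
    proof (rule rest_mapI[OF ws])
      show "w 0 = 0" using w1[of 0] L(5)[of 0] by simp
      show "w 1 = 1" using w3 by simp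
      show "finite W" using U(1) by (simp add: W_def)
      show "deriv w t \<ge> 0" for t unfolding wd using L(7) deriv_delayed_nonneg by (intro add_nonneg_nonneg)
      show "deriv w t > 0" if "w t \<notin> W" for t
      proof (cases "t \<le> 1/8")
        case True
        then have "\<rho> (8 * t) \<notin> U" using that w1[of t] by (auto simp: W_def)
        then have "deriv \<rho> (8 * t) > 0" using U(2) by blast
        then show ?thesis unfolding wd using deriv_delayed_nonneg[of "8 * t - 1"] by linarith
      next
        case False
        have "8 * t - 1 > 1/8"
        proof (rule ccontr)
          assume "\<not> 8 * t - 1 > 1/8"
          then have "w t = 1/8" using w2[of t] False by (simp add: delayed_left)
          then show False using that by (simp add: W_def)
        qed
        then show ?thesis unfolding wd using deriv_delayed_pos[of "8 * t - 1"] L(7)[of "8 * t"] by linarith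
      qed
      fix v assume "v \<in> W"
      then consider "v = 1/8" | u where "u \<in> U" "v = u / 8" by (auto simp: W_def)
      then show "rests_at w v"
      proof cases
        case 1
        have "w t = v" if "t \<in> {1/8..9/64}" for t using that w2[of t] 1 by (simp add: delayed_left)
        then show ?thesis by (intro exI[of _ "1/8"] exI[of _ "9/64"]) simp
      next
        case 2
        then obtain p q where pq: "p < q" "{p..q} \<subseteq> {0..1}" "\<forall>t\<in>{p..q}. \<rho> t = u" using U(3) by blast
        then have "w t = v" if "t \<in> {p/8..q/8}" for t using that w1[of t] 2 by auto
        then show ?thesis using pq by (intro exI[of _ "p/8"] exI[of _ "q/8"]) auto
      qed
    qed
    have KW: "K (w t) = join (join (join (\<lambda>t. \<gamma> (c t)) b) (\<lambda>t. b (1 - t))) d t" for t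
    proof -
      consider "t \<le> 1/8" | "1/8 < t" "t \<le> 1/4" | "1/4 < t" by linarith
      then show ?thesis
      proof cases
        case 1
        have "8 * w t = \<rho> (8 * t)" using w1[OF 1] by simp
        moreover have "K (w t) = D (8 * w t)" using w1[OF 1] L(4)[of "8 * t"] by (simp add: K_def join_def A_def)
        ultimately have "K (w t) = D (\<rho> (8 * t))" by (simp only:)
        also have "\<dots> = \<gamma> (c (8 * t))" using L(4)[of "8 * t"] L(2)[of "8 * t"] \<kappa> by (simp add: D_def)
        finally show ?thesis using 1 by (simp add: join_def)
      next
        case 2
        have "delayed (8 * t - 1) \<le> 8 * t - 1" using 2 by (intro delayed_range) simp
        then have "w t \<le> 1/4" using w2[of t] 2 by simp
        then have "K (w t) = D (8 * w t)" by (simp add: K_def join_def A_def)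
        also have "8 * w t = 1 + delayed (8 * t - 1)" using w2[of t] 2 by simp
        also have "D (1 + delayed (8 * t - 1)) = b (8 * t - 1)" by (simp only: b_def)
        finally show ?thesis using 2 by (simp add: join_def)
      next
        case 3
        then show ?thesis using w3[of t] by (simp add: K_def join_def)
      qed
    qed
    have "geo_eq x0 K (join (join (join (\<lambda>t. \<gamma> (c t)) b) (\<lambda>t. b (1 - t))) d)"
      using geo_rest_curve[OF K K0 wr] unfolding KW .
    moreover have "geo_eq x0 (join (join (join (\<lambda>t. \<gamma> (c t)) b) (\<lambda>t. b (1 - t))) d) (join (\<lambda>t. \<gamma> (c t)) d)"
    proof (rule geo_backtrack[OF flat_step_curve[OF \<gamma>p(1) c] flat_compose_flat_step[OF c] _ b bflat d(1,2)])
      show "\<gamma> (c 0) = x0" "\<gamma> (c 1) = b 0" "b 0 = d 0"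
        using flat_stepD(4,5)[OF c] \<gamma>p(2) b0[of 0] d(3) by simp_all
    qed
    ultimately show ?thesis by (rule equivclp_trans)
  qed
  then show ?thesis by blast
qed

lemma fold_right_eq:
  assumes "\<gamma> \<in> paths_from X x0" "curve X d" "flat d" "d 0 = \<gamma> 1" "flat_step c V" "flat_step c' V'"
  shows "geo_eq x0 (join (\<lambda>t. \<gamma> (c t)) d) (join (\<lambda>t. \<gamma> (c' t)) d)"
proof -
  obtain K where "\<forall>c V. flat_step c V \<longrightarrow> geo_equiv X x0 K (unit_path (join (\<lambda>t. \<gamma> (c t)) d))"
    using fold_right[OF assms(1-4)] by blast
  then show ?thesis using assms(5,6) by (meson equivclp_sym equivclp_trans)
qed

lemma path_concat_ends: "(\<gamma> \<star> \<delta>) 0 = \<gamma> 0" "(\<gamma> \<star> \<delta>) 1 = \<delta> 1"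
  by (simp_all add: path_concat_def join_ends)

lemma path_rev_ends: "path_rev \<gamma> 0 = \<gamma> 1" "path_rev \<gamma> 1 = \<gamma> 0"
  by (simp_all add: path_rev_def)

lemma geo_step_ends:
  assumes "geo_step X x0 \<gamma> \<gamma>'"
  shows "\<gamma> \<in> paths_from X x0 \<and> \<gamma>' \<in> paths_from X x0 \<and> \<gamma>' 1 = \<gamma> 1"
  using assms
proof cases
  case (reparam \<phi>)
  have "smooth_map I01 I01 \<phi>" using reparam(3) by (simp add: op_diffeo_def)
  then show ?thesis using reparam path_reparam_in_path_space flat_step_reparam(2,3)[OF reparam(3)] by simp
next
  case (stop \<psi> a b t0)
  then show ?thesis using path_reparam_in_path_space flat_step_stop(2,3)[OF stop(3-7)] by simp
next
  case (backtrack \<alpha> \<beta> \<eta>)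
  then show ?thesis by (simp add: path_concat_ends)
next
  case (backtrack_empty \<beta>)
  then show ?thesis by (simp add: path_concat_ends)
qed

text \<open>For a path \<open>\<gamma>\<close>, the curve \<open>smoothed \<gamma>\<close> is a flat representative of its class.\<close>

definition smoothed :: "(real \<Rightarrow> 'a) \<Rightarrow> real \<Rightarrow> 'a" where
  "smoothed \<gamma> = (\<lambda>t. \<gamma> (base_step t))"

lemma path_concat_smoothing:
  assumes "flat_step c V" "flat_step c' V'" "\<gamma> 1 = \<delta> 0" 
    "(\<lambda>t. \<gamma> (c t)) = f" "(\<lambda>t. \<delta> (c' t)) = g"
  shows "(\<lambda>t. (\<gamma> \<star> \<delta>) (wjoin (1/2) c c' t)) = join f g"
  using path_concat_wjoin[where \<gamma> = \<gamma> and \<delta> = \<delta>, OF assms(1-3)] assms(4,5) by auto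

lemma path_rev_smoothed: "(\<lambda>t. path_rev \<beta> (base_step t)) = (\<lambda>t. smoothed \<beta> (1 - t))"
proof
  fix t
  have "base_step t \<in> {0..1}" by (rule flat_stepD(8)[OF flat_base_step])
  then show "path_rev \<beta> (base_step t) = smoothed \<beta> (1 - t)" by (simp add: path_rev_def smoothed_def base_step_symmetric)
qed

lemma backtrack_smoothing:
  assumes c: "flat_step c V" "(\<lambda>t. \<delta> (c t)) = J" and e: "\<delta> 1 = \<beta> 1" "\<beta> 0 = \<eta> 0"
  shows "\<exists>c V. flat_step c V \<and> (\<lambda>t. (\<delta> \<star> path_rev \<beta> \<star> \<eta>) (c t)) = join (join J (\<lambda>t. smoothed \<beta> (1 - t))) (smoothed \<eta>)"
proof -
  note b = flat_base_step
  let ?c1 = "wjoin (1/2) c base_step"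
  obtain V1 where 1: "flat_step ?c1 V1" using flat_step_wjoin[OF _ _ c(1) b, of "1/2"] by auto
  obtain V2 where 2: "flat_step (wjoin (1/2) ?c1 base_step) V2" using flat_step_wjoin[OF _ _ 1 b, of "1/2"] by auto
  have "(\<lambda>t. (\<delta> \<star> path_rev \<beta>) (?c1 t)) = join J (\<lambda>t. smoothed \<beta> (1 - t))"
    by (rule path_concat_smoothing[where \<gamma> = \<delta> and \<delta> = "path_rev \<beta>", OF c(1) b _ c(2) path_rev_smoothed]) (simp add: path_rev_ends e(1))
  from path_concat_smoothing[where \<gamma> = "\<delta> \<star> path_rev \<beta>" and \<delta> = \<eta>, OF 1 b _ this refl] 2 show ?thesis
    by (auto simp: path_concat_ends path_rev_ends e(2) smoothed_def)
qed

lemma concat_smoothing: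
  assumes "\<alpha> 1 = \<eta> 0"
  shows "\<exists>c V. flat_step c V \<and> (\<lambda>t. (\<alpha> \<star> \<eta>) (c t)) = join (smoothed \<alpha>) (smoothed \<eta>)"
proof -
  note b = flat_base_step
  obtain V1 where 1: "flat_step (wjoin (1/2) base_step base_step) V1" using flat_step_wjoin[OF _ _ b b, of "1/2"] by auto
  show ?thesis unfolding smoothed_def using 1 path_concat_smoothing[where \<gamma> = \<alpha> and \<delta> = \<eta>, OF b b assms refl refl] by blast
qed

lemma reparam_base_step: "(\<lambda>t. unit_path (\<gamma> \<circ> \<psi>) (base_step t)) = (\<lambda>t. \<gamma> (\<psi> (base_step t)))"
  using flat_stepD(8)[OF flat_base_step] by (auto simp: fun_eq_iff)

lemma smoothed_ends [simp]: "smoothed \<gamma> 0 = \<gamma> 0" "smoothed \<gamma> 1 = \<gamma> 1"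
  by (simp_all add: smoothed_def base_step_values)

lemma smoothed_curve: "\<gamma> \<in> smooth_paths X \<Longrightarrow> curve X (smoothed \<gamma>)"
  unfolding smoothed_def by (rule flat_step_curve[OF _ flat_base_step])

lemma smoothed_flat: "flat (smoothed \<gamma>)"
  unfolding smoothed_def by (rule flat_compose_flat_step[OF flat_base_step])

lemma geo_smoothed: "K \<in> paths_from X x0 \<Longrightarrow> geo_equiv X x0 K (unit_path (smoothed K))"
  unfolding smoothed_def by (rule geo_flat_step_path[OF _ flat_base_step])

lemma smoothed_unit: "smoothed (unit_path f) = (\<lambda>t. f (base_step t))"
  using flat_stepD(8)[OF flat_base_step] by (auto simp: fun_eq_iff smoothed_def)

text \<open>After composition with flat steps, the generators are of two kinds only: they change the flat step or cancel
one backtrack between flat curves. An empty \<open>\<alpha>\<close> is replaced by a constant curve.\<close>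

lemma geo_step_normal_form:
  assumes "geo_step X x0 \<gamma> \<gamma>'"
  obtains (reparam) c V where "flat_step c V" "smoothed \<gamma>' = (\<lambda>t. \<gamma> (c t))"
    | (cancel) A \<beta> N c V c' V' where "curve X A" "flat A" "curve X N" "flat N" "\<beta> \<in> smooth_paths X"
      "A 1 = \<beta> 0" "\<beta> 0 = N 0" "A 0 = x0" "N 1 = \<gamma> 1"
      "flat_step c V" "(\<lambda>t. \<gamma> (c t)) = join (join (join A (smoothed \<beta>)) (\<lambda>t. smoothed \<beta> (1 - t))) N"
      "flat_step c' V'" "(\<lambda>t. \<gamma>' (c' t)) = join A N"
  using assms
proof cases
  case (reparam \<phi>)
  have "smoothed \<gamma>' = (\<lambda>t. \<gamma> (\<phi> (base_step t)))" unfolding reparam(1) smoothed_def by (rule reparam_base_step)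
  then show ?thesis by (rule that(1)[OF flat_step_reparam(1)[OF reparam(3)]])
next
  case (stop \<psi> a b t0)
  have "smoothed \<gamma>' = (\<lambda>t. \<gamma> (\<psi> (base_step t)))" unfolding stop(1) smoothed_def by (rule reparam_base_step)
  then show ?thesis by (rule that(1)[OF flat_step_stop(1)[OF stop(3-7)]])
next
  case (backtrack \<alpha> \<beta> \<eta>)
  have e: "\<alpha> 0 = x0" "\<alpha> 1 = \<eta> 0" using backtrack(6-8) by (simp_all add: path_space_iff path_concat_ends)
  obtain c0 V0 where c0: "flat_step c0 V0" "(\<lambda>t. (\<alpha> \<star> \<beta>) (c0 t)) = join (smoothed \<alpha>) (smoothed \<beta>)"
    using concat_smoothing[of \<alpha> \<beta>] backtrack(6) by blast
  obtain c V where c: "flat_step c V" "(\<lambda>t. \<gamma> (c t)) = join (join (join (smoothed \<alpha>) (smoothed \<beta>)) (\<lambda>t. smoothed \<beta> (1 - t))) (smoothed \<eta>)"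
    using backtrack_smoothing[OF c0, of \<beta> \<eta>] backtrack(7) unfolding backtrack(1) by (auto simp: path_concat_ends)
  obtain c' V' where c': "flat_step c' V'" "(\<lambda>t. \<gamma>' (c' t)) = join (smoothed \<alpha>) (smoothed \<eta>)"
    using concat_smoothing[of \<alpha> \<eta>, OF e(2)] unfolding backtrack(2) by blast
  show ?thesis
    by (rule that(2)[OF smoothed_curve[OF backtrack(3)] smoothed_flat smoothed_curve[OF backtrack(5)] smoothed_flat backtrack(4) _ _ _ _ c c'])
       (use backtrack(1,6,7) e(1) in \<open>simp_all add: path_concat_ends\<close>)
next
  case (backtrack_empty \<beta>)
  note b = flat_base_step
  have \<gamma>': "\<gamma>' \<in> smooth_paths X" "\<gamma>' 0 = x0" using backtrack_empty(5) by (simp_all add: path_space_iff)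
  obtain W where W: "flat_step (wjoin 0 base_step base_step) W" using flat_step_wjoin[OF _ _ b b, of 0] by auto
  have j: "(\<lambda>t. \<delta> (wjoin 0 base_step base_step t)) = join (\<lambda>t. \<delta> 0) (smoothed \<delta>)" for \<delta> :: "real \<Rightarrow> 'a"
    using join_const_left[OF b, where f = \<delta> and c = base_step] by (simp add: smoothed_def fun_eq_iff)
  obtain c V where c: "flat_step c V" "(\<lambda>t. \<gamma> (c t)) = join (join (join (\<lambda>t. \<beta> 0) (smoothed \<beta>)) (\<lambda>t. smoothed \<beta> (1 - t))) (smoothed \<gamma>')"
    using backtrack_smoothing[where \<delta> = \<beta> and \<beta> = \<beta> and \<eta> = \<gamma>', OF W j[of \<beta>] refl backtrack_empty(3)] unfolding backtrack_empty(1) by blast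
  have c': "(\<lambda>t. \<gamma>' (wjoin 0 base_step base_step t)) = join (\<lambda>t. \<beta> 0) (smoothed \<gamma>')"
    using j[of \<gamma>'] backtrack_empty(3) by simp
  have "curve X (\<lambda>t. \<beta> 0)" using curve_const[OF curve_carrier[OF smoothed_curve[OF backtrack_empty(2)], of 0]] by simp
  then show ?thesis
    by (rule that(2)[OF _ flat_const smoothed_curve[OF \<gamma>'(1)] smoothed_flat backtrack_empty(2) _ _ _ _ c W c'])
       (use backtrack_empty(1,3) \<gamma>'(2) in \<open>simp_all add: path_concat_ends\<close>)
qed

text \<open>A change of the flat step on the left factor is harmless by \<open>fold_right\<close>; a backtrack is cancelled after moving
the brackets.\<close>

lemma geo_step_join_right:
  assumes st: "geo_step X x0 \<gamma> \<gamma>'" and d: "d \<in> smooth_paths X" "d 0 = \<gamma> 1"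
  shows "geo_eq x0 (join (smoothed \<gamma>) (smoothed d)) (join (smoothed \<gamma>') (smoothed d))"
proof -
  note b = flat_base_step
  note D = smoothed_curve[OF d(1)] smoothed_flat[of d]
  have \<gamma>: "\<gamma> \<in> paths_from X x0" "\<gamma>' \<in> paths_from X x0" "\<gamma>' 1 = \<gamma> 1"
    using geo_step_ends[OF st] by auto
  have D0: "smoothed d 0 = \<gamma> 1" "smoothed d 0 = \<gamma>' 1" using d(2) \<gamma>(3) by simp_all
  note F = fold_right_eq[OF \<gamma>(1) D D0(1)] and F' = fold_right_eq[OF \<gamma>(2) D D0(2)]
  from st show ?thesis
  proof (cases rule: geo_step_normal_form)
    case (reparam c V)
    show ?thesis unfolding reparam(2) using F[OF b reparam(1)] by (simp only: smoothed_def)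
  next
    case (cancel A \<beta> N c V c' V')
    let ?B = "smoothed \<beta>" and ?B' = "\<lambda>t. smoothed \<beta> (1 - t)" and ?D = "smoothed d"
    note A = cancel(1,2) and N = cancel(3,4) and B = smoothed_curve[OF cancel(5)] smoothed_flat[of \<beta>]
    note B' = curve_rev[OF B(1)] flat_rev[OF B(2)]
    have AB: "A 1 = ?B 0" and BN: "?B 0 = N 0" and BB: "join A ?B 1 = ?B' 0" and ND: "N 1 = ?D 0"
      using cancel(6,7,9) d(2) by (simp_all add: join_ends)
    note jAB = curve_flat_join_simps[OF A B AB] and jND = curve_flat_join_simps[OF N D ND]
    note Q = curve_flat_join_simps[OF jAB(1,2) B' BB]
    have "geo_eq x0 (join (smoothed \<gamma>) ?D) (join (join (join (join A ?B) ?B') N) ?D)"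
      using F[OF b cancel(10)] unfolding cancel(11) smoothed_def .
    also have "geo_equiv X x0 \<dots> (unit_path (join (join (join A ?B) ?B') (join N ?D)))"
      by (rule geo_assoc[OF Q(1,2) _ N D _ ND]) (use BN in \<open>simp_all add: join_ends cancel(8)\<close>)
    also have "geo_equiv X x0 \<dots> (unit_path (join A (join N ?D)))"
      by (rule geo_backtrack[OF A cancel(8) B jND(1,2) AB]) (use BN in \<open>simp add: join_ends\<close>)
    also have "geo_equiv X x0 \<dots> (unit_path (join (join A N) ?D))"
      by (rule equivclp_sym, rule geo_assoc[OF A cancel(8) N D _ ND]) (use AB BN in simp)
    also have "geo_equiv X x0 \<dots> (unit_path (join (smoothed \<gamma>') ?D))"
      using F'[OF cancel(12) b] unfolding cancel(13) smoothed_def .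
    finally show ?thesis .
  qed
qed

lemma equivclp_geo_ends:
  assumes "geo_equiv X x0 \<gamma> \<gamma>'" "\<gamma> \<in> paths_from X x0"
  shows "\<gamma>' \<in> paths_from X x0 \<and> \<gamma>' 1 = \<gamma> 1"
  using assms
proof (induction rule: equivclp_induct)
  case (step y z)
  have y: "y \<in> paths_from X x0" "y 1 = \<gamma> 1" using step.IH[OF step.prems] by simp_all
  from step.hyps(2) show ?case
  proof
    assume "geo_step X x0 y z"
    from geo_step_ends[OF this] show ?thesis using y by simp
  next
    assume "geo_step X x0 z y"
    from geo_step_ends[OF this] show ?thesis using y by simp
  qed
qed simp

lemma geo_join_right:
  assumes "geo_equiv X x0 \<gamma> \<gamma>'" "\<gamma> \<in> paths_from X x0" "d \<in> smooth_paths X" "d 0 = \<gamma> 1"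
  shows "geo_eq x0 (join (smoothed \<gamma>) (smoothed d)) (join (smoothed \<gamma>') (smoothed d))"
  using assms
proof (induction rule: equivclp_induct)
  case (step y z)
  have y: "y 1 = \<gamma> 1" "z 1 = \<gamma> 1"
    using equivclp_geo_ends[OF step.hyps(1) step.prems(1)] geo_step_ends[of x0 y z] geo_step_ends[of x0 z y] step.hyps(2) by auto
  have "geo_eq x0 (join (smoothed y) (smoothed d)) (join (smoothed z) (smoothed d))"
    using step.hyps(2)
  proof
    assume "geo_step X x0 y z"
    then show ?thesis by (rule geo_step_join_right) (use step.prems y in auto)
  next
    assume "geo_step X x0 z y"
    then have "geo_eq x0 (join (smoothed z) (smoothed d)) (join (smoothed y) (smoothed d))"
      by (rule geo_step_join_right) (use step.prems y in auto)
    then show ?thesis by (rule equivclp_sym)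
  qed
  with step.IH[OF step.prems] show ?case by (rule equivclp_trans)
qed simp

lemma geo_join_smoothed:
  assumes f: "curve X f" "flat f" "f 0 = x0" and g: "curve X g" "flat g" and fg: "f 1 = g 0"
  shows "geo_eq x0 (join f g) (join (smoothed (unit_path f)) (smoothed (unit_path g)))"
  unfolding smoothed_unit by (rule geo_join_flat_step[OF f g fg flat_base_step flat_base_step])

lemma geo_cong_right:
  assumes f: "curve X f" "flat f" "f 0 = x0" and f': "curve X f'" "flat f'" "f' 0 = x0"
    and g: "curve X g" "flat g" and fg: "f 1 = g 0" and eq: "geo_eq x0 f f'"
  shows "geo_eq x0 (join f g) (join f' g)"
proof -
  have P: "unit_path f \<in> paths_from X x0" by (rule curve_path_space[OF f(1,3)])
  have "f' 1 = f 1" using equivclp_geo_ends[OF eq P] by simp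
  then have f'g: "f' 1 = g 0" using fg by simp
  have "geo_eq x0 (join (smoothed (unit_path f)) (smoothed (unit_path g))) (join (smoothed (unit_path f')) (smoothed (unit_path g)))"
    by (rule geo_join_right[OF eq P curve_in_smooth_paths[OF g(1)]]) (simp add: fg)
  then show ?thesis
    using geo_join_smoothed[OF f g fg] geo_join_smoothed[OF f' g f'g] by (meson equivclp_sym equivclp_trans)
qed

lemma join_rev: "f 1 = g 0 \<Longrightarrow> (\<lambda>t. join f g (1 - t)) = join (\<lambda>t. g (1 - t)) (\<lambda>t. f (1 - t))"
  by (auto simp: join_def fun_eq_iff algebra_simps)

text \<open>Reversal turns the end of a path into its start, so the equivalence on the reversed paths is that for
the base point \<open>\<gamma> 1\<close>.\<close>

lemma geo_rev_flat_steps: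
  assumes \<gamma>: "\<gamma> \<in> smooth_paths X" and c: "flat_step c V" "flat_step c' V'"
  shows "geo_eq (\<gamma> 1) (\<lambda>t. \<gamma> (c (1 - t))) (\<lambda>t. \<gamma> (c' (1 - t)))"
proof -
  have "smooth_map I01 I01 (\<lambda>t. - 1 * t + 1)"
    by (rule smooth_map_real_subsets[OF smooth_on_affine[of "- 1" 1] open_UNIV]) auto
  then have "smooth_map I01 I01 (\<lambda>t. 1 - t)" by simp
  from smooth_paths_reparam[OF \<gamma> this] have "path_rev \<gamma> \<in> smooth_paths X" by (simp add: path_rev_def comp_def)
  then have P: "path_rev \<gamma> \<in> paths_from X (\<gamma> 1)" by (simp add: path_space_iff path_rev_ends)
  have "geo_equiv X (\<gamma> 1) (path_rev \<gamma>) (unit_path (\<lambda>t. \<gamma> (c (1 - t))))" if c: "flat_step c V" for c V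
  proof -
    have "(\<lambda>t. path_rev \<gamma> (1 - c (1 - t))) = (\<lambda>t. \<gamma> (c (1 - t)))"
      using flat_stepD(6,7)[OF c] by (simp add: path_rev_def)
    then show ?thesis using geo_flat_step_path[OF P flat_step_reflect[OF c]] by simp
  qed
  then show ?thesis using c equivclp_sym equivclp_trans by meson
qed

text \<open>The reverse of a cancelled backtrack is again a backtrack, with the brackets on the other side.\<close>

lemma geo_step_rev:
  assumes st: "geo_step X x0 \<gamma> \<gamma>'"
  shows "geo_eq (\<gamma> 1) (\<lambda>t. smoothed \<gamma> (1 - t)) (\<lambda>t. smoothed \<gamma>' (1 - t))"
proof -
  note b = flat_base_step
  have \<gamma>: "\<gamma> \<in> smooth_paths X" "\<gamma>' \<in> smooth_paths X" "\<gamma>' 1 = \<gamma> 1"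
    using geo_step_ends[OF st] by (auto simp: path_space_iff)
  note F = geo_rev_flat_steps[OF \<gamma>(1)] and F' = geo_rev_flat_steps[OF \<gamma>(2), unfolded \<gamma>(3)]
  from st show ?thesis
  proof (cases rule: geo_step_normal_form)
    case (reparam c V)
    show ?thesis unfolding reparam(2) using F[OF b reparam(1)] by (simp only: smoothed_def)
  next
    case (cancel A \<beta> N c V c' V')
    let ?B = "smoothed \<beta>" and ?A' = "\<lambda>t. A (1 - t)" and ?B' = "\<lambda>t. smoothed \<beta> (1 - t)" and ?N' = "\<lambda>t. N (1 - t)"
    note B = smoothed_curve[OF cancel(5)] smoothed_flat[of \<beta>]
    note A' = curve_rev[OF cancel(1)] flat_rev[OF cancel(2)] and B' = curve_rev[OF B(1)] flat_rev[OF B(2)]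
      and N' = curve_rev[OF cancel(3)] flat_rev[OF cancel(4)]
    have NB: "?N' 1 = ?B 0" and BA: "?B' 1 = ?A' 0" and BB: "?B 1 = ?B' 0" and N0: "?N' 0 = \<gamma> 1"
      using cancel(6,7,9) by simp_all
    note jBA = curve_flat_join_simps[OF B' A' BA] and jNB = curve_flat_join_simps[OF N' B NB]
    have r: "(\<lambda>t. \<gamma> (c (1 - t))) = join ?N' (join ?B (join ?B' ?A'))"
      using fun_cong[OF cancel(11)] join_rev[of "join (join A ?B) ?B'" N] join_rev[of "join A ?B" ?B'] join_rev[of A ?B] cancel(6,7)
      by (simp add: join_ends)
    have r': "(\<lambda>t. \<gamma>' (c' (1 - t))) = join ?N' ?A'"
      using fun_cong[OF cancel(13)] join_rev[of A N] cancel(6,7) by simp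
    have "geo_eq (\<gamma> 1) (\<lambda>t. smoothed \<gamma> (1 - t)) (\<lambda>t. \<gamma> (c (1 - t)))" using F[OF b cancel(10)] unfolding smoothed_def .
    also have "geo_equiv X (\<gamma> 1) \<dots> (unit_path (join (join ?N' ?B) (join ?B' ?A')))"
      unfolding r by (rule equivclp_sym, rule geo_assoc[OF N' N0 B jBA(1,2) NB]) (simp add: join_ends)
    also have "geo_equiv X (\<gamma> 1) \<dots> (unit_path (join (join (join ?N' ?B) ?B') ?A'))"
      by (rule equivclp_sym, rule geo_assoc[OF jNB(1,2) _ B' A' _ BA]) (use N0 in \<open>simp_all add: join_ends\<close>)
    also have "geo_equiv X (\<gamma> 1) \<dots> (unit_path (\<lambda>t. \<gamma>' (c' (1 - t))))"
      unfolding r' by (rule geo_backtrack[OF N' N0 B A' NB]) (simp add: cancel(6))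
    also have "geo_equiv X (\<gamma> 1) \<dots> (unit_path (\<lambda>t. smoothed \<gamma>' (1 - t)))"
      using F'[OF cancel(12) b] unfolding smoothed_def .
    finally show ?thesis .
  qed
qed

lemma geo_rev:
  assumes "geo_equiv X x0 \<gamma> \<gamma>'" "\<gamma> \<in> paths_from X x0"
  shows "geo_eq (\<gamma> 1) (\<lambda>t. smoothed \<gamma> (1 - t)) (\<lambda>t. smoothed \<gamma>' (1 - t))"
  using assms
proof (induction rule: equivclp_induct)
  case (step y z)
  have y: "y 1 = \<gamma> 1" using equivclp_geo_ends[OF step.hyps(1) step.prems] by simp
  have "geo_eq (y 1) (\<lambda>t. smoothed y (1 - t)) (\<lambda>t. smoothed z (1 - t))"
    using step.hyps(2)
  proof
    assume "geo_step X x0 y z"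
    then show ?thesis by (rule geo_step_rev)
  next
    assume "geo_step X x0 z y"
    from equivclp_sym[OF geo_step_rev[OF this]] geo_step_ends[OF this] show ?thesis by simp
  qed
  with step.IH[OF step.prems] show ?case unfolding y by (rule equivclp_trans)
qed simp

text \<open>Reversal exchanges the factors of a concatenation and reduces this to \<open>geo_cong_right\<close>.\<close>

lemma geo_join_left:
  assumes eq: "geo_equiv X x0 d d'" and d: "d \<in> paths_from X x0"
    and f: "curve X f" "flat f" "f 1 = x0"
  shows "geo_eq (f 0) (join f (smoothed d)) (join f (smoothed d'))"
proof -
  have d': "d' \<in> paths_from X x0" "d' 1 = d 1" using equivclp_geo_ends[OF eq d] by auto
  let ?h = "\<lambda>d. join (\<lambda>t. smoothed d (1 - t)) (\<lambda>t. f (1 - t))"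
  note f' = curve_rev[OF f(1)] flat_rev[OF f(2)]
  have D: "curve X (smoothed d)" "d 0 = x0" if "d \<in> paths_from X x0" for d
    using that smoothed_curve by (simp_all add: path_space_iff)
  have h: "curve X (?h d)" "?h d 0 = d 1" "?h d 1 = f 0" if "d \<in> paths_from X x0" for d
    using curve_join_flat[OF curve_rev[OF D(1)[OF that]] flat_rev[OF smoothed_flat] f'] D(2)[OF that] f(3) by (simp_all add: join_ends)
  have "geo_eq (d 1) (?h d) (?h d')"
    by (rule geo_cong_right[OF curve_rev[OF D(1)[OF d]] flat_rev[OF smoothed_flat] _ curve_rev[OF D(1)[OF d'(1)]] flat_rev[OF smoothed_flat] _ f' _ geo_rev[OF eq d]])
       (use D(2)[OF d] f(3) d'(2) in simp_all)
  from geo_rev[OF this curve_path_space[OF h(1,2)[OF d]]]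
  have "geo_eq (f 0) (\<lambda>t. smoothed (unit_path (?h d)) (1 - t)) (\<lambda>t. smoothed (unit_path (?h d')) (1 - t))"
    using h(3)[OF d] by simp
  moreover have "(\<lambda>t. smoothed (unit_path (?h d)) (1 - t)) = (\<lambda>t. join f (smoothed d) (base_step t))"
    if "d \<in> paths_from X x0" for d
    using fun_cong[OF join_rev[of f "smoothed d"]] D(2)[OF that] f(3)
    by (simp add: smoothed_unit base_step_symmetric flip: join_rev)
  ultimately have 1: "geo_eq (f 0) (\<lambda>t. join f (smoothed d) (base_step t)) (\<lambda>t. join f (smoothed d') (base_step t))"
    using d d'(1) by simp
  have "geo_eq (f 0) (join f (smoothed d)) (\<lambda>t. join f (smoothed d) (base_step t))" if "d \<in> paths_from X x0" for d
    by (rule geo_flat_step[OF curve_join_flat[OF f(1,2) D(1)[OF that] smoothed_flat] _ flat_base_step])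
       (use D(2)[OF that] f(3) in \<open>simp_all add: join_ends\<close>)
  then show ?thesis using 1 d d'(1) equivclp_sym equivclp_trans by meson
qed

lemma geo_join_cong:
  assumes eq: "geo_equiv X x0 \<gamma> \<gamma>'" "geo_equiv X x0 \<delta> \<delta>'"
    and \<gamma>: "\<gamma> \<in> paths_from X x0" "\<gamma> 1 = x0" and \<delta>: "\<delta> \<in> paths_from X x0"
  shows "geo_eq x0 (join (smoothed \<gamma>) (smoothed \<delta>)) (join (smoothed \<gamma>') (smoothed \<delta>'))"
proof -
  have \<gamma>': "\<gamma>' \<in> paths_from X x0" "\<gamma>' 1 = x0" using equivclp_geo_ends[OF eq(1) \<gamma>(1)] \<gamma>(2) by auto
  have "geo_eq x0 (join (smoothed \<gamma>) (smoothed \<delta>)) (join (smoothed \<gamma>') (smoothed \<delta>))"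
    by (rule geo_join_right[OF eq(1) \<gamma>(1)]) (use \<delta> \<gamma>(2) in \<open>auto simp: path_space_iff\<close>)
  moreover have "geo_eq x0 (join (smoothed \<gamma>') (smoothed \<delta>)) (join (smoothed \<gamma>') (smoothed \<delta>'))"
    using geo_join_left[OF eq(2) \<delta> smoothed_curve smoothed_flat, of \<gamma>'] \<gamma>' by (simp add: path_space_iff)
  ultimately show ?thesis by (rule equivclp_trans)
qed

end

section \<open>The geometric loop group is a group\<close>

definition flat_loop :: "'a diffeology \<Rightarrow> 'a \<Rightarrow> (real \<Rightarrow> 'a) \<Rightarrow> bool" where
  "flat_loop X x0 f \<longleftrightarrow> curve X f \<and> flat f \<and> f 0 = x0 \<and> f 1 = x0"

lemma flat_loopD:
  assumes "flat_loop X x0 f"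
  shows "curve X f" "flat f" "f 0 = x0" "f 1 = x0"
  using assms by (simp_all add: flat_loop_def)

definition loop_ext :: "'a \<Rightarrow> (real \<Rightarrow> 'a) \<Rightarrow> real \<Rightarrow> 'a" where
  "loop_ext x \<gamma> = (\<lambda>t. if t \<in> {0..1} then \<gamma> t else x)"

context diffeological_space
begin

lemma flat_loop_ext:
  assumes "\<gamma> \<in> stationary_loops X x0"
  shows "flat_loop X x0 (loop_ext x0 \<gamma>)" "unit_path (loop_ext x0 \<gamma>) = \<gamma>"
proof -
  have \<gamma>: "\<gamma> \<in> smooth_paths X" "\<gamma> 0 = x0" "\<gamma> 1 = x0" and "sitting \<gamma>"
    using assms by (auto simp only: stationary_loops_def mem_Collect_eq)
  then obtain \<epsilon> where \<epsilon>: "0 < \<epsilon>" "\<epsilon> < 1/2" "\<And>t. t \<in> {0..<\<epsilon>} \<Longrightarrow> \<gamma> t = x0" "\<And>t. t \<in> {1-\<epsilon><..1} \<Longrightarrow> \<gamma> t = x0"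
    unfolding sitting_def by metis
  let ?f = "loop_ext x0 \<gamma>"
  have l: "?f t = x0" if "t < \<epsilon>" for t using \<epsilon>(3)[of t] that by (simp add: loop_ext_def)
  have r: "?f t = x0" if "t > 1 - \<epsilon>" for t using \<epsilon>(4)[of t] that by (simp add: loop_ext_def)
  have smp: "smooth_map I01 X \<gamma>" "\<gamma> \<in> extensional {0..1}" using \<gamma>(1) by (simp_all add: smooth_paths_iff)
  have x0: "x0 \<in> carrier X" using smp(1) \<gamma>(2) unfolding smooth_map_def by (metis IntI PiE UNIV_I atLeastAtMost_iff order_refl real_line_simps(1) subset_diff_simps(1) zero_le_one)
  have c: "curve X ?f"
  proof (rule curve_localI)
    fix t :: real
    consider "t < \<epsilon>" | "t > 1 - \<epsilon>" | "0 < t" "t < 1" using \<epsilon>(1,2) by linarith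
    then show "\<exists>B g. open B \<and> t \<in> B \<and> (\<lambda>x. g (x 0)) \<in> plots X 1 {x \<in> Rn 1. x 0 \<in> B} \<and> (\<forall>s\<in>B. ?f s = g s)"
    proof cases
      case 1
      show ?thesis
        by (rule exI[of _ "{..<\<epsilon>}"], rule exI[of _ "\<lambda>t. x0"]) (use 1 l plot_const[OF openin_coord[of "{..<\<epsilon>}" 1 0] x0] in simp)
    next
      case 2
      show ?thesis
        by (rule exI[of _ "{1 - \<epsilon><..}"], rule exI[of _ "\<lambda>t. x0"]) (use 2 r plot_const[OF openin_coord[of "{1 - \<epsilon><..}" 1 0] x0] in simp)
    next
      case 3
      have o: "open_Rn 1 {x \<in> Rn 1. x 0 \<in> {0<..<1}}" by (rule openin_coord) simp
      have "(\<lambda>x. \<gamma> (x 0)) \<in> plots X 1 {x \<in> Rn 1. x 0 \<in> {0<..<1}}"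
        by (rule path_plot[OF smp(1) o smooth_fun_proj[OF o]]) auto
      then show ?thesis
        by (intro exI[of _ "{0<..<1}"] exI[of _ \<gamma>]) (use 3 in \<open>auto simp: loop_ext_def\<close>)
    qed
  qed
  have "flat ?f"
    unfolding flat_def
    by (rule exI[of _ "\<epsilon>/2"]) (use \<epsilon>(1,2) l r in auto)
  then show "flat_loop X x0 ?f" using c l[of 0] r[of 1] \<epsilon>(1) by (simp add: flat_loop_def)
  show "unit_path ?f = \<gamma>"
    using smp(2) by (auto simp: loop_ext_def restrict_def extensional_def fun_eq_iff)
qed

lemma flat_loop_stationary:
  assumes "flat_loop X x0 f"
  shows "unit_path f \<in> stationary_loops X x0"
proof -
  note f = flat_loopD[OF assms]
  obtain e where e: "e > 0" "e < 1/2" "\<And>t. t \<le> e \<Longrightarrow> f t = f 0" "\<And>t. t \<ge> 1 - e \<Longrightarrow> f t = f 1" using f(2) unfolding flat_def by blast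
  have "sitting (unit_path f)"
    unfolding sitting_def
  proof (intro exI[of _ e] conjI ballI)
    show "unit_path f t = unit_path f 0" if "t \<in> {0..<e}" for t using that e(3)[of t] e(2) by simp
    show "unit_path f t = unit_path f 1" if "t \<in> {1-e<..1}" for t using that e(4)[of t] e(2) by simp
  qed (use e in auto)
  then show ?thesis using curve_in_smooth_paths[OF f(1)] f(3,4) by (simp add: stationary_loops_def)
qed

lemma flat_loop_join: "flat_loop X x0 f \<Longrightarrow> flat_loop X x0 g \<Longrightarrow> flat_loop X x0 (join f g)"
  using curve_flat_join_simps[of f g] by (simp add: flat_loop_def)

lemma flat_loop_const: "x0 \<in> carrier X \<Longrightarrow> flat_loop X x0 (\<lambda>t. x0)"
  by (simp add: flat_loop_def curve_const flat_const)

lemma flat_loop_rev: "flat_loop X x0 f \<Longrightarrow> flat_loop X x0 (\<lambda>t. f (1 - t))"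
  by (simp add: flat_loop_def curve_rev flat_rev)

text \<open>Both groups consist of classes of flat loops multiplied by concatenation, so the group axioms are
verified once for a step-invariant relation.\<close>

lemma group_of_flat_loops:
  fixes G :: "('c, 'd) monoid_scheme" and cls :: "(real \<Rightarrow> 'a) \<Rightarrow> 'c"
  assumes E: "step_invariant X x0 E" and x0: "x0 \<in> carrier X"
    and carrier: "\<And>A. A \<in> carrier G \<longleftrightarrow> (\<exists>f. flat_loop X x0 f \<and> A = cls f)"
    and mult: "\<And>f g. flat_loop X x0 f \<Longrightarrow> flat_loop X x0 g \<Longrightarrow> cls f \<otimes>\<^bsub>G\<^esub> cls g = cls (join f g)"
    and one: "\<one>\<^bsub>G\<^esub> = cls (\<lambda>t. x0)"
    and eq: "\<And>f g. flat_loop X x0 f \<Longrightarrow> flat_loop X x0 g \<Longrightarrow> E f g \<Longrightarrow> cls f = cls g"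
    and rev: "\<And>f. flat_loop X x0 f \<Longrightarrow> E (join (\<lambda>t. f (1 - t)) f) (\<lambda>t. x0)"
  shows "group G"
proof (rule groupI)
  fix A B C assume "A \<in> carrier G" "B \<in> carrier G" "C \<in> carrier G"
  then obtain f g h where f: "flat_loop X x0 f" "A = cls f" and g: "flat_loop X x0 g" "B = cls g" and h: "flat_loop X x0 h" "C = cls h"
    unfolding carrier by blast
  note fg = flat_loop_join[OF f(1) g(1)] and gh = flat_loop_join[OF g(1) h(1)]
  show "A \<otimes>\<^bsub>G\<^esub> B \<otimes>\<^bsub>G\<^esub> C = A \<otimes>\<^bsub>G\<^esub> (B \<otimes>\<^bsub>G\<^esub> C)"
    unfolding f(2) g(2) h(2) mult[OF f(1) g(1)] mult[OF g(1) h(1)] mult[OF fg h(1)] mult[OF f(1) gh]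
  proof (rule eq[OF flat_loop_join[OF fg h(1)] flat_loop_join[OF f(1) gh]])
    show "E (join (join f g) h) (join f (join g h))"
      by (rule invariant_assoc[OF E]) (use flat_loopD[OF f(1)] flat_loopD[OF g(1)] flat_loopD[OF h(1)] in simp_all)
  qed
next
  fix A B assume "A \<in> carrier G" "B \<in> carrier G"
  then obtain f g where f: "flat_loop X x0 f" "A = cls f" and g: "flat_loop X x0 g" "B = cls g"
    unfolding carrier by blast
  show "A \<otimes>\<^bsub>G\<^esub> B \<in> carrier G"
    unfolding f(2) g(2) mult[OF f(1) g(1)] carrier using flat_loop_join[OF f(1) g(1)] by blast
next
  show "\<one>\<^bsub>G\<^esub> \<in> carrier G" unfolding one carrier using flat_loop_const[OF x0] by blast
next
  fix A assume "A \<in> carrier G"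
  then obtain f where f: "flat_loop X x0 f" "A = cls f" unfolding carrier by blast
  note c = flat_loop_const[OF x0] and r = flat_loop_rev[OF f(1)] and d = flat_loopD[OF f(1)]
  show "\<one>\<^bsub>G\<^esub> \<otimes>\<^bsub>G\<^esub> A = A"
    unfolding f(2) one mult[OF c f(1)]
    by (rule eq[OF flat_loop_join[OF c f(1)] f(1)]) (use invariant_const_left[OF E d(1-3)] d(3) in simp)
  have "cls (\<lambda>t. f (1 - t)) \<otimes>\<^bsub>G\<^esub> A = \<one>\<^bsub>G\<^esub>"
    unfolding f(2) one mult[OF r f(1)] by (rule eq[OF flat_loop_join[OF r f(1)] c rev[OF f(1)]])
  moreover have "cls (\<lambda>t. f (1 - t)) \<in> carrier G" unfolding carrier using r by blast
  ultimately show "\<exists>B\<in>carrier G. B \<otimes>\<^bsub>G\<^esub> A = \<one>\<^bsub>G\<^esub>" by blast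
qed

lemma flat_loop_path: "flat_loop X x0 f \<Longrightarrow> unit_path f \<in> paths_from X x0"
  by (rule curve_path_space) (simp_all add: flat_loop_def)

lemma geo_rel_iff: "(\<gamma>, \<gamma>') \<in> geo_rel X x0 \<longleftrightarrow> \<gamma> \<in> paths_from X x0 \<and> geo_equiv X x0 \<gamma> \<gamma>'"
  using equivclp_geo_ends[of x0 \<gamma> \<gamma>'] by (auto simp only: geo_rel_def mem_Collect_eq case_prod_conv)

lemma equiv_geo_rel: "equiv (paths_from X x0) (geo_rel X x0)"
proof (rule equivI)
  show "geo_rel X x0 \<subseteq> paths_from X x0 \<times> paths_from X x0" by (auto simp only: geo_rel_def)
  show "refl_on (paths_from X x0) (geo_rel X x0)"
    by (rule refl_onI) (simp add: geo_rel_iff)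
  show "sym (geo_rel X x0)"
    unfolding sym_def geo_rel_iff using equivclp_geo_ends equivclp_sym by metis
  show "trans (geo_rel X x0)"
    unfolding trans_def geo_rel_iff using equivclp_trans by metis
qed

lemma geo_class_eq_iff: "\<gamma> \<in> paths_from X x0 \<Longrightarrow> \<gamma>' \<in> paths_from X x0 \<Longrightarrow>
    geo_class X x0 \<gamma> = geo_class X x0 \<gamma>' \<longleftrightarrow> geo_equiv X x0 \<gamma> \<gamma>'"
  unfolding geo_class_def by (subst eq_equiv_class_iff[OF equiv_geo_rel]) (simp_all add: geo_rel_iff)

lemma geo_class_eqI:
  assumes "flat_loop X x0 f" "flat_loop X x0 g" "geo_eq x0 f g"
  shows "geo_class X x0 (unit_path f) = geo_class X x0 (unit_path g)"
  using geo_class_eq_iff[OF flat_loop_path[OF assms(1)] flat_loop_path[OF assms(2)]] assms(3) by blast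

lemma geo_loop_group_carrier:
  "A \<in> carrier (geo_loop_group X x0) \<longleftrightarrow> (\<exists>f. flat_loop X x0 f \<and> A = geo_class X x0 (unit_path f))"
proof
  assume "A \<in> carrier (geo_loop_group X x0)"
  then have A: "A \<in> paths_from X x0 // geo_rel X x0" "(\<lambda>\<gamma>. \<gamma> 1) ` A = {x0}"
    by (simp_all add: geo_loop_group_def geo_path_space_def quotient_diff_def)
  obtain \<gamma> where \<gamma>: "\<gamma> \<in> paths_from X x0" "A = geo_class X x0 \<gamma>"
    using A(1) unfolding geo_class_def by (rule quotientE)
  have "\<gamma> \<in> A" unfolding \<gamma>(2) geo_class_def using equiv_class_self[OF equiv_geo_rel \<gamma>(1)] .
  then have \<gamma>1: "\<gamma> 1 = x0" using A(2) by blast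
  have s: "\<gamma> \<in> smooth_paths X" "\<gamma> 0 = x0" using \<gamma>(1) by (simp_all add: path_space_iff)
  have l: "flat_loop X x0 (smoothed \<gamma>)"
    using smoothed_curve[OF s(1)] smoothed_flat s(2) \<gamma>1 by (simp add: flat_loop_def)
  have "A = geo_class X x0 (unit_path (smoothed \<gamma>))"
    unfolding \<gamma>(2) using geo_class_eq_iff[OF \<gamma>(1) flat_loop_path[OF l]] geo_smoothed[OF \<gamma>(1)] by blast
  with l show "\<exists>f. flat_loop X x0 f \<and> A = geo_class X x0 (unit_path f)" by blast
next
  assume "\<exists>f. flat_loop X x0 f \<and> A = geo_class X x0 (unit_path f)"
  then obtain f where f: "flat_loop X x0 f" "A = geo_class X x0 (unit_path f)" by blast
  note p = flat_loop_path[OF f(1)]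
  have "A \<in> paths_from X x0 // geo_rel X x0" unfolding f(2) geo_class_def by (rule quotientI[OF p])
  moreover have "unit_path f \<in> A" unfolding f(2) geo_class_def using equiv_class_self[OF equiv_geo_rel p] .
  moreover have "\<gamma> 1 = x0" if "\<gamma> \<in> A" for \<gamma>
  proof -
    have "geo_equiv X x0 (unit_path f) \<gamma>" using that unfolding f(2) geo_class_def by (simp add: geo_rel_iff)
    from equivclp_geo_ends[OF this p] show ?thesis using flat_loopD(4)[OF f(1)] by simp
  qed
  moreover have "(\<lambda>\<gamma>. \<gamma> 1) ` A = {x0}" using calculation(2,3) by blast
  ultimately show "A \<in> carrier (geo_loop_group X x0)"
    by (simp add: geo_loop_group_def geo_path_space_def quotient_diff_def)
qed

lemma geo_eq_join:
  assumes f: "flat_loop X x0 f" "flat_loop X x0 f'" "geo_eq x0 f f'"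
    and g: "flat_loop X x0 g" "flat_loop X x0 g'" "geo_eq x0 g g'"
  shows "geo_eq x0 (join f g) (join f' g')"
proof -
  have 1: "geo_eq x0 (join f g) (join (smoothed (unit_path f)) (smoothed (unit_path g)))" if "flat_loop X x0 f" "flat_loop X x0 g" for f g
    by (rule geo_join_smoothed) (use flat_loopD[OF that(1)] flat_loopD[OF that(2)] in simp_all)
  have "geo_eq x0 (join f g) (join (smoothed (unit_path f)) (smoothed (unit_path g)))" by (rule 1[OF f(1) g(1)])
  also have "geo_equiv X x0 \<dots> (unit_path (join (smoothed (unit_path f')) (smoothed (unit_path g'))))"
    by (rule geo_join_cong[OF f(3) g(3) flat_loop_path[OF f(1)] _ flat_loop_path[OF g(1)]]) (use flat_loopD(4)[OF f(1)] in simp)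
  also have "geo_equiv X x0 \<dots> (unit_path (join f' g'))" by (rule equivclp_sym[OF 1[OF f(2) g(2)]])
  finally show ?thesis .
qed

text \<open>The union over representatives that defines the product is a union of one and the same class: every
stationary representative extends to an equivalent flat loop, and concatenation respects equivalence.\<close>

lemma geo_loop_group_mult:
  assumes "flat_loop X x0 f" "flat_loop X x0 g"
  shows "geo_class X x0 (unit_path f) \<otimes>\<^bsub>geo_loop_group X x0\<^esub> geo_class X x0 (unit_path g) = geo_class X x0 (unit_path (join f g))"
proof -
  let ?A = "geo_class X x0 (unit_path f) \<inter> stationary_loops X x0" and ?B = "geo_class X x0 (unit_path g) \<inter> stationary_loops X x0"
  let ?C = "geo_class X x0 (unit_path (join f g))"
  have ne: "unit_path f \<in> geo_class X x0 (unit_path f)" if "flat_loop X x0 f" for f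
    unfolding geo_class_def using equiv_class_self[OF equiv_geo_rel flat_loop_path[OF that]] .
  have rep: "\<exists>f'. flat_loop X x0 f' \<and> \<gamma> = unit_path f' \<and> geo_eq x0 f f'" if "\<gamma> \<in> geo_class X x0 (unit_path f) \<inter> stationary_loops X x0" for \<gamma> f
    using that flat_loop_ext[of \<gamma> x0] by (intro exI[of _ "loop_ext x0 \<gamma>"]) (simp add: geo_class_def geo_rel_iff)
  have eq: "geo_class X x0 (\<gamma> \<star> \<delta>) = ?C" if \<gamma>A: "\<gamma> \<in> ?A" and \<delta>B: "\<delta> \<in> ?B" for \<gamma> \<delta>
  proof -
    obtain f' where f': "flat_loop X x0 f'" "\<gamma> = unit_path f'" "geo_eq x0 f f'" using rep[OF \<gamma>A] by blast
    obtain g' where g': "flat_loop X x0 g'" "\<delta> = unit_path g'" "geo_eq x0 g g'" using rep[OF \<delta>B] by blast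
    have "geo_class X x0 (unit_path (join f g)) = geo_class X x0 (unit_path (join f' g'))"
      by (rule geo_class_eqI[OF flat_loop_join[OF assms] flat_loop_join[OF f'(1) g'(1)] geo_eq_join[OF assms(1) f'(1,3) assms(2) g'(1,3)]])
    then show ?thesis unfolding f'(2) g'(2) path_concat_unit by (rule sym)
  qed
  have A: "unit_path f \<in> ?A" using ne[OF assms(1)] flat_loop_stationary[OF assms(1)] by blast
  have B: "unit_path g \<in> ?B" using ne[OF assms(2)] flat_loop_stationary[OF assms(2)] by blast
  have "(\<Union>\<gamma>\<in>?A. \<Union>\<delta>\<in>?B. geo_class X x0 (\<gamma> \<star> \<delta>)) = (\<Union>\<gamma>\<in>?A. \<Union>\<delta>\<in>?B. ?C)"
    using eq by (intro SUP_cong refl)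
  also have "\<dots> = ?C" using A B by blast
  finally show ?thesis by (simp add: geo_loop_group_def)
qed

lemma geo_loop_group_one: "\<one>\<^bsub>geo_loop_group X x0\<^esub> = geo_class X x0 (unit_path (\<lambda>t. x0))"
  by (simp add: geo_loop_group_def)

theorem group_geo_loop_group:
  assumes "x0 \<in> carrier X"
  shows "group (geo_loop_group X x0)"
proof (rule group_of_flat_loops[where G = "geo_loop_group X x0" and cls = "\<lambda>f. geo_class X x0 (unit_path f)",
      OF geo_step_invariant assms geo_loop_group_carrier geo_loop_group_mult geo_loop_group_one geo_class_eqI])
  fix f assume f: "flat_loop X x0 f"
  note r = flat_loop_rev[OF f] and j = flat_loopD[OF flat_loop_join[OF flat_loop_rev[OF f] f]]
  have "geo_eq x0 (join (\<lambda>t. f (1 - t)) f) (join (join (\<lambda>t. f (1 - t)) f) (\<lambda>t. x0))"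
    using equivclp_sym[OF geo_const_right[OF j(1-3)]] j(4) by simp
  also have "geo_equiv X x0 \<dots> (unit_path (\<lambda>t. x0))"
    using geo_backtrack_empty[OF flat_loopD(1-3)[OF r] curve_const[OF assms] flat_const] flat_loopD(4)[OF f] by simp
  finally show "geo_eq x0 (join (\<lambda>t. f (1 - t)) f) (\<lambda>t. x0)" .
qed

end

section \<open>The smooth fundamental group is a group\<close>

declare One_nat_def [simp del]

lemma smooth_vec_take: "smooth_vec (n + m) (Rn (n + m)) n (Rn n) (vec_take n)"
  unfolding smooth_vec_def
proof (intro conjI allI impI)
  show "vec_take n \<in> Rn (n + m) \<rightarrow> Rn n" by (simp add: vec_take_def Rn_iff Pi_iff)
  show "smooth_fun (n + m) (Rn (n + m)) (\<lambda>z. vec_take n z i)" if "i < n" for i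
    using that smooth_fun_proj[of "n + m" "Rn (n + m)" i] by (simp add: vec_take_def)
qed

lemma smooth_vec_drop: "smooth_vec (n + m) (Rn (n + m)) m (Rn m) (vec_drop n)"
  unfolding smooth_vec_def
proof (intro conjI allI impI)
  show "vec_drop n \<in> Rn (n + m) \<rightarrow> Rn m" by (simp add: vec_drop_def Rn_iff Pi_iff)
  show "smooth_fun (n + m) (Rn (n + m)) (\<lambda>z. vec_drop n z i)" for i
    using smooth_fun_proj[of "n + m" "Rn (n + m)" "n + i"] by (simp add: vec_drop_def)
qed

lemma openin_vec_times:
  assumes "open_Rn n U" "open_Rn m V"
  shows "open_Rn (n + m) (vec_times n U m V)"
proof -
  have "vec_times n U m V = {z \<in> Rn (n + m). vec_take n z \<in> U} \<inter> {z \<in> Rn (n + m). vec_drop n z \<in> V}"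
    by (auto simp: vec_times_def)
  then show ?thesis
    using openin_smooth_vec_preimage[OF openin_Rn_UNIV openin_Rn_UNIV assms(1) smooth_vec_take]
      openin_smooth_vec_preimage[OF openin_Rn_UNIV openin_Rn_UNIV assms(2) smooth_vec_drop] by auto
qed

lemma smooth_fun_precompose:
  assumes "open_Rn n U" "smooth_fun n U f" "open_Rn m V" "V \<subseteq> W"
    "open_Rn m W" "smooth_vec m W n (Rn n) F" "F \<in> V \<rightarrow> U"
  shows "smooth_fun m V (\<lambda>x. f (F x))"
proof (rule smooth_fun_compose[OF assms(1,3,2)])
  show "smooth_vec m V n U F"
    using assms(6,7) smooth_fun_subset[OF assms(5,3,4)] by (simp add: smooth_vec_def)
qed

lemma vec_times_1_1: "vec_times 1 (Rn 1) 1 (Rn 1) = Rn 2"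
  by (auto simp: vec_times_def Rn_iff vec_take_def vec_drop_def one_add_one)

text \<open>For loops this is the relation of lying in the same smooth component of the loop space
(\<open>smooth_component_rel_loop_space\<close>); the groupoid laws also need it for other curves.\<close>

definition path_homotopic :: "'a diffeology \<Rightarrow> (real \<Rightarrow> 'a) \<Rightarrow> (real \<Rightarrow> 'a) \<Rightarrow> bool" where
  "path_homotopic X f g \<longleftrightarrow> (\<exists>H. (\<lambda>z. H (z 0) (z 1)) \<in> plots X 2 (Rn 2) \<and>
     (\<forall>t. H 0 t = f t) \<and> (\<forall>t. H 1 t = g t) \<and> (\<forall>s. H s 0 = f 0 \<and> H s 1 = f 1))"

context diffeological_space
begin

lemma plot2_compose:
  assumes H: "(\<lambda>z. H (z 0) (z 1)) \<in> plots X 2 (Rn 2)"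
    and U: "open_Rn n U" and ab: "smooth_fun n U a" "smooth_fun n U b"
  shows "(\<lambda>u. H (a u) (b u)) \<in> plots X n U"
proof -
  let ?F = "\<lambda>u i::nat. if i = 0 then a u else if i = 1 then b u else 0"
  have "smooth_vec n U 2 (Rn 2) ?F"
    unfolding smooth_vec_def
  proof (intro conjI allI impI)
    show "?F \<in> U \<rightarrow> Rn 2" by (simp add: Rn_iff Pi_iff)
    fix i :: nat assume "i < 2"
    then have "i = 0 \<or> i = 1" by linarith
    then show "smooth_fun n U (\<lambda>x. ?F x i)" using ab by auto
  qed
  from plot_compose[OF H U this] show ?thesis by (simp add: comp_def)
qed

lemma plot2_curve:
  assumes "(\<lambda>z. H (z 0) (z 1)) \<in> plots X 2 (Rn 2)"
  shows "curve X (H s)"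
  unfolding curve_iff_plot
  by (rule plot2_compose[OF assms]) (simp_all add: smooth_fun_const smooth_fun_proj)

lemma loop_space_iff: "f \<in> carrier (loop_space X x0) \<longleftrightarrow> curve X f \<and> f 0 = x0 \<and> f 1 = x0"
  by (simp add: loop_space_def fun_diff_def)

text \<open>Smooth paths in the loop space are plots on the plane: in one direction the defining condition of the functional diffeology
is applied to the two coordinates; in the other, every test plot is the plane plot composed with a smooth map.\<close>

lemma loop_space_curve_iff:
  "smooth_map real_line (loop_space X x0) H \<longleftrightarrow>
   (\<lambda>z. H (z 0) (z 1)) \<in> plots X 2 (Rn 2) \<and> (\<forall>s. H s 0 = x0 \<and> H s 1 = x0)"
proof
  assume H: "smooth_map real_line (loop_space X x0) H"
  have id: "(\<lambda>x. x 0) \<in> plots real_line 1 (Rn 1)" by (simp add: smooth_fun_proj)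
  then have "H \<circ> (\<lambda>x. x 0) \<in> plots (loop_space X x0) 1 (Rn 1)" using H unfolding smooth_map_def by blast
  then have "\<forall>m V. \<forall>q\<in>plots real_line m V. (\<lambda>z. (H \<circ> (\<lambda>x. x 0)) (vec_take 1 z) (q (vec_drop 1 z))) \<in> plots X (1 + m) (vec_times 1 (Rn 1) m V)"
    by (simp add: loop_space_def fun_diff_def)
  from bspec[OF spec[OF spec[OF this, of 1], of "Rn 1"], OF id]
  have "(\<lambda>z. H (z 0) (z 1)) \<in> plots X 2 (Rn 2)"
    unfolding vec_times_1_1 by (simp add: vec_take_def vec_drop_def one_add_one)
  moreover have "H s \<in> carrier (loop_space X x0)" for s using H unfolding smooth_map_def by auto
  ultimately show "(\<lambda>z. H (z 0) (z 1)) \<in> plots X 2 (Rn 2) \<and> (\<forall>s. H s 0 = x0 \<and> H s 1 = x0)"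
    by (simp add: loop_space_iff)
next
  assume H: "(\<lambda>z. H (z 0) (z 1)) \<in> plots X 2 (Rn 2) \<and> (\<forall>s. H s 0 = x0 \<and> H s 1 = x0)"
  then have c: "H s \<in> carrier (loop_space X x0)" for s using plot2_curve[of H s] by (simp add: loop_space_iff)
  show "smooth_map real_line (loop_space X x0) H"
    unfolding smooth_map_def
  proof (intro conjI allI ballI)
    show "H \<in> carrier real_line \<rightarrow> carrier (loop_space X x0)" using c by simp
    fix n U p assume "p \<in> plots real_line n U"
    then have p: "open_Rn n U" "smooth_fun n U p" by simp_all
    have "(\<lambda>z. (H \<circ> p) (vec_take n z) (q (vec_drop n z))) \<in> plots X (n + m) (vec_times n U m V)"
      if "q \<in> plots real_line m V" for q m V
    proof -
      have q: "open_Rn m V" "smooth_fun m V q" using that by simp_all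
      have sub: "vec_times n U m V \<subseteq> Rn (n + m)" by (auto simp: vec_times_def)
      have 1: "smooth_fun (n + m) (vec_times n U m V) (\<lambda>z. p (vec_take n z))"
        by (rule smooth_fun_precompose[OF p openin_vec_times[OF p(1) q(1)] sub openin_Rn_UNIV smooth_vec_take]) (auto simp: vec_times_def)
      have 2: "smooth_fun (n + m) (vec_times n U m V) (\<lambda>z. q (vec_drop n z))"
        by (rule smooth_fun_precompose[OF q openin_vec_times[OF p(1) q(1)] sub openin_Rn_UNIV smooth_vec_drop]) (auto simp: vec_times_def)
      have "(\<lambda>z. H (p (vec_take n z)) (q (vec_drop n z))) \<in> plots X (n + m) (vec_times n U m V)"
        by (rule plot2_compose[OF conjunct1[OF H] openin_vec_times[OF p(1) q(1)] 1 2])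
      then show ?thesis by (simp add: comp_def)
    qed
    then show "H \<circ> p \<in> plots (loop_space X x0) n U"
      using p(1) c by (auto simp: loop_space_def fun_diff_def Pi_iff)
  qed
qed

lemma path_homotopicD:
  assumes "path_homotopic X f g"
  shows "curve X f" "curve X g" "g 0 = f 0" "g 1 = f 1"
proof -
  obtain H where H: "(\<lambda>z. H (z 0) (z 1)) \<in> plots X 2 (Rn 2)" "\<And>t. H 0 t = f t" "\<And>t. H 1 t = g t"
    "\<And>s. H s 0 = f 0" "\<And>s. H s 1 = f 1" using assms unfolding path_homotopic_def by blast
  have "H 0 = f" "H 1 = g" using H(2,3) by auto
  then show "curve X f" "curve X g" using plot2_curve[OF H(1)] by metis+
  show "g 0 = f 0" "g 1 = f 1" using H(3)[of 0] H(3)[of 1] H(4,5)[of 1] by simp_all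
qed

lemma smooth_component_rel_loop_space:
  "(f, g) \<in> smooth_component_rel (loop_space X x0) \<longleftrightarrow> f 0 = x0 \<and> f 1 = x0 \<and> path_homotopic X f g"
proof
  assume "(f, g) \<in> smooth_component_rel (loop_space X x0)"
  then obtain H where H: "smooth_map real_line (loop_space X x0) H" "H 0 = f" "H 1 = g"
    unfolding smooth_component_rel_def by blast
  have *: "H s 0 = x0" "H s 1 = x0" for s using H(1) unfolding loop_space_curve_iff by blast+
  have fg: "H 0 t = f t" "H 1 t = g t" for t using H(2,3) by auto
  have f: "f 0 = x0" "f 1 = x0" using *[of 0] fg(1) by auto
  have "path_homotopic X f g" unfolding path_homotopic_def
    by (rule exI[of _ H, OF conjI]) (use H(1) * fg f in \<open>auto simp: loop_space_curve_iff\<close>)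
  with f show "f 0 = x0 \<and> f 1 = x0 \<and> path_homotopic X f g" by blast
next
  assume a: "f 0 = x0 \<and> f 1 = x0 \<and> path_homotopic X f g"
  note d = path_homotopicD[OF conjunct2[OF conjunct2[OF a]]]
  obtain H where H: "(\<lambda>z. H (z 0) (z 1)) \<in> plots X 2 (Rn 2)" "\<And>t. H 0 t = f t" "\<And>t. H 1 t = g t"
    "\<And>s. H s 0 = f 0" "\<And>s. H s 1 = f 1" using a unfolding path_homotopic_def by blast
  have "H 0 = f" "H 1 = g" using H(2,3) by auto
  moreover have "smooth_map real_line (loop_space X x0) H"
    unfolding loop_space_curve_iff using H(1,4,5) a by metis
  ultimately show "(f, g) \<in> smooth_component_rel (loop_space X x0)"
    using d a unfolding smooth_component_rel_def by (auto simp: loop_space_iff)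
qed

lemma path_homotopic_refl: "curve X f \<Longrightarrow> path_homotopic X f f"
  unfolding path_homotopic_def
  by (rule exI[of _ "\<lambda>s. f"]) (simp add: smooth_map_plot[OF _ openin_Rn_UNIV smooth_fun_proj[OF openin_Rn_UNIV]])

lemma path_homotopic_sym: 
  assumes "path_homotopic X f g"
  shows "path_homotopic X g f"
proof -
  note d = path_homotopicD[OF assms]
  obtain H where H: "(\<lambda>z. H (z 0) (z 1)) \<in> plots X 2 (Rn 2)" "\<And>t. H 0 t = f t" "\<And>t. H 1 t = g t"
    "\<And>s. H s 0 = f 0" "\<And>s. H s 1 = f 1" using assms unfolding path_homotopic_def by blast
  have "smooth_fun 2 (Rn 2) (\<lambda>z. - 1 * z 0 + 1)"
    by (rule smooth_fun_coord) (rule smooth_on_affine)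
  then have "(\<lambda>z. H (- 1 * z 0 + 1) (z 1)) \<in> plots X 2 (Rn 2)"
    by (intro plot2_compose[OF H(1)]) (simp_all add: smooth_fun_proj)
  then show ?thesis unfolding path_homotopic_def
    using H(2-5) d(3,4) by (intro exI[of _ "\<lambda>s. H (- 1 * s + 1)"]) simp
qed

lemma plot2_glue:
  fixes i :: nat and K :: "real \<Rightarrow> real \<Rightarrow> 'a"
  assumes "(\<lambda>z. H (z 0) (z 1)) \<in> plots X 2 (Rn 2)" "(\<lambda>z. H' (z 0) (z 1)) \<in> plots X 2 (Rn 2)" "a < b"
    "\<And>z. z i < b \<Longrightarrow> K (z 0) (z 1) = H (z 0) (z 1)" "\<And>z. z i > a \<Longrightarrow> K (z 0) (z 1) = H' (z 0) (z 1)"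
  shows "(\<lambda>z. K (z 0) (z 1)) \<in> plots X 2 (Rn 2)"
proof (rule plot_localI)
  fix u assume u: "u \<in> Rn 2"
  show "\<exists>V p'. open_Rn 2 V \<and> u \<in> V \<and> p' \<in> plots X 2 V \<and> (\<forall>v\<in>V \<inter> Rn 2. K (v 0) (v 1) = p' v)"
  proof (cases "u i < b")
    case True
    have o: "open_Rn 2 {x \<in> Rn 2. x i \<in> {..<b}}" by (rule openin_coord) simp
    show ?thesis
      by (rule exI[of _ "{x \<in> Rn 2. x i \<in> {..<b}}"], rule exI[of _ "\<lambda>z. H (z 0) (z 1)"])
         (use u True assms(4) o plot_restrict[OF assms(1) o] in auto)
  next
    case False
    have o: "open_Rn 2 {x \<in> Rn 2. x i \<in> {a<..}}" by (rule openin_coord) simp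
    show ?thesis
      by (rule exI[of _ "{x \<in> Rn 2. x i \<in> {a<..}}"], rule exI[of _ "\<lambda>z. H' (z 0) (z 1)"])
         (use u False assms(3,5) o plot_restrict[OF assms(2) o] in auto)
  qed
qed simp

lemma plot2_reparam:
  assumes "(\<lambda>z. H (z 0) (z 1)) \<in> plots X 2 (Rn 2)" "smooth_on UNIV a" "smooth_on UNIV b"
  shows "(\<lambda>z. H (a (z 0)) (b (z 1))) \<in> plots X 2 (Rn 2)"
  by (rule plot2_compose[OF assms(1)]) (simp_all add: smooth_fun_coord assms(2,3))

lemma smooth_base_step_affine: "smooth_on UNIV (\<lambda>t. base_step (2 * t))" "smooth_on UNIV (\<lambda>t. base_step (2 * t - 1))"
  using smooth_on_compose_affine[OF smooth_base_step, of 2 0] smooth_on_compose_affine[OF smooth_base_step, of 2 "-1"] by simp_all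

text \<open>Two homotopies are run one after the other, each slowed down by \<open>base_step\<close> so that the result is
independent of the parameter near \<open>1/2\<close>.\<close>

lemma path_homotopic_trans [trans]:
  assumes "path_homotopic X f g" "path_homotopic X g h"
  shows "path_homotopic X f h"
proof -
  note d = path_homotopicD(3,4)[OF assms(1)] path_homotopicD(3,4)[OF assms(2)]
  obtain H where H: "(\<lambda>z. H (z 0) (z 1)) \<in> plots X 2 (Rn 2)" "\<And>t. H 0 t = f t" "\<And>t. H 1 t = g t"
    "\<And>s. H s 0 = f 0" "\<And>s. H s 1 = f 1" using assms(1) unfolding path_homotopic_def by blast
  obtain H' where H': "(\<lambda>z. H' (z 0) (z 1)) \<in> plots X 2 (Rn 2)" "\<And>t. H' 0 t = g t" "\<And>t. H' 1 t = h t"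
    "\<And>s. H' s 0 = g 0" "\<And>s. H' s 1 = g 1" using assms(2) unfolding path_homotopic_def by blast
  let ?K = "\<lambda>s t. if s \<le> 1/2 then H (base_step (2 * s)) t else H' (base_step (2 * s - 1)) t"
  note b = base_step_values
  have "(\<lambda>z. ?K (z 0) (z 1)) \<in> plots X 2 (Rn 2)"
  proof (rule plot2_glue[where a = "1/3" and b = "2/3" and i = 0])
    show "(\<lambda>z. H (base_step (2 * z 0)) (z 1)) \<in> plots X 2 (Rn 2)"
      by (rule plot2_reparam[OF H(1) smooth_base_step_affine(1) smooth_on_id])
    show "(\<lambda>z. H' (base_step (2 * z 0 - 1)) (z 1)) \<in> plots X 2 (Rn 2)"
      by (rule plot2_reparam[OF H'(1) smooth_base_step_affine(2) smooth_on_id])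
  qed (auto simp: b H H')
  then show ?thesis unfolding path_homotopic_def
    by (rule exI[of _ ?K, OF conjI]) (auto simp: b H H' d)
qed

text \<open>The homotopy \<open>k ((1 - s) * \<phi> t + s * \<psi> t)\<close> factors through the curve \<open>k\<close>. It therefore exists in
every diffeological space that has the same curves, in particular in \<open>X\<^sub>1\<close>; all homotopies needed for
the comparison with the geometric loop group are built from homotopies of this kind.\<close>

lemma path_homotopic_reparam:
  assumes k: "curve X k" and s: "smooth_on UNIV \<phi>" "smooth_on UNIV \<psi>" and e: "\<phi> 0 = \<psi> 0" "\<phi> 1 = \<psi> 1"
  shows "path_homotopic X (\<lambda>t. k (\<phi> t)) (\<lambda>t. k (\<psi> t))"
proof -
  let ?H = "\<lambda>s t. k ((1 - s) * \<phi> t + s * \<psi> t)"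
  have "smooth_fun 2 (Rn 2) (\<lambda>z. (- 1 * z 0 + 1) * \<phi> (z 1) + z 0 * \<psi> (z 1))"
    by (intro smooth_fun_add smooth_fun_mult openin_Rn_UNIV smooth_fun_coord smooth_on_affine s smooth_fun_proj)
  then have "(\<lambda>z. k ((- 1 * z 0 + 1) * \<phi> (z 1) + z 0 * \<psi> (z 1))) \<in> plots X 2 (Rn 2)"
    by (rule smooth_map_plot[OF k openin_Rn_UNIV])
  then have "(\<lambda>z. ?H (z 0) (z 1)) \<in> plots X 2 (Rn 2)" by (simp add: algebra_simps)
  then show ?thesis unfolding path_homotopic_def
    by (intro exI[of _ ?H]) (simp add: e algebra_simps)
qed

lemma path_homotopic_flat_step:
  "curve X k \<Longrightarrow> flat_step c V \<Longrightarrow> path_homotopic X k (\<lambda>t. k (c t))"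
  using path_homotopic_reparam[of k "\<lambda>t. t" c] flat_stepD(1,4,5)[of c V] by (simp add: smooth_on_id)

lemma path_homotopic_step_invariant: "step_invariant X x0 (path_homotopic X)"
  unfolding step_invariant_def
proof (intro conjI allI impI)
  show "symp (path_homotopic X)" by (rule sympI) (rule path_homotopic_sym)
  show "transp (path_homotopic X)" by (rule transpI) (rule path_homotopic_trans)
qed (rule path_homotopic_flat_step)

lemmas path_homotopic_join_flat_step = invariant_join_flat_step[OF path_homotopic_step_invariant _ _ refl]
  and path_homotopic_assoc = invariant_assoc[OF path_homotopic_step_invariant _ _ refl]
  and path_homotopic_const_left = invariant_const_left[OF path_homotopic_step_invariant _ _ refl]
  and path_homotopic_const_right = invariant_const_right[OF path_homotopic_step_invariant _ _ refl]

lemma path_homotopic_join: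
  assumes f: "flat f" "flat f'" "path_homotopic X f f'" and g: "flat g" "flat g'" "path_homotopic X g g'" and fg: "f 1 = g 0"
  shows "path_homotopic X (join f g) (join f' g')"
proof -
  note df = path_homotopicD[OF f(3)] and dg = path_homotopicD[OF g(3)]
  note b = base_step_values and fb = flat_base_step
  have fg': "f' 1 = g' 0" using fg df(4) dg(3) by simp
  obtain H where H: "(\<lambda>z. H (z 0) (z 1)) \<in> plots X 2 (Rn 2)" "\<And>t. H 0 t = f t" "\<And>t. H 1 t = f' t"
    "\<And>s. H s 0 = f 0" "\<And>s. H s 1 = f 1" using f(3) unfolding path_homotopic_def by blast
  obtain H' where H': "(\<lambda>z. H' (z 0) (z 1)) \<in> plots X 2 (Rn 2)" "\<And>t. H' 0 t = g t" "\<And>t. H' 1 t = g' t"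
    "\<And>s. H' s 0 = g 0" "\<And>s. H' s 1 = g 1" using g(3) unfolding path_homotopic_def by blast
  let ?K = "\<lambda>s t. if t \<le> 1/2 then H s (base_step (2 * t)) else H' s (base_step (2 * t - 1))"
  have "(\<lambda>z. ?K (z 0) (z 1)) \<in> plots X 2 (Rn 2)"
  proof (rule plot2_glue[where a = "1/3" and b = "2/3" and i = 1])
    show "(\<lambda>z. H (z 0) (base_step (2 * z 1))) \<in> plots X 2 (Rn 2)"
      by (rule plot2_reparam[OF H(1) smooth_on_id smooth_base_step_affine(1)])
    show "(\<lambda>z. H' (z 0) (base_step (2 * z 1 - 1))) \<in> plots X 2 (Rn 2)"
      by (rule plot2_reparam[OF H'(1) smooth_on_id smooth_base_step_affine(2)])
  qed (auto simp: b H H' fg)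
  then have "path_homotopic X (join (\<lambda>t. f (base_step t)) (\<lambda>t. g (base_step t))) (join (\<lambda>t. f' (base_step t)) (\<lambda>t. g' (base_step t)))"
    unfolding path_homotopic_def by (rule exI[of _ ?K, OF conjI]) (auto simp: b H H' join_def)
  with path_homotopic_join_flat_step[OF df(1) f(1) dg(1) g(1) fg fb fb]
  have "path_homotopic X (join f g) (join (\<lambda>t. f' (base_step t)) (\<lambda>t. g' (base_step t)))" by (rule path_homotopic_trans)
  then show ?thesis
    by (rule path_homotopic_trans[OF _ path_homotopic_sym[OF path_homotopic_join_flat_step[OF df(2) f(2) dg(2) g(2) fg' fb fb]]])
qed

text \<open>A curve followed by its reverse is \<open>k \<circ> \<phi>\<close> with \<open>\<phi>\<close> starting and ending at \<open>0\<close>.\<close>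

lemma path_homotopic_backtrack:
  assumes k: "curve X k" and r: "smooth_on UNIV \<rho>" "\<And>t. t \<le> 0 \<Longrightarrow> \<rho> t = 0" "\<And>t. t \<ge> 1 \<Longrightarrow> \<rho> t = 1"
  shows "path_homotopic X (join (\<lambda>t. k (\<rho> t)) (\<lambda>t. k (\<rho> (1 - t)))) (\<lambda>t. k 0)"
proof -
  let ?\<phi> = "\<lambda>t. \<rho> (2 * t) + \<rho> (2 - 2 * t) - 1"
  have "join (\<lambda>t. k (\<rho> t)) (\<lambda>t. k (\<rho> (1 - t))) = (\<lambda>t. k (?\<phi> t))"
    by (auto simp: join_def fun_eq_iff r(2,3) algebra_simps)
  moreover have "smooth_on UNIV ?\<phi>"
    using smooth_on_compose_affine[OF r(1), of 2 0] smooth_on_compose_affine[OF r(1), of "-2" 2]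
    by (intro smooth_on_diff smooth_on_add smooth_on_const) (simp_all add: algebra_simps)
  ultimately show ?thesis
    using path_homotopic_reparam[OF k, of ?\<phi> "\<lambda>t. 0"] r(2)[of 0] r(3)[of 2] by (simp add: smooth_on_const)
qed

lemma stationary_real_loops_iff: "f \<in> stationary_real_loops X x0 \<longleftrightarrow> flat_loop X x0 f"
proof
  assume f: "f \<in> stationary_real_loops X x0"
  then have c: "curve X f" "f 0 = x0" "f 1 = x0"
    by (simp_all add: stationary_real_loops_def loop_space_iff)
  obtain e where e: "0 < e" "e < 1/2" "\<And>t. t < e \<Longrightarrow> f t = x0" "\<And>t. t > 1 - e \<Longrightarrow> f t = x0"
    using f unfolding stationary_real_loops_def by blast
  have "flat f" unfolding flat_def
    by (rule exI[of _ "e/2"]) (use e c in auto)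
  then show "flat_loop X x0 f" using c by (simp add: flat_loop_def)
next
  assume f: "flat_loop X x0 f"
  note d = flat_loopD[OF f]
  obtain e where e: "e > 0" "e < 1/2" "\<And>t. t \<le> e \<Longrightarrow> f t = f 0" "\<And>t. t \<ge> 1 - e \<Longrightarrow> f t = f 1" using d(2) unfolding flat_def by blast
  have "f t = x0" if "t < e" for t using e(3)[of t] that d(3) by simp
  moreover have "f t = x0" if "t > 1 - e" for t using e(4)[of t] that d(4) by simp
  ultimately show "f \<in> stationary_real_loops X x0"
    using d(1,3,4) e(1,2) unfolding stationary_real_loops_def by (auto simp: loop_space_iff)
qed

lemma equiv_smooth_component_rel: "equiv (carrier (loop_space X x0)) (smooth_component_rel (loop_space X x0))"
proof (rule equivI)
  show "smooth_component_rel (loop_space X x0) \<subseteq> carrier (loop_space X x0) \<times> carrier (loop_space X x0)"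
    by (auto simp only: smooth_component_rel_def)
  show "refl_on (carrier (loop_space X x0)) (smooth_component_rel (loop_space X x0))"
    by (rule refl_onI) (simp add: smooth_component_rel_loop_space loop_space_iff path_homotopic_refl)
  show "sym (smooth_component_rel (loop_space X x0))"
    unfolding sym_def smooth_component_rel_loop_space using path_homotopicD(3,4) path_homotopic_sym by metis
  show "trans (smooth_component_rel (loop_space X x0))"
    unfolding trans_def smooth_component_rel_loop_space using path_homotopic_trans by metis
qed

lemma flat_loop_in_loop_space: "flat_loop X x0 f \<Longrightarrow> f \<in> carrier (loop_space X x0)"
  by (simp add: flat_loop_def loop_space_iff)

lemma pi1_class_eqI:
  assumes "f 0 = x0" "f 1 = x0" "path_homotopic X f g"
  shows "pi1_class X x0 f = pi1_class X x0 g"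
  unfolding pi1_class_def by (rule equiv_class_eq[OF equiv_smooth_component_rel])
    (simp add: smooth_component_rel_loop_space assms)

lemma smooth_pi1_carrier: "A \<in> carrier (smooth_pi1 X x0) \<longleftrightarrow> (\<exists>f. flat_loop X x0 f \<and> A = pi1_class X x0 f)"
proof
  assume "A \<in> carrier (smooth_pi1 X x0)"
  then have "A \<in> carrier (loop_space X x0) // smooth_component_rel (loop_space X x0)" by (simp add: smooth_pi1_def)
  then obtain f where f: "f \<in> carrier (loop_space X x0)" "A = pi1_class X x0 f"
    unfolding pi1_class_def by (rule quotientE)
  have c: "curve X f" "f 0 = x0" "f 1 = x0" using f(1) by (simp_all add: loop_space_iff)
  let ?g = "\<lambda>t. f (base_step t)"
  have "flat_loop X x0 ?g"
    using curve_compose[OF c(1) smooth_base_step] flat_compose_flat_step[OF flat_base_step] c(2,3) by (simp add: flat_loop_def base_step_values)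
  moreover have "A = pi1_class X x0 ?g"
    unfolding f(2) by (rule pi1_class_eqI[OF c(2,3) path_homotopic_flat_step[OF c(1) flat_base_step]])
  ultimately show "\<exists>f. flat_loop X x0 f \<and> A = pi1_class X x0 f" by blast
next
  assume "\<exists>f. flat_loop X x0 f \<and> A = pi1_class X x0 f"
  then show "A \<in> carrier (smooth_pi1 X x0)"
    using flat_loop_in_loop_space by (auto simp: smooth_pi1_def pi1_class_def intro: quotientI)
qed

lemma smooth_pi1_mult:
  assumes "flat_loop X x0 f" "flat_loop X x0 g"
  shows "pi1_class X x0 f \<otimes>\<^bsub>smooth_pi1 X x0\<^esub> pi1_class X x0 g = pi1_class X x0 (join f g)"
proof -
  let ?A = "pi1_class X x0 f \<inter> stationary_real_loops X x0" and ?B = "pi1_class X x0 g \<inter> stationary_real_loops X x0"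
  have eq: "pi1_class X x0 (join f' g') = pi1_class X x0 (join f g)" if A: "f' \<in> ?A" and B: "g' \<in> ?B" for f' g'
  proof -
    have f': "flat_loop X x0 f'" "path_homotopic X f f'" and g': "flat_loop X x0 g'" "path_homotopic X g g'"
      using A B by (auto simp: pi1_class_def stationary_real_loops_iff smooth_component_rel_loop_space)
    note d = flat_loopD[OF assms(1)] flat_loopD[OF assms(2)]
    have "path_homotopic X (join f g) (join f' g')"
      by (rule path_homotopic_join[OF d(2) flat_loopD(2)[OF f'(1)] f'(2) d(6) flat_loopD(2)[OF g'(1)] g'(2)]) (simp add: d)
    then show ?thesis using pi1_class_eqI[of "join f g" x0 "join f' g'"] flat_loopD(3,4)[OF flat_loop_join[OF assms]] by simp
  qed
  have "f \<in> ?A" "g \<in> ?B"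
    using assms flat_loopD[OF assms(1)] flat_loopD[OF assms(2)]
    by (simp_all add: pi1_class_def stationary_real_loops_iff smooth_component_rel_loop_space path_homotopic_refl)
  moreover have "(\<Union>f'\<in>?A. \<Union>g'\<in>?B. pi1_class X x0 (join f' g')) = (\<Union>f'\<in>?A. \<Union>g'\<in>?B. pi1_class X x0 (join f g))"
    using eq by (intro SUP_cong refl)
  ultimately have "(\<Union>f'\<in>?A. \<Union>g'\<in>?B. pi1_class X x0 (join f' g')) = pi1_class X x0 (join f g)" by blast
  then show ?thesis by (simp add: smooth_pi1_def)
qed

lemma smooth_pi1_one: "\<one>\<^bsub>smooth_pi1 X x0\<^esub> = pi1_class X x0 (\<lambda>t. x0)"
  by (simp add: smooth_pi1_def)

theorem group_smooth_pi1:
  assumes "x0 \<in> carrier X"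
  shows "group (smooth_pi1 X x0)"
proof (rule group_of_flat_loops[where G = "smooth_pi1 X x0" and cls = "pi1_class X x0",
      OF path_homotopic_step_invariant assms smooth_pi1_carrier smooth_pi1_mult smooth_pi1_one])
  fix f assume f: "flat_loop X x0 f"
  note r = flat_loop_rev[OF f] and d = flat_loopD[OF f]
  show "pi1_class X x0 f = pi1_class X x0 g" if "path_homotopic X f g" for g
    by (rule pi1_class_eqI[OF d(3,4) that])
  have "path_homotopic X (join (\<lambda>t. f (1 - t)) f) (join (\<lambda>t. f (1 - base_step t)) (\<lambda>t. f (base_step t)))"
    using path_homotopic_join_flat_step[OF flat_loopD(1,2)[OF r] d(1,2) _ flat_base_step flat_base_step] by simp
  also have "path_homotopic X (join (\<lambda>t. f (1 - base_step t)) (\<lambda>t. f (base_step t))) (\<lambda>t. x0)"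
    using path_homotopic_backtrack[OF flat_loopD(1)[OF r] smooth_base_step] d(4)
    by (simp add: base_step_values base_step_symmetric)
  finally show "path_homotopic X (join (\<lambda>t. f (1 - t)) f) (\<lambda>t. x0)" .
qed

end

declare One_nat_def [simp]

section \<open>From the geometric loop group to the fundamental group of the 1-skeletal space\<close>

context diffeological_space
begin

text \<open>Here \<open>\<gamma>\<close> is defined on \<open>[0, 1]\<close> only. The lifts of the two steps through the folding map take the
role of the reparametrizations of the curve \<open>\<gamma> \<circ> sin_fold\<close>.\<close>

lemma path_homotopic_flat_steps:
  assumes k: "curve X (\<lambda>x. \<gamma> (sin_fold x))" and c: "flat_step c V" "flat_step c' V'"
  shows "path_homotopic X (\<lambda>t. \<gamma> (c t)) (\<lambda>t. \<gamma> (c' t))"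
proof -
  note l = flat_step_lift[OF c(1)] and l' = flat_step_lift[OF c(2)]
  have "path_homotopic X (\<lambda>t. \<gamma> (sin_fold (fold_lift c t))) (\<lambda>t. \<gamma> (sin_fold (fold_lift c' t)))"
    by (rule path_homotopic_reparam[where k = "\<lambda>x. \<gamma> (sin_fold x)" and \<phi> = "fold_lift c" and \<psi> = "fold_lift c'", OF k l(1) l'(1)])
       (simp_all add: l(5,6) l'(5,6))
  then show ?thesis by (simp add: l(2) l'(2))
qed

lemma path_homotopic_backtrack_smoothed:
  assumes k: "curve X (\<lambda>x. \<beta> (sin_fold x))"
  shows "path_homotopic X (join (smoothed \<beta>) (\<lambda>t. smoothed \<beta> (1 - t))) (\<lambda>t. \<beta> 0)"
proof -
  note l = flat_step_lift[OF flat_base_step]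
  show ?thesis
    using path_homotopic_backtrack[where k = "\<lambda>x. \<beta> (sin_fold x)" and \<rho> = "fold_lift base_step", OF k l(1,5,6)]
    by (simp add: l(2) smoothed_def)
qed

lemma path_homotopic_cancel:
  assumes f: "curve X f" "flat f" and g: "curve X g" "flat g"
    and k: "curve X (\<lambda>x. \<beta> (sin_fold x))" and e: "f 1 = \<beta> 0" "\<beta> 0 = g 0"
  shows "path_homotopic X (join (join (join f (smoothed \<beta>)) (\<lambda>t. smoothed \<beta> (1 - t))) g) (join f g)"
proof -
  let ?B = "smoothed \<beta>" and ?B' = "\<lambda>t. smoothed \<beta> (1 - t)"
  have B: "curve X ?B" "flat ?B"
    using curve_compose[OF k flat_step_lift(1)[OF flat_base_step]] smoothed_flat
    by (simp_all add: flat_step_lift(2)[OF flat_base_step] smoothed_def)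
  note B' = curve_rev[OF B(1)] flat_rev[OF B(2)]
  have fB: "f 1 = ?B 0" using e by simp
  have BB': "?B 1 = ?B' 0" by simp
  note fBj = curve_flat_join_simps[OF f B fB] and BB'j = curve_flat_join_simps[OF B B' BB']
  have fBB': "join f ?B 1 = ?B' 0" using fBj(4) by simp
  note fBB'j = curve_flat_join_simps[OF fBj(1,2) B' fBB']
  have "path_homotopic X (join (join f ?B) ?B') (join f (join ?B ?B'))"
    by (rule path_homotopic_assoc[OF f B B' fB BB'])
  also have "path_homotopic X \<dots> (join f (\<lambda>t. \<beta> 0))"
    by (rule path_homotopic_join[OF f(2) f(2) path_homotopic_refl[OF f(1)] BB'j(2) flat_const path_homotopic_backtrack_smoothed[OF k]])
       (simp add: BB'j(3) e)
  also have "path_homotopic X \<dots> f" using path_homotopic_const_right[OF f] e(1) by simp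
  finally have "path_homotopic X (join (join f ?B) ?B') f" .
  then show ?thesis
    by (rule path_homotopic_join[OF fBB'j(2) f(2) _ g(2) g(2) path_homotopic_refl[OF g(1)]]) (simp add: fBB'j(4) e(2)[symmetric])
qed

interpretation sk: diffeological_space "one_skeletal X"
  by (rule one_skeletal_diffeological[OF diffeological_space_axioms])

lemma skeletal_fold_curve: "\<gamma> \<in> smooth_paths X \<Longrightarrow> curve (one_skeletal X) (\<lambda>x. \<gamma> (sin_fold x))"
  unfolding one_skeletal_curve_iff by (rule fold_curve[where k = "\<lambda>x. x", OF _ smooth_on_id])

text \<open>The generators of the equivalence of paths become homotopies in \<open>X\<^sub>1\<close>: a changed flat step by
\<open>path_homotopic_flat_steps\<close>, a backtrack by contraction along itself.\<close>

lemma geo_step_path_homotopic: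
  assumes st: "geo_step X x0 \<gamma> \<gamma>'"
  shows "path_homotopic (one_skeletal X) (smoothed \<gamma>) (smoothed \<gamma>')"
proof -
  note b = flat_base_step
  have \<gamma>: "\<gamma> \<in> smooth_paths X" "\<gamma>' \<in> smooth_paths X"
    using geo_step_ends[OF st] by (auto simp: path_space_iff)
  note F = sk.path_homotopic_flat_steps[OF skeletal_fold_curve[OF \<gamma>(1)]]
    and F' = sk.path_homotopic_flat_steps[OF skeletal_fold_curve[OF \<gamma>(2)]]
  from st show ?thesis
  proof (cases rule: geo_step_normal_form)
    case (reparam c V)
    show ?thesis unfolding reparam(2) using F[OF b reparam(1)] by (simp only: smoothed_def)
  next
    case (cancel A \<beta> N c V c' V')
    have "path_homotopic (one_skeletal X) (smoothed \<gamma>) (\<lambda>t. \<gamma> (c t))"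
      using F[OF b cancel(10)] unfolding smoothed_def .
    also have "path_homotopic (one_skeletal X) \<dots> (\<lambda>t. \<gamma>' (c' t))"
      unfolding cancel(11,13)
      by (rule sk.path_homotopic_cancel[OF _ cancel(2) _ cancel(4) skeletal_fold_curve[OF cancel(5)] cancel(6,7)])
         (simp_all add: one_skeletal_curve_iff cancel(1,3))
    also have "path_homotopic (one_skeletal X) \<dots> (smoothed \<gamma>')"
      using F'[OF cancel(12) b] unfolding smoothed_def .
    finally show ?thesis .
  qed
qed

lemma geo_equiv_path_homotopic:
  assumes "geo_equiv X x0 \<gamma> \<gamma>'" "\<gamma> \<in> smooth_paths X"
  shows "path_homotopic (one_skeletal X) (smoothed \<gamma>) (smoothed \<gamma>')"
  using assms
proof (induction rule: equivclp_induct)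
  case base
  then show ?case by (intro sk.path_homotopic_refl) (simp add: one_skeletal_curve_iff smoothed_curve)
next
  case (step y z)
  have "path_homotopic (one_skeletal X) (smoothed y) (smoothed z)"
    using step.hyps(2)
  proof
    assume "geo_step X x0 y z"
    then show ?thesis by (rule geo_step_path_homotopic)
  next
    assume "geo_step X x0 z y"
    then show ?thesis by (rule sk.path_homotopic_sym[OF geo_step_path_homotopic])
  qed
  with step.IH[OF step.prems] show ?case by (rule sk.path_homotopic_trans)
qed

lemma flat_loop_one_skeletal: "flat_loop (one_skeletal X) x0 f \<longleftrightarrow> flat_loop X x0 f"
  by (simp add: flat_loop_def one_skeletal_curve_iff)

text \<open>The union is a single class by \<open>geo_equiv_path_homotopic\<close>.\<close>

definition loop_hom :: "'a \<Rightarrow> (real \<Rightarrow> 'a) set \<Rightarrow> (real \<Rightarrow> 'a) set" where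
  "loop_hom x0 A = (\<Union>\<gamma>\<in>A. pi1_class (one_skeletal X) x0 (smoothed \<gamma>))"

text \<open>On classes of flat loops the map is induced by the identity, which makes it multiplicative,
surjective and compatible with the projections.\<close>

lemma loop_hom_class:
  assumes f: "flat_loop X x0 f"
  shows "loop_hom x0 (geo_class X x0 (unit_path f)) = pi1_class (one_skeletal X) x0 f"
proof -
  note p = flat_loop_path[OF f] and d = flat_loopD[OF f]
  have "pi1_class (one_skeletal X) x0 (smoothed \<gamma>) = pi1_class (one_skeletal X) x0 f"
    if "\<gamma> \<in> geo_class X x0 (unit_path f)" for \<gamma>
  proof -
    have "geo_equiv X x0 (unit_path f) \<gamma>" using that by (simp add: geo_class_def geo_rel_iff)
    moreover have "unit_path f \<in> smooth_paths X" using p by (simp add: path_space_iff)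
    ultimately have "path_homotopic (one_skeletal X) (smoothed (unit_path f)) (smoothed \<gamma>)"
      by (rule geo_equiv_path_homotopic)
    moreover have "path_homotopic (one_skeletal X) f (smoothed (unit_path f))"
      unfolding smoothed_unit by (rule sk.path_homotopic_flat_step[OF _ flat_base_step]) (simp add: one_skeletal_curve_iff d(1))
    ultimately have "path_homotopic (one_skeletal X) f (smoothed \<gamma>)" using sk.path_homotopic_trans by blast
    then show ?thesis using sk.pi1_class_eqI[OF d(3,4)] by metis
  qed
  moreover have "unit_path f \<in> geo_class X x0 (unit_path f)"
    unfolding geo_class_def by (rule equiv_class_self[OF equiv_geo_rel p])
  ultimately show ?thesis unfolding loop_hom_def by blast
qed

lemma loop_hom_group_hom:
  assumes "x0 \<in> carrier X"
  shows "group_hom (geo_loop_group X x0) (smooth_pi1 (one_skeletal X) x0) (loop_hom x0)"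
proof -
  have "loop_hom x0 \<in> hom (geo_loop_group X x0) (smooth_pi1 (one_skeletal X) x0)"
  proof (rule homI)
    show "loop_hom x0 A \<in> carrier (smooth_pi1 (one_skeletal X) x0)" if A: "A \<in> carrier (geo_loop_group X x0)" for A
      using A loop_hom_class unfolding geo_loop_group_carrier sk.smooth_pi1_carrier flat_loop_one_skeletal by blast
    fix A B assume "A \<in> carrier (geo_loop_group X x0)" "B \<in> carrier (geo_loop_group X x0)"
    then obtain f g where f: "flat_loop X x0 f" "A = geo_class X x0 (unit_path f)"
      and g: "flat_loop X x0 g" "B = geo_class X x0 (unit_path g)"
      unfolding geo_loop_group_carrier by blast
    show "loop_hom x0 (A \<otimes>\<^bsub>geo_loop_group X x0\<^esub> B) = loop_hom x0 A \<otimes>\<^bsub>smooth_pi1 (one_skeletal X) x0\<^esub> loop_hom x0 B"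
      unfolding f(2) g(2) geo_loop_group_mult[OF f(1) g(1)] loop_hom_class[OF f(1)] loop_hom_class[OF g(1)]
        loop_hom_class[OF flat_loop_join[OF f(1) g(1)]]
      by (rule sk.smooth_pi1_mult[symmetric]) (simp_all add: flat_loop_one_skeletal f(1) g(1))
  qed
  then show ?thesis
    using group_geo_loop_group[OF assms] sk.group_smooth_pi1[of x0] assms
    by (simp add: group_hom_def group_hom_axioms_def)
qed

lemma loop_hom_surj: "loop_hom x0 ` carrier (geo_loop_group X x0) = carrier (smooth_pi1 (one_skeletal X) x0)"
proof -
  have "A \<in> loop_hom x0 ` carrier (geo_loop_group X x0) \<longleftrightarrow> A \<in> carrier (smooth_pi1 (one_skeletal X) x0)" for A
    unfolding image_iff Bex_def geo_loop_group_carrier sk.smooth_pi1_carrier flat_loop_one_skeletal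
    using loop_hom_class by metis
  then show ?thesis by blast
qed

lemma loop_hom_q_geo:
  assumes "\<gamma> \<in> stationary_loops X x0"
  shows "loop_hom x0 (q_geo X x0 \<gamma>) = q_one X x0 \<gamma>"
  using loop_hom_class[OF flat_loop_ext(1)[OF assms]] unfolding flat_loop_ext(2)[OF assms]
  by (simp add: q_geo_def q_one_def loop_ext_def)

end

theorem lemma6p1p13:
  fixes X :: "'a diffeology" and x0 :: 'a
  assumes "diffeological_space X" and "x0 \<in> carrier X"
  shows "\<exists>\<theta>. group_hom (geo_loop_group X x0) (smooth_pi1 (one_skeletal X) x0) \<theta> \<and>
    \<theta> ` carrier (geo_loop_group X x0) = carrier (smooth_pi1 (one_skeletal X) x0) \<and>
    (\<forall>\<gamma> \<in> stationary_loops X x0. \<theta> (q_geo X x0 \<gamma>) = q_one X x0 \<gamma>)"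
proof -
  interpret diffeological_space X by (rule assms(1))
  show ?thesis
    using loop_hom_group_hom[OF assms(2)] loop_hom_surj loop_hom_q_geo by blast
qed

end
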